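(* Let $n$ be a positive integer, $G=\mathbb{F}_2^n$, and let $f:G\to\mathbb{R}$ be integer-valued with $\|f\|_A\le M$. Then there are subspaces $V_1,\dots,V_L\le G$ and signs $\varepsilon_1,\dots,\varepsilon_L\in\{-1,1\}$ such that $$f=\sum_{i=1}^L \varepsilon_i 1_{V_i}\quad\text{and}\quad L\le \exp\left(M^{3+o(1)}\right),$$ where $o(1)$ denotes a quantity tending to $0$ as $M\to\infty$, uniformly in $n$ and $f$.
   Context: For $f:G\to\mathbb{R}$ with $G=\mathbb{F}_2^n$, the Fourier transform is $\widehat{f}(r)=\mathbb{E}_{x\in G} f(x)(-1)^{r^t x}=\frac{1}{|G|}\sum_{x\in G}f(x)(-1)^{r^tx}$ for $r\in G$, and the spectral norm is $\|f\|_A=\sum_{r\in G}|\widehat{f}(r)|$. $V\le G$ means that $V$ is a linear subspace of $G$; $1_V$ is its indicator function. The case $L=0$ (empty sum, equal to $0$) is allowed. The bound $L\le\exp(M^{3+o(1)})$ means: for every $\delta>0$ there is $M_0=M_0(\delta)$, not depending on $n$ or $f$, such that for all $M\ge M_0$ one can take $L\le\exp(M^{3+\delta})$. *)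

theory Defs
  imports
    "Jordan_Normal_Form.VS_Connect"
    "HOL-Library.Z2"
    "HOL-Library.Indicator_Function"
    Complex_Main
begin

text \<open>
  The group \<open>G = F_2^n\<close> is the carrier \<open>F2 n\<close>, so that the dimension \<open>n\<close> is an ordinary
  natural number that can be quantified over inside a formula. A function on \<open>G\<close> is represented
  by a total function on \<^typ>\<open>bit vec\<close> whose values outside \<open>F2 n\<close> are never used.
\<close>

abbreviation F2 :: "nat \<Rightarrow> bit vec set" where
  "F2 n \<equiv> carrier_vec n"

definition fourier_transform :: "nat \<Rightarrow> (bit vec \<Rightarrow> real) \<Rightarrow> bit vec \<Rightarrow> real" where
  "fourier_transform n f r =
     (1 / real (card (F2 n))) * (\<Sum>x\<in>F2 n. f x * (- 1) ^ (of_bit (r \<bullet> x) :: nat))"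

definition spectral_norm :: "nat \<Rightarrow> (bit vec \<Rightarrow> real) \<Rightarrow> real" where
  "spectral_norm n f = (\<Sum>r\<in>F2 n. \<bar>fourier_transform n f r\<bar>)"

abbreviation subspace_F2 :: "nat \<Rightarrow> bit vec set \<Rightarrow> bool" where
  "subspace_F2 n V \<equiv> VectorSpace.subspace class_ring V (module_vec TYPE(bit) n)"

end

theory Submission
  imports Defs "HOL-Library.FuncSet" "HOL-Library.Function_Algebras" "HOL-Analysis.Convex"
    "HOL-Real_Asymp.Real_Asymp"
begin

text \<open>
  Starting from \<open>f\<^sub>0 = z\<^sub>0 = f\<close>, the proof maintains an integer-valued \<open>z\<^sub>i\<close> and a function \<open>f\<^sub>i\<close> uniformly
  close to it with \<open>\<parallel>f\<^sub>i\<parallel>\<^sub>A \<le> M - i/2\<close>. If \<open>z\<^sub>i \<noteq> 0\<close>, one finds a subspace \<open>V\<close> such that averaging over the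
  cosets of \<open>V\<close> gives an almost integer-valued function whose rounding \<open>g\<close> is nonzero and lives on at
  most \<open>exp (M^(3 + o(1)))\<close> cosets of \<open>V\<close>, and puts \<open>f\<^sub>i\<^sub>+\<^sub>1 = f\<^sub>i - f\<^sub>i * \<mu>\<^sub>V\<close>, \<open>z\<^sub>i\<^sub>+\<^sub>1 = z\<^sub>i - g\<close>. The norm
  drops by at least \<open>1/2\<close>, so there are \<open>O(M)\<close> steps; the uniform error at most doubles in each of them,
  so that an initial precision of \<open>exp (- O(M))\<close> suffices.

  Each \<open>g\<close> is killed by the projection \<open>1 - \<mu>\<^sub>V\<close>, so \<open>f\<^sub>i\<close> is a Fourier projection of \<open>z\<^sub>i\<close> and
  \<open>\<parallel>f\<^sub>i\<parallel>\<^sub>2 \<le> \<parallel>z\<^sub>i\<parallel>\<^sub>2\<close>. By Cauchy--Schwarz the support of \<open>z\<^sub>i\<close> then has additive energy at least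
  \<open>M^(-O(1))\<close> times the trivial bound. Hence the Balog--Szemeredi--Gowers lemma and a quasi-polynomial
  Bogolyubov--Ruzsa lemma (Croot--Sisask almost periodicity and Chang's theorem) give a subspace \<open>H\<close> on a
  coset of which the support has density at least \<open>exp (- (log M)^O(1))\<close>. Finally, maximising
  \<open>\<parallel>f * \<mu>\<^sub>V\<parallel>\<^sub>A - \<eta> codim V\<close> over \<open>V \<le> H\<close> yields \<open>V\<close> of codimension \<open>O(M\<^sup>2 p)\<close> in \<open>H\<close> such that on every
  coset of \<open>V\<close> the function is within \<open>1/4\<close> of its mean outside a proportion \<open>exp (- p)\<close>; take \<open>p\<close> of
  order \<open>M\<close>.
\<close>

section \<open>Fourier analysis on finite groups of exponent two\<close>

text \<open>The exponent 3 is a product of two costs. To push the exceptional proportion on cosets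
  down to \<open>exp (- p)\<close>, the Fourier mass per dimension has to be brought down to order
  \<open>1 / (M * p)\<close>; as the total mass is at most \<open>M\<close>, this takes a
  codimension of order \<open>M\<^sup>2 * p\<close>. Doubling of errors over about
  \<open>2 * M\<close> steps forces \<open>p\<close> to be of order \<open>M\<close>. Whatever is
  spent on finding \<open>H\<close> is quasi-polynomial in \<open>M\<close> and disappears in the
  constant. The passage through \<open>H\<close> is forced by sparsity. The support of
  \<open>z\<^sub>i\<close> may have a density in \<open>G\<close> below any function of
  \<open>M\<close>, and then the average over every subspace whose codimension in \<open>G\<close>
  is bounded in terms of \<open>M\<close> would round to zero. In a coset of \<open>H\<close> the
  support is denser than the exceptional proportion, so the rounding survives. Moreover
  \<open>H\<close> is at least as large as the support up to a quasi-polynomial factor; this bounds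
  the number of cosets without reference to \<open>n\<close>.\<close>

locale F2_pairing =
  fixes G :: "'a::ab_group_add set" and e :: "'a \<Rightarrow> 'a \<Rightarrow> real"
  assumes double: "\<And>x::'a. x + x = 0"
    and finG: "finite G" and zeroG: "0 \<in> G"
    and addG: "\<And>x y. x \<in> G \<Longrightarrow> y \<in> G \<Longrightarrow> x + y \<in> G"
    and e_sym: "\<And>r x. e r x = e x r"
    and e_add: "\<And>r x y. e r (x + y) = e r x * e r y"
    and e_vals: "\<And>r x. e r x = 1 \<or> e r x = -1"
    and nondeg: "\<And>r. r \<in> G \<Longrightarrow> r \<noteq> 0 \<Longrightarrow> \<exists>x\<in>G. e r x = -1"
begin

text \<open>The dual group is identified with \<open>G\<close> through the symmetric pairing
  \<open>e\<close>, so spectra, annihilators and subspaces all live in one type.\<close>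

definition hat :: "('a \<Rightarrow> real) \<Rightarrow> 'a \<Rightarrow> real" where
  "hat f r = (\<Sum>x\<in>G. f x * e r x) / card G"

definition anorm :: "('a \<Rightarrow> real) \<Rightarrow> real" where
  "anorm f = (\<Sum>r\<in>G. \<bar>hat f r\<bar>)"

definition sub :: "'a set \<Rightarrow> bool" where
  "sub V \<longleftrightarrow> V \<subseteq> G \<and> 0 \<in> V \<and> (\<forall>x\<in>V. \<forall>y\<in>V. x + y \<in> V)"

definition perp :: "'a set \<Rightarrow> 'a set" where
  "perp V = {r \<in> G. \<forall>x\<in>V. e r x = 1}"

text \<open>This is \<open>f\<close> convolved with the uniform probability measure on
  \<open>V\<close>; by \<open>hat_avg\<close> it is the Fourier projection onto
  \<open>perp V\<close>.\<close>

definition avg :: "'a set \<Rightarrow> ('a \<Rightarrow> real) \<Rightarrow> 'a \<Rightarrow> real" where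
  "avg V f x = (\<Sum>v\<in>V. f (x + v)) / card V"

lemma uminus_id [simp]: "- x = (x::'a)"
  using double[of x] by (metis minus_unique)

lemma add_self_left [simp]: "x + (x + y) = (y::'a)"
  by (metis add.assoc double add_0)

lemma add_self [simp]: "x + x = (0::'a)" by (rule double)

lemma add_eq_0: "x + y = 0 \<longleftrightarrow> x = (y::'a)"
  by (metis add_self_left add_0_right double)

lemma e_add_left: "e (r + s) x = e r x * e s x"
  by (metis e_add e_sym)

lemma e_zero [simp]: "e r 0 = 1" "e 0 r = 1"
proof -
  have "e r 0 = e r 0 * e r 0" using e_add[of r 0 0] by simp
  then show "e r 0 = 1" using e_vals[of r 0] by auto
  then show "e 0 r = 1" using e_sym by metis
qed

lemma e_sq [simp]: "e r x * e r x = 1"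
  using e_vals[of r x] by auto

lemma e_sq_left [simp]: "e r x * (e r x * z) = z"
  by (simp flip: mult.assoc)

lemma abs_e [simp]: "\<bar>e r x\<bar> = 1"
  using e_vals[of r x] by auto

lemma cardG_pos [simp]: "card G > 0"
  using finG zeroG card_gt_0_iff by blast

lemma subD: "sub V \<Longrightarrow> V \<subseteq> G" "sub V \<Longrightarrow> 0 \<in> V"
  "sub V \<Longrightarrow> x \<in> V \<Longrightarrow> y \<in> V \<Longrightarrow> x + y \<in> V" "sub V \<Longrightarrow> x \<in> V \<Longrightarrow> x \<in> G"
  by (auto simp: sub_def)

lemma sub_finite: "sub V \<Longrightarrow> finite V"
  using finG finite_subset subD(1) by blast

lemma sub_card_pos: "sub V \<Longrightarrow> card V > 0"
  using sub_finite subD(2) card_gt_0_iff by blast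

lemma sub_G: "sub G"
  using zeroG addG by (auto simp: sub_def)

lemma sub_0: "sub {0}"
  using zeroG by (auto simp: sub_def)

lemma sub_perp: "sub (perp V)"
  using zeroG addG by (auto simp: sub_def perp_def e_add_left)

lemma perp_G: "perp G = {0}"
  using nondeg zeroG by (force simp: perp_def)

lemma shift_bij: "sub V \<Longrightarrow> y \<in> V \<Longrightarrow> bij_betw (\<lambda>x. x + y) V V"
  by (rule bij_betwI[where g = "\<lambda>x. x + y"]) (auto simp: subD add.assoc)

lemma sum_shift: "sub V \<Longrightarrow> y \<in> V \<Longrightarrow> (\<Sum>x\<in>V. h (x + y)) = (\<Sum>x\<in>V. h x)"
  using sum.reindex_bij_betw[OF shift_bij] by metis

lemma sum_shift': "sub V \<Longrightarrow> y \<in> V \<Longrightarrow> (\<Sum>x\<in>V. h (y + x)) = (\<Sum>x\<in>V. h x)"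
  using sum_shift[of V y h] by (simp add: add.commute)

lemma sum_e:
  assumes "sub V" "r \<in> G"
  shows "(\<Sum>x\<in>V. e r x) = (if r \<in> perp V then real (card V) else 0)"
proof (cases "r \<in> perp V")
  case True
  then show ?thesis by (simp add: perp_def)
next
  case False
  then obtain y where y: "y \<in> V" "e r y = -1"
    using assms(2) e_vals unfolding perp_def by blast
  have "(\<Sum>x\<in>V. e r x) = (\<Sum>x\<in>V. e r (x + y))"
    by (rule sum_shift[symmetric]) (use assms y in auto)
  also have "\<dots> = - (\<Sum>x\<in>V. e r x)"
    by (simp add: e_add y sum_negf)
  finally show ?thesis using False by simp
qed

lemma sum_eG: "r \<in> G \<Longrightarrow> (\<Sum>x\<in>G. e r x) = (if r = 0 then real (card G) else 0)"
  using sum_e[OF sub_G] by (simp add: perp_G)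

lemma sum_eG': "x \<in> G \<Longrightarrow> (\<Sum>r\<in>G. e r x) = (if x = 0 then real (card G) else 0)"
  using sum_eG[of x] by (subst e_sym)

text \<open>The characters are summed over \<open>G \<times> V\<close> in both orders: orthogonality
  on \<open>V\<close> leaves \<open>perp V\<close>, orthogonality on \<open>G\<close> leaves only
  \<open>x = 0\<close>.\<close>

lemma card_perp:
  assumes "sub V" shows "card V * card (perp V) = card G"
proof -
  have "(\<Sum>r\<in>G. \<Sum>x\<in>V. e r x) = (\<Sum>r\<in>G. if r \<in> perp V then real (card V) else 0)"
    by (rule sum.cong) (use sum_e assms in auto)
  also have "\<dots> = (\<Sum>r\<in>perp V. real (card V))"
    by (rule sum.mono_neutral_cong_right) (use finG in \<open>auto simp: perp_def\<close>)
  finally have 1: "(\<Sum>r\<in>G. \<Sum>x\<in>V. e r x) = real (card V * card (perp V))" by simp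
  have "(\<Sum>r\<in>G. \<Sum>x\<in>V. e r x) = (\<Sum>x\<in>V. \<Sum>r\<in>G. e r x)" by (rule sum.swap)
  also have "\<dots> = (\<Sum>x\<in>V. if x = 0 then real (card G) else 0)"
    by (rule sum.cong) (use sum_eG' assms subD in auto)
  also have "\<dots> = real (card G)"
    using assms by (simp add: sub_finite subD)
  finally show ?thesis using 1 by linarith
qed

lemma perp_perp:
  assumes "sub V" shows "perp (perp V) = V"
proof -
  have 1: "V \<subseteq> perp (perp V)"
    using assms subD(1) by (auto simp: perp_def e_sym)
  have "card V * card (perp V) = card (perp (perp V)) * card (perp V)"
    using card_perp[OF assms] card_perp[OF sub_perp[of V]] by (simp add: mult.commute)
  then have "card V = card (perp (perp V))"
    using sub_card_pos[OF sub_perp[of V]] by simp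
  with 1 show ?thesis
    using card_subset_eq sub_finite[OF sub_perp] by metis
qed

lemma perp_mono: "V \<subseteq> W \<Longrightarrow> perp W \<subseteq> perp V"
  by (auto simp: perp_def)

lemma fourier_inversion:
  assumes "x \<in> G" shows "(\<Sum>r\<in>G. hat f r * e r x) = f x"
proof -
  have "(\<Sum>r\<in>G. hat f r * e r x) = (\<Sum>r\<in>G. \<Sum>y\<in>G. f y / card G * e r (x + y))"
    by (simp add: hat_def e_add sum_distrib_left sum_distrib_right sum_divide_distrib mult_ac)
  also have "\<dots> = (\<Sum>y\<in>G. f y / card G * (\<Sum>r\<in>G. e r (x + y)))"
    by (subst sum.swap) (simp add: sum_distrib_left)
  also have "\<dots> = (\<Sum>y\<in>G. if y = x then f y else 0)"
    by (rule sum.cong) (use sum_eG' addG assms in \<open>auto simp: add_eq_0\<close>)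
  also have "\<dots> = f x" using assms finG by simp
  finally show ?thesis .
qed

lemma parseval2: "(\<Sum>r\<in>G. hat f r * hat h r) = (\<Sum>x\<in>G. f x * h x) / card G"
proof -
  have "(\<Sum>r\<in>G. hat f r * hat h r) = (\<Sum>r\<in>G. \<Sum>x\<in>G. h x / card G * (hat f r * e r x))"
    by (simp add: hat_def[of h] sum_distrib_left sum_divide_distrib mult_ac)
  also have "\<dots> = (\<Sum>x\<in>G. h x / card G * (\<Sum>r\<in>G. hat f r * e r x))"
    by (subst sum.swap) (simp add: sum_distrib_left)
  also have "\<dots> = (\<Sum>x\<in>G. h x / card G * f x)"
    by (rule sum.cong) (auto simp: fourier_inversion)
  finally show ?thesis by (simp add: sum_divide_distrib mult_ac)
qed

lemma parseval: "(\<Sum>r\<in>G. (hat f r)\<^sup>2) = (\<Sum>x\<in>G. (f x)\<^sup>2) / card G"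
  using parseval2[of f f] by (simp add: power2_eq_square)

lemma sup_le_anorm: "x \<in> G \<Longrightarrow> \<bar>f x\<bar> \<le> anorm f"
  unfolding fourier_inversion[of x f, symmetric] anorm_def
  by (rule order.trans[OF sum_abs]) (simp add: abs_mult)

lemma hat_cong: "(\<And>x. x \<in> G \<Longrightarrow> f x = h x) \<Longrightarrow> hat f = hat h"
  by (rule ext) (simp add: hat_def)

lemma hat_diff: "hat (\<lambda>x. f x - h x) r = hat f r - hat h r"
  by (simp add: hat_def left_diff_distrib sum_subtractf diff_divide_distrib)

lemma hat_shift_sum: assumes "y \<in> G"
  shows "hat (\<lambda>x. f (x + y)) r = e r y * hat f r"
proof -
  have "(\<Sum>x\<in>G. f (x + y) * e r x) = (\<Sum>x\<in>G. f (x + y) * e r (x + y) * e r y)"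
    by (simp add: e_add mult_ac)
  also have "\<dots> = (\<Sum>x\<in>G. f x * e r x * e r y)"
    by (rule sum_shift[OF sub_G assms])
  finally show ?thesis by (simp add: hat_def sum_distrib_left mult_ac)
qed

lemma hat_avg:
  assumes "sub V" "r \<in> G"
  shows "hat (avg V f) r = (if r \<in> perp V then hat f r else 0)"
proof -
  have "hat (avg V f) r = (\<Sum>v\<in>V. hat (\<lambda>x. f (x + v)) r) / card V"
    unfolding hat_def avg_def
    by (simp add: sum_divide_distrib[symmetric] sum_distrib_right sum.swap[of _ V] mult_ac
        sum_distrib_left)
  also have "\<dots> = (\<Sum>v\<in>V. e r v * hat f r) / card V"
    by (simp add: hat_shift_sum subD(4)[OF assms(1)] cong: sum.cong)
  also have "\<dots> = (\<Sum>v\<in>V. e r v) * hat f r / card V"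
    by (simp add: sum_distrib_right)
  finally show ?thesis
    using sum_e[OF assms] sub_card_pos[OF assms(1)] by simp
qed

lemma avg_shift: "sub V \<Longrightarrow> v \<in> V \<Longrightarrow> avg V f (x + v) = avg V f x"
  unfolding avg_def using sum_shift'[of V v "\<lambda>w. f (x + w)"] by (simp add: add.assoc)

lemma avg_invariant:
  assumes "sub V" "\<And>v. v \<in> V \<Longrightarrow> f (x + v) = f x" shows "avg V f x = f x"
  using assms sub_card_pos[OF assms(1)] by (simp add: avg_def)

text \<open>The average keeps the frequencies in \<open>perp V\<close> and the difference keeps the
  others, so the triangle inequality is an equality. Hence a lower bound on the norm of the average
  is a genuine decrease of the norm.\<close>

lemma anorm_split:
  assumes "sub V"
  shows "anorm (\<lambda>x. f x - avg V f x) = anorm f - anorm (avg V f)"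
  unfolding anorm_def hat_diff sum_subtractf[symmetric]
  by (rule sum.cong) (auto simp: hat_avg[OF assms])

lemma avg_fourier:
  assumes "sub V" "x \<in> G"
  shows "f x - avg V f x = (\<Sum>r\<in>G - perp V. hat f r * e r x)"
proof -
  have "f x - avg V f x = (\<Sum>r\<in>G. hat (\<lambda>x. f x - avg V f x) r * e r x)"
    by (rule fourier_inversion[symmetric]) fact
  also have "\<dots> = (\<Sum>r\<in>G. (if r \<in> perp V then 0 else hat f r) * e r x)"
    by (rule sum.cong) (auto simp: hat_diff hat_avg[OF assms(1)])
  also have "\<dots> = (\<Sum>r\<in>G - perp V. hat f r * e r x)"
    by (rule sum.mono_neutral_cong_right) (use finG in auto)
  finally show ?thesis .
qed

end

section \<open>Subgaussian sums of characters\<close>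

text \<open>For \<open>y = - u < 0\<close> the claim amounts to
  \<open>1 \<le> (1 - u + u\<^sup>2) * exp u\<close>, where the quadratic Taylor polynomial is
  already a sufficient lower bound for \<open>exp u\<close>.\<close>

lemma exp_le_quadratic:
  fixes y :: real assumes "\<bar>y\<bar> \<le> 1" shows "exp y \<le> 1 + y + y\<^sup>2"
proof (cases "y \<ge> 0")
  case True
  then show ?thesis using exp_bound[of y] assms by simp
next
  case False
  define u where "u = - y"
  have u: "0 \<le> u" "u \<le> 1" using False assms by (auto simp: u_def)
  have "1 + u + u\<^sup>2 / 2 \<le> exp u" using exp_lower_Taylor_quadratic[OF u(1)] .
  then have "(1 - u + u\<^sup>2) * (1 + u + u\<^sup>2 / 2) \<le> (1 - u + u\<^sup>2) * exp u"
    by (rule mult_left_mono) (use u in \<open>auto intro: add_nonneg_nonneg\<close>)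
  moreover have "(1 - u + u\<^sup>2) * (1 + u + u\<^sup>2 / 2) = 1 + (u\<^sup>2 + u^3 + u^4) / 2"
    by (simp add: field_simps power2_eq_square power3_eq_cube power4_eq_xxxx)
  moreover have "1 \<le> 1 + (u\<^sup>2 + u^3 + u^4) / 2" using u by simp
  ultimately have "1 \<le> (1 - u + u\<^sup>2) * exp u" by (metis order.trans)
  then have "exp (- u) \<le> 1 - u + u\<^sup>2"
    by (simp add: exp_minus field_simps)
  then show ?thesis by (simp add: u_def)
qed

lemma cosh_le_exp_square: "cosh t \<le> exp ((t::real)\<^sup>2)"
proof (cases "\<bar>t\<bar> \<le> 1")
  case True
  have "cosh t = (exp t + exp (- t)) / 2" by (simp add: cosh_field_def)
  also have "\<dots> \<le> 1 + t\<^sup>2"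
    using exp_le_quadratic[of t] exp_le_quadratic[of "-t"] True by simp
  also have "\<dots> \<le> exp (t\<^sup>2)" by (rule exp_ge_add_one_self)
  finally show ?thesis .
next
  case False
  have "cosh t = (exp t + exp (- t)) / 2" by (simp add: cosh_field_def)
  also have "\<dots> \<le> exp \<bar>t\<bar>" by (cases "t \<ge> 0") auto
  also have "\<bar>t\<bar> \<le> t\<^sup>2"
    using mult_left_mono[of 1 "\<bar>t\<bar>" "\<bar>t\<bar>"] False by (simp add: power2_eq_square)
  finally show ?thesis by simp
qed

lemma exp_convex_combination:
  fixes a b p :: real assumes "0 \<le> p" "p \<le> 1"
  shows "exp (p * a + (1 - p) * b) \<le> p * exp a + (1 - p) * exp b"
proof -
  define m where "m = p * a + (1 - p) * b"
  have tangent: "exp m * (1 + (z - m)) \<le> exp z" for z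
    using mult_left_mono[OF exp_ge_add_one_self[of "z - m"], of "exp m"]
    by (simp add: exp_add[symmetric])
  have "p * (exp m * (1 + (a - m))) + (1 - p) * (exp m * (1 + (b - m))) \<le> p * exp a + (1 - p) * exp b"
    by (intro add_mono mult_left_mono tangent) (use assms in auto)
  also have "p * (exp m * (1 + (a - m))) + (1 - p) * (exp m * (1 + (b - m)))
      = exp m * (1 + (p * a + (1 - p) * b - m))"
    by (simp add: algebra_simps)
  finally show ?thesis by (simp add: m_def)
qed

text \<open>Jensen's inequality: the tangent of \<open>exp\<close> at the mean lies below the graph,
  and the deviations from the mean sum to zero.\<close>

lemma exp_mean_le:
  fixes g :: "'b \<Rightarrow> real"
  assumes "finite T" "T \<noteq> {}"
  shows "card T * exp ((\<Sum>v\<in>T. g v) / card T) \<le> (\<Sum>v\<in>T. exp (g v))"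
proof -
  define m where "m = (\<Sum>v\<in>T. g v) / card T"
  have c: "real (card T) > 0" using assms by (simp add: card_gt_0_iff)
  have tangent: "exp m * (1 + (z - m)) \<le> exp z" for z
    using mult_left_mono[OF exp_ge_add_one_self[of "z - m"], of "exp m"]
    by (simp add: exp_add[symmetric])
  have "(\<Sum>v\<in>T. exp m * (1 + (g v - m))) \<le> (\<Sum>v\<in>T. exp (g v))"
    by (rule sum_mono) (rule tangent)
  also have "(\<Sum>v\<in>T. exp m * (1 + (g v - m))) = exp m * (card T + ((\<Sum>v\<in>T. g v) - card T * m))"
    by (simp add: sum_distrib_left[symmetric] sum.distrib sum_subtractf)
  also have "\<dots> = card T * exp m" using c by (simp add: m_def)
  finally show ?thesis by (simp add: m_def)
qed

text \<open>The exponential Markov inequality for both tails: where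
  \<open>\<bar>g a\<bar> > d\<close>, one of the two exponentials is at least
  \<open>exp (t * d)\<close>.\<close>

lemma card_abs_gt_le:
  fixes g :: "'b \<Rightarrow> real"
  assumes "finite P" "t \<ge> 0" and E: "(\<Sum>a\<in>P. exp (t * g a)) \<le> E" "(\<Sum>a\<in>P. exp (- t * g a)) \<le> E"
  shows "card {a \<in> P. \<bar>g a\<bar> > d} * exp (t * d) \<le> 2 * E"
proof -
  define Q where "Q = {a \<in> P. \<bar>g a\<bar> > d}"
  have "card Q * exp (t * d) = (\<Sum>a\<in>Q. exp (t * d))" by simp
  also have "\<dots> \<le> (\<Sum>a\<in>Q. exp (t * g a) + exp (- t * g a))"
  proof (rule sum_mono)
    fix a assume "a \<in> Q"
    then have "d \<le> g a \<or> d \<le> - g a" by (auto simp: Q_def)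
    then have "t * d \<le> t * g a \<or> t * d \<le> t * (- g a)" using assms(2) by (metis mult_left_mono)
    then have "exp (t * d) \<le> exp (t * g a) \<or> exp (t * d) \<le> exp (- t * g a)" by simp
    moreover have "exp (t * g a) > 0" "exp (- t * g a) > 0" by simp_all
    ultimately show "exp (t * d) \<le> exp (t * g a) + exp (- t * g a)" by linarith
  qed
  also have "\<dots> \<le> (\<Sum>a\<in>P. exp (t * g a) + exp (- t * g a))"
    by (rule sum_mono2) (use assms(1) in \<open>auto simp: Q_def\<close>)
  finally show ?thesis using E by (simp add: sum.distrib Q_def)
qed

text \<open>A moment bound under the uniform measure on \<open>V\<close>, for \<open>t\<close> of
  either sign. The exponent is \<open>t\<^sup>2 * \<sigma>\<^sup>2\<close> instead of the customary
  half of it, to match \<open>cosh_le_exp_square\<close>.\<close>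

definition subgaussian :: "'b set \<Rightarrow> real \<Rightarrow> ('b \<Rightarrow> real) \<Rightarrow> bool" where
  "subgaussian V \<sigma> g \<longleftrightarrow> (\<forall>t. (\<Sum>v\<in>V. exp (t * g v)) \<le> card V * exp (t\<^sup>2 * \<sigma>\<^sup>2))"

lemma subgaussian_mono:
  assumes "subgaussian V \<sigma> g" "0 \<le> \<sigma>" "\<sigma> \<le> \<tau>" shows "subgaussian V \<tau> g"
  unfolding subgaussian_def
proof
  fix t :: real
  have "(\<Sum>v\<in>V. exp (t * g v)) \<le> card V * exp (t\<^sup>2 * \<sigma>\<^sup>2)"
    using assms(1) by (simp add: subgaussian_def)
  also have "\<dots> \<le> card V * exp (t\<^sup>2 * \<tau>\<^sup>2)"
    using assms(2,3) by (intro mult_left_mono) (auto intro!: mult_left_mono power_mono)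
  finally show "(\<Sum>v\<in>V. exp (t * g v)) \<le> card V * exp (t\<^sup>2 * \<tau>\<^sup>2)" .
qed

text \<open>A triangle inequality for the parameter, without independence. Convexity of
  \<open>exp\<close> is used with weights proportional to \<open>\<sigma>\<close> and
  \<open>\<tau>\<close>, the choice for which both moments carry the same exponent.\<close>

lemma subgaussian_add:
  assumes "subgaussian V \<sigma> g" "subgaussian V \<tau> h" "0 < \<sigma>" "0 < \<tau>"
  shows "subgaussian V (\<sigma> + \<tau>) (\<lambda>v. g v + h v)"
  unfolding subgaussian_def
proof
  fix t :: real
  define p where "p = \<sigma> / (\<sigma> + \<tau>)"
  have p: "0 < p" "p < 1" "1 - p = \<tau> / (\<sigma> + \<tau>)"
    using assms(3,4) by (auto simp: p_def field_simps)
  have e1: "t / p * \<sigma> = t * (\<sigma> + \<tau>)" "t / (1 - p) * \<tau> = t * (\<sigma> + \<tau>)"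
    using assms(3,4) unfolding p(3) by (auto simp: p_def)
  have "(\<Sum>v\<in>V. exp (t * (g v + h v))) \<le>
        (\<Sum>v\<in>V. p * exp (t / p * g v) + (1 - p) * exp (t / (1 - p) * h v))"
  proof (rule sum_mono)
    fix v
    have "t * (g v + h v) = p * (t / p * g v) + (1 - p) * (t / (1 - p) * h v)"
      using p(1,2) by (simp add: distrib_left)
    then show "exp (t * (g v + h v)) \<le> p * exp (t / p * g v) + (1 - p) * exp (t / (1 - p) * h v)"
      using exp_convex_combination[of p "t / p * g v" "t / (1 - p) * h v"] p(1,2) by (metis less_imp_le)
  qed
  also have "\<dots> = p * (\<Sum>v\<in>V. exp (t / p * g v)) + (1 - p) * (\<Sum>v\<in>V. exp (t / (1 - p) * h v))"
    by (simp add: sum.distrib sum_distrib_left)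
  also have "\<dots> \<le> p * (card V * exp ((t / p)\<^sup>2 * \<sigma>\<^sup>2)) + (1 - p) * (card V * exp ((t / (1 - p))\<^sup>2 * \<tau>\<^sup>2))"
    using p(1,2) by (intro add_mono mult_left_mono assms(1,2)[unfolded subgaussian_def, rule_format]) auto
  also have "(t / p)\<^sup>2 * \<sigma>\<^sup>2 = t\<^sup>2 * (\<sigma> + \<tau>)\<^sup>2"
    unfolding power_mult_distrib[symmetric] e1 ..
  also have "(t / (1 - p))\<^sup>2 * \<tau>\<^sup>2 = t\<^sup>2 * (\<sigma> + \<tau>)\<^sup>2"
    unfolding power_mult_distrib[symmetric] e1 ..
  finally show "(\<Sum>v\<in>V. exp (t * (g v + h v))) \<le> card V * exp (t\<^sup>2 * (\<sigma> + \<tau>)\<^sup>2)"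
    by (simp add: algebra_simps)
qed

section \<open>Independence of characters modulo a subspace, and exponential moments of their
  sums\<close>

context F2_pairing
begin

text \<open>Linear independence of \<open>I\<close> modulo \<open>U\<close>: over the field with two
  elements the coefficients are 0 or 1, so linear combinations are subset sums.\<close>

definition indep :: "'a set \<Rightarrow> 'a set \<Rightarrow> bool" where
  "indep U I \<longleftrightarrow> (\<forall>J\<subseteq>I. J \<noteq> {} \<longrightarrow> \<Sum>J \<notin> U)"

definition span :: "'a set \<Rightarrow> 'a set \<Rightarrow> 'a set" where
  "span U I = (\<lambda>(u, J). u + \<Sum>J) ` (U \<times> Pow I)"

lemma spanI: "u \<in> U \<Longrightarrow> J \<subseteq> I \<Longrightarrow> u + \<Sum>J \<in> span U I"
  unfolding span_def by (rule image_eqI[of _ _ "(u, J)"]) auto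

lemma spanE:
  assumes "x \<in> span U I" obtains u J where "u \<in> U" "J \<subseteq> I" "x = u + \<Sum>J"
  using assms unfolding span_def by auto

lemma sum_sym_diff:
  fixes J K :: "'a set"
  assumes "finite J" "finite K"
  shows "\<Sum>J + \<Sum>K = \<Sum>((J - K) \<union> (K - J))"
proof -
  have "\<Sum>J = \<Sum>(J - K) + \<Sum>(J \<inter> K)"
    using sum.Int_Diff[of J "\<lambda>x. x" K] assms by (simp add: add.commute)
  moreover have "\<Sum>K = \<Sum>(K - J) + \<Sum>(J \<inter> K)"
    using sum.Int_Diff[of K "\<lambda>x. x" J] assms by (simp add: add.commute Int_commute)
  ultimately have "\<Sum>J + \<Sum>K = \<Sum>(J - K) + (\<Sum>(J \<inter> K) + (\<Sum>(J \<inter> K) + \<Sum>(K - J)))"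
    by (simp only: ac_simps)
  then have "\<Sum>J + \<Sum>K = \<Sum>(J - K) + \<Sum>(K - J)" by simp
  also have "\<dots> = \<Sum>((J - K) \<union> (K - J))"
    by (rule sum.union_disjoint[symmetric]) (use assms in auto)
  finally show ?thesis .
qed

lemma sum_in_G: "I \<subseteq> G \<Longrightarrow> \<Sum>I \<in> G"
proof (induction I rule: infinite_finite_induct)
  case (insert x F)
  then show ?case using addG by simp
qed (use zeroG in auto)

lemma sub_span:
  assumes "sub U" "I \<subseteq> G" shows "sub (span U I)"
  unfolding sub_def
proof (intro conjI ballI)
  show "span U I \<subseteq> G"
  proof
    fix x assume "x \<in> span U I"
    then obtain u J where x: "u \<in> U" "J \<subseteq> I" "x = u + \<Sum>J" by (rule spanE)
    have "\<Sum>J \<in> G" by (rule sum_in_G) (use x assms(2) in auto)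
    then show "x \<in> G" using x addG subD(4)[OF assms(1)] by auto
  qed
  show "0 \<in> span U I"
    using spanI[OF subD(2)[OF assms(1)], of "{}"] by simp
  have finI: "finite I" using assms(2) finG finite_subset by blast
  fix x y assume xy: "x \<in> span U I" "y \<in> span U I"
  obtain u J where *: "u \<in> U" "J \<subseteq> I" "x = u + \<Sum>J" using xy(1) by (rule spanE)
  obtain v K where **: "v \<in> U" "K \<subseteq> I" "y = v + \<Sum>K" using xy(2) by (rule spanE)
  have "x + y = (u + v) + (\<Sum>J + \<Sum>K)" using * ** by (simp only: ac_simps)
  also have "\<Sum>J + \<Sum>K = \<Sum>((J - K) \<union> (K - J))"
    by (rule sum_sym_diff) (use * ** finI finite_subset in blast)+
  finally have eq: "x + y = (u + v) + \<Sum>((J - K) \<union> (K - J))" .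
  show "x + y \<in> span U I"
    unfolding eq by (rule spanI) (use * ** subD(3)[OF assms(1)] in auto)
qed

lemma card_span:
  assumes "finite U" "finite I" shows "card (span U I) \<le> card U * 2 ^ card I"
  unfolding span_def
  by (rule order.trans[OF card_image_le]) (use assms in \<open>auto simp: card_cartesian_product card_Pow\<close>)

lemma span_superset: "U \<subseteq> span U I"
  using spanI[of _ U "{}"] by auto

text \<open>An independent set of largest cardinality spans: inserting a further \<open>r\<close>
  creates a subset sum in \<open>U\<close> that must involve \<open>r\<close>, and as addition is
  its own inverse this can be solved for \<open>r\<close>.\<close>

lemma exists_maximal_indep:
  assumes "sub U" "P \<subseteq> G"
  obtains I where "I \<subseteq> P" "indep U I" "P \<subseteq> span U I"
proof -
  have finP: "finite P" using assms(2) finG finite_subset by blast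
  have ex: "{} \<subseteq> P \<and> indep U {}" by (simp add: indep_def)
  have "\<exists>I. (I \<subseteq> P \<and> indep U I) \<and> (\<forall>I'. I' \<subseteq> P \<and> indep U I' \<longrightarrow> card I' \<le> card I)"
    by (rule ex_has_greatest_nat[where b = "Suc (card P)" and k = "{}"])
      (use finP ex in \<open>auto intro: card_mono le_imp_less_Suc\<close>)
  then obtain I where I: "I \<subseteq> P" "indep U I" "\<And>I'. I' \<subseteq> P \<Longrightarrow> indep U I' \<Longrightarrow> card I' \<le> card I"
    by blast
  have finI: "finite I" using I(1) finP finite_subset by blast
  have "P \<subseteq> span U I"
  proof
    fix r assume r: "r \<in> P"
    show "r \<in> span U I"
    proof (cases "r \<in> I")
      case True
      then show ?thesis using spanI[OF subD(2)[OF assms(1)], of "{r}"] by simp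
    next
      case False
      then have "\<not> indep U (insert r I)"
        using I(3)[of "insert r I"] r I(1) finI by auto
      then obtain J where J: "J \<subseteq> insert r I" "J \<noteq> {}" "\<Sum>J \<in> U" by (auto simp: indep_def)
      have "r \<in> J" using J I(2) by (auto simp: indep_def)
      have finJ: "finite J" using J finI finite_subset by blast
      have "\<Sum>J = r + \<Sum>(J - {r})" by (rule sum.remove[OF finJ \<open>r \<in> J\<close>])
      then have "r = \<Sum>J + \<Sum>(J - {r})" by (simp add: add.assoc)
      moreover have "\<Sum>J + \<Sum>(J - {r}) \<in> span U I"
        by (rule spanI) (use J in auto)
      ultimately show ?thesis by simp
    qed
  qed
  with I that show ?thesis by blast
qed

lemma e_sum: "e (\<Sum>J) v = (\<Prod>r\<in>J. e r v)"
  by (induction J rule: infinite_finite_induct) (auto simp: e_add_left)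

text \<open>Rudin's inequality by a Riesz product. As \<open>e r v\<close> is a sign, each factor
  \<open>exp (t * (s r * e r v))\<close> is affine in it. After expansion over subsets
  \<open>J\<close>, independence modulo \<open>U\<close> kills every character sum over
  \<open>perp U\<close> except that of \<open>J = {}\<close>, which leaves a power of
  \<open>cosh t\<close>.\<close>

lemma subgaussian_indep:
  assumes "sub U" "I \<subseteq> G" "indep U I" and s: "\<And>r. r \<in> I \<Longrightarrow> s r = 1 \<or> s r = (-1::real)"
  shows "subgaussian (perp U) (sqrt (card I)) (\<lambda>v. \<Sum>r\<in>I. s r * e r v)"
  unfolding subgaussian_def
proof
  fix t :: real
  have finI: "finite I" using assms(2) finG finite_subset by blast
  have "(\<Sum>v\<in>perp U. exp (t * (\<Sum>r\<in>I. s r * e r v))) =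
        (\<Sum>v\<in>perp U. \<Prod>r\<in>I. (s r * sinh t) * e r v + cosh t)"
  proof (rule sum.cong[OF refl])
    fix v
    have "exp (t * (\<Sum>r\<in>I. s r * e r v)) = (\<Prod>r\<in>I. exp (t * (s r * e r v)))"
      by (simp add: sum_distrib_left exp_sum finI)
    also have "\<dots> = (\<Prod>r\<in>I. (s r * sinh t) * e r v + cosh t)"
    proof (rule prod.cong[OF refl])
      fix r assume "r \<in> I"
      have "exp t = sinh t + cosh t" "exp (- t) = cosh t - sinh t"
        by (auto simp: sinh_field_def cosh_field_def field_simps)
      then show "exp (t * (s r * e r v)) = (s r * sinh t) * e r v + cosh t"
        using s[OF \<open>r \<in> I\<close>] e_vals[of r v] by auto
    qed
    finally show "exp (t * (\<Sum>r\<in>I. s r * e r v)) = (\<Prod>r\<in>I. (s r * sinh t) * e r v + cosh t)" .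
  qed
  also have "\<dots> = (\<Sum>v\<in>perp U. \<Sum>J\<in>Pow I. (\<Prod>r\<in>J. (s r * sinh t) * e r v) * (\<Prod>r\<in>I - J. cosh t))"
    by (simp add: prod_add[OF finI])
  also have "\<dots> = (\<Sum>J\<in>Pow I. (\<Prod>r\<in>J. s r * sinh t) * (\<Prod>r\<in>I - J. cosh t) * (\<Sum>v\<in>perp U. e (\<Sum>J) v))"
    by (subst sum.swap) (simp add: prod.distrib e_sum sum_distrib_left mult_ac)
  also have "\<dots> = (\<Sum>J\<in>Pow I. if J = {} then (\<Prod>r\<in>I. cosh t) * card (perp U) else 0)"
  proof (rule sum.cong[OF refl])
    fix J assume J: "J \<in> Pow I"
    then have "\<Sum>J \<in> G" using assms(2) sum_in_G by blast
    then have "(\<Sum>v\<in>perp U. e (\<Sum>J) v) = (if \<Sum>J \<in> U then real (card (perp U)) else 0)"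
      using sum_e[OF sub_perp] perp_perp[OF assms(1)] by simp
    then show "(\<Prod>r\<in>J. s r * sinh t) * (\<Prod>r\<in>I - J. cosh t) * (\<Sum>v\<in>perp U. e (\<Sum>J) v) =
        (if J = {} then (\<Prod>r\<in>I. cosh t) * card (perp U) else 0)"
      using assms(3) J subD(2)[OF assms(1)] by (auto simp: indep_def)
  qed
  also have "\<dots> = card (perp U) * cosh t ^ card I"
    using finI by simp
  also have "\<dots> \<le> card (perp U) * exp (t\<^sup>2) ^ card I"
    by (intro mult_left_mono power_mono cosh_le_exp_square) auto
  also have "exp (t\<^sup>2) ^ card I = exp (t\<^sup>2 * (sqrt (card I))\<^sup>2)"
    by (simp add: exp_of_nat_mult[symmetric] mult.commute)
  finally show "(\<Sum>v\<in>perp U. exp (t * (\<Sum>r\<in>I. s r * e r v))) \<le> card (perp U) * exp (t\<^sup>2 * (sqrt (card I))\<^sup>2)" .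
qed

text \<open>The greedy step subtracts a multiple of a maximal independent set from \<open>\<bar>c\<bar>\<close>; the cost is
  paid for by the decrease of \<open>2 sqrt (\<eta> W)\<close>, so the increments telescope.\<close>

lemma subgaussian_of_capacity:
  assumes U: "sub U" and \<eta>: "\<eta> > 0"
    and cap: "\<And>L. sub L \<Longrightarrow> U \<subseteq> L \<Longrightarrow> (\<Sum>r\<in>L - U. \<bar>c r\<bar>) \<le> \<eta> * log 2 (card L / card U)"
  shows "subgaussian (perp U) (2 * sqrt (\<eta> * (\<Sum>r\<in>G - U. \<bar>c r\<bar>))) (\<lambda>v. \<Sum>r\<in>G - U. c r * e r v)"
  using cap
proof (induction "card {r \<in> G - U. c r \<noteq> 0}" arbitrary: c rule: less_induct)
  case less
  define P where "P = {r \<in> G - U. c r \<noteq> 0}"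
  define W where "W = (\<Sum>r\<in>G - U. \<bar>c r\<bar>)"
  have finP: "finite P" using finG by (simp add: P_def)
  show ?case
  proof (cases "P = {}")
    case True
    then have "c r = 0" if "r \<in> G - U" for r using that by (auto simp: P_def)
    then have "(\<Sum>r\<in>G - U. c r * e r v) = 0" "(\<Sum>r\<in>G - U. \<bar>c r\<bar>) = 0" for v by simp_all
    then show ?thesis by (simp only: subgaussian_def) simp
  next
    case False
    obtain I where I: "I \<subseteq> P" "indep U I" "P \<subseteq> span U I"
      using exists_maximal_indep[OF U, of P] by (auto simp: P_def)
    have finI: "finite I" using I(1) finP finite_subset by blast
    have IG: "I \<subseteq> G" "I \<subseteq> G - U" using I(1) by (auto simp: P_def)
    have "I \<noteq> {}"
    proof
      assume "I = {}"
      then have "P \<subseteq> U" using I(3) by (auto simp: span_def)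
      then show False using False by (auto simp: P_def)
    qed
    have cI: "card I > 0" using finI \<open>I \<noteq> {}\<close> by (simp add: card_gt_0_iff)
    have cU: "card U > 0" using sub_card_pos[OF U] .
    \<comment> \<open>The capacity hypothesis is applied to the span of \<open>U\<close> and
      \<open>I\<close>, which contains all of \<open>P\<close> and has dimension at most
      \<open>card I\<close> over \<open>U\<close>.\<close>
    have W_le: "W \<le> \<eta> * card I"
    proof -
      have spG: "span U I \<subseteq> G" using sub_span[OF U IG(1)] subD(1) by blast
      have "W = (\<Sum>r\<in>P. \<bar>c r\<bar>)"
        unfolding W_def by (rule sum.mono_neutral_right) (use finG in \<open>auto simp: P_def\<close>)
      also have "\<dots> \<le> (\<Sum>r\<in>span U I - U. \<bar>c r\<bar>)"
        by (rule sum_mono2) (use finG spG finite_subset I(3) in \<open>auto simp: P_def\<close>)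
      also have "\<dots> \<le> \<eta> * log 2 (card (span U I) / card U)"
        by (rule less.prems) (use sub_span[OF U IG(1)] span_superset in auto)
      also have "\<dots> \<le> \<eta> * log 2 (2 ^ card I)"
      proof -
        have "real (card (span U I)) \<le> card U * 2 ^ card I"
          using card_span[OF sub_finite[OF U] finI] by (metis of_nat_le_iff of_nat_mult of_nat_numeral of_nat_power)
        then have "card (span U I) / card U \<le> 2 ^ card I" using cU by (simp add: field_simps)
        moreover have "card (span U I) / card U > 0"
          using cU sub_card_pos[OF sub_span[OF U IG(1)]] by simp
        ultimately have "log 2 (card (span U I) / card U) \<le> log 2 (2 ^ card I)"
          by (subst log_le_cancel_iff) auto
        then show ?thesis using \<eta> by (intro mult_left_mono) auto
      qed
      also have "log 2 (2 ^ card I) = card I" by (simp add: log_nat_power)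
      finally show ?thesis .
    qed
    \<comment> \<open>The smallest coefficient on \<open>I\<close> is the largest amount that can be
      removed on all of \<open>I\<close> without changing a sign; it empties \<open>r0\<close>, so
      the support shrinks and the induction proceeds.\<close>
    define u where "u = Min ((\<lambda>r. \<bar>c r\<bar>) ` I)"
    have u_le: "u \<le> \<bar>c r\<bar>" if "r \<in> I" for r
      unfolding u_def by (rule Min_le) (use finI that in auto)
    have "u \<in> (\<lambda>r. \<bar>c r\<bar>) ` I"
      unfolding u_def by (rule Min_in) (use finI \<open>I \<noteq> {}\<close> in auto)
    then obtain r0 where r0: "r0 \<in> I" "u = \<bar>c r0\<bar>" by auto
    have u_pos: "u > 0" using r0 I(1) by (auto simp: P_def)
    define c' where "c' r = (if r \<in> I then c r - u * sgn (c r) else c r)" for r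
    have abs_c': "\<bar>c' r\<bar> = \<bar>c r\<bar> - (if r \<in> I then u else 0)" for r
      using u_le[of r] u_pos by (auto simp: c'_def sgn_if)
    have W': "(\<Sum>r\<in>G - U. \<bar>c' r\<bar>) = W - u * card I"
    proof -
      have "(\<Sum>r\<in>G - U. if r \<in> I then u else 0) = (\<Sum>r\<in>I. u)"
        by (rule sum.mono_neutral_cong_right) (use finG IG in auto)
      then show ?thesis unfolding abs_c' sum_subtractf W_def by (simp add: mult.commute)
    qed
    have W'_nonneg: "W - u * card I \<ge> 0" unfolding W'[symmetric] by (simp add: sum_nonneg)
    have uI: "u * card I > 0" using u_pos cI by simp
    have "card {r \<in> G - U. c' r \<noteq> 0} < card P"
    proof (rule psubset_card_mono[OF finP])
      have "c' r0 = 0" using r0 abs_c'[of r0] by simp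
      moreover have "r0 \<in> P" using r0 I(1) by auto
      moreover have "{r \<in> G - U. c' r \<noteq> 0} \<subseteq> P" using I(1) by (auto simp: c'_def P_def split: if_splits)
      ultimately show "{r \<in> G - U. c' r \<noteq> 0} \<subset> P" by auto
    qed
    then have IH: "subgaussian (perp U) (2 * sqrt (\<eta> * (W - u * card I))) (\<lambda>v. \<Sum>r\<in>G - U. c' r * e r v)"
      unfolding W'[symmetric]
    proof (rule less.hyps[unfolded P_def[symmetric]])
      fix L assume L: "sub L" "U \<subseteq> L"
      have "(\<Sum>r\<in>L - U. \<bar>c' r\<bar>) \<le> (\<Sum>r\<in>L - U. \<bar>c r\<bar>)"
        by (rule sum_mono) (use abs_c' u_pos in auto)
      also have "\<dots> \<le> \<eta> * log 2 (card L / card U)" by (rule less.prems) fact+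
      finally show "(\<Sum>r\<in>L - U. \<bar>c' r\<bar>) \<le> \<eta> * log 2 (card L / card U)" .
    qed
    have sub2: "subgaussian (perp U) (u * sqrt (card I)) (\<lambda>v. u * (\<Sum>r\<in>I. sgn (c r) * e r v))"
    proof -
      have "subgaussian (perp U) (sqrt (card I)) (\<lambda>v. \<Sum>r\<in>I. sgn (c r) * e r v)"
        by (rule subgaussian_indep[OF U IG(1) I(2)]) (use I(1) in \<open>auto simp: P_def sgn_if\<close>)
      then have "(\<Sum>v\<in>perp U. exp ((t * u) * (\<Sum>r\<in>I. sgn (c r) * e r v)))
          \<le> card (perp U) * exp ((t * u)\<^sup>2 * (sqrt (card I))\<^sup>2)" for t
        unfolding subgaussian_def by blast
      then show ?thesis unfolding subgaussian_def by (simp only: power_mult_distrib mult.assoc simp_thms)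
    qed
    have decomp: "(\<Sum>r\<in>G - U. c r * e r v) =
        (\<Sum>r\<in>G - U. c' r * e r v) + u * (\<Sum>r\<in>I. sgn (c r) * e r v)" for v
    proof -
      have 1: "(\<Sum>r\<in>I. u * (sgn (c r) * e r v)) = (\<Sum>r\<in>G - U. if r \<in> I then u * (sgn (c r) * e r v) else 0)"
        by (rule sum.mono_neutral_cong_left) (use finG IG in auto)
      have "c r * e r v = c' r * e r v + (if r \<in> I then u * (sgn (c r) * e r v) else 0)" for r
        by (simp add: c'_def left_diff_distrib)
      then show ?thesis unfolding sum_distrib_left 1 sum.distrib[symmetric] by (rule sum.cong[OF refl])
    qed
    have W_pos: "W > 0" using W'_nonneg uI by linarith
    \<comment> \<open>Here \<open>a\<^sup>2 - b\<^sup>2 = \<eta> * u * card I\<close>, while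
      \<open>W_le\<close> gives \<open>a \<le> \<eta> * sqrt (card I)\<close>. Factoring the
      difference of squares and bounding \<open>a + b\<close> by \<open>2 * a\<close> leaves the
      required decrement.\<close>
    have key: "u * sqrt (card I) \<le> 2 * sqrt (\<eta> * W) - 2 * sqrt (\<eta> * (W - u * card I))"
    proof -
      define a b where "a = sqrt (\<eta> * W)" and "b = sqrt (\<eta> * (W - u * card I))"
      have a2: "a\<^sup>2 = \<eta> * W" and b2: "b\<^sup>2 = \<eta> * (W - u * card I)"
        using \<eta> W_pos W'_nonneg by (auto simp: a_def b_def)
      have ab: "0 < a" "0 \<le> b" using \<eta> W_pos W'_nonneg by (auto simp: a_def b_def)
      have "a \<le> \<eta> * sqrt (card I)"
      proof -
        have "\<eta> * W \<le> \<eta> * (\<eta> * card I)" by (rule mult_left_mono) (use W_le \<eta> in auto)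
        also have "\<dots> = (\<eta> * sqrt (card I))\<^sup>2"
          by (simp add: power_mult_distrib power2_eq_square[of \<eta>])
        finally show ?thesis unfolding a_def using \<eta> by (intro real_le_lsqrt) auto
      qed
      have ba: "b \<le> a" unfolding a_def b_def using \<eta> uI by (intro real_sqrt_le_mono mult_left_mono) auto
      have "\<eta> * u * card I = a\<^sup>2 - b\<^sup>2" unfolding a2 b2 by (simp add: algebra_simps)
      also have "\<dots> = (a + b) * (a - b)" by (simp add: algebra_simps power2_eq_square)
      also have "\<dots> \<le> (2 * a) * (a - b)" using ab ba by (intro mult_right_mono) auto
      also have "\<dots> \<le> (2 * (\<eta> * sqrt (card I))) * (a - b)"
        using \<open>a \<le> \<eta> * sqrt (card I)\<close> ba by (intro mult_right_mono) auto
      finally have "(\<eta> * sqrt (card I)) * (u * sqrt (card I)) \<le> (\<eta> * sqrt (card I)) * (2 * a - 2 * b)"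
        by (simp add: algebra_simps)
      then have "u * sqrt (card I) \<le> 2 * a - 2 * b"
        using \<eta> cI by (subst (asm) mult_le_cancel_left_pos) auto
      then show ?thesis by (simp add: a_def b_def)
    qed
    show ?thesis
    \<comment> \<open>\<open>subgaussian_add\<close> asks for positive parameters, so an exhausted
      remainder is treated separately.\<close>
    proof (cases "W - u * card I = 0")
      case True
      then have "(\<Sum>r\<in>G - U. \<bar>c' r\<bar>) = 0" using W' by simp
      then have "\<forall>r\<in>G - U. c' r = 0"
        using finG by (subst (asm) sum_nonneg_eq_0_iff) auto
      then have "(\<Sum>r\<in>G - U. c r * e r v) = u * (\<Sum>r\<in>I. sgn (c r) * e r v)" for v
        unfolding decomp by simp
      then show ?thesis
        using subgaussian_mono[OF sub2, of "2 * sqrt (\<eta> * W)"] key True u_pos by (simp add: W_def)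
    next
      case False
      then have "W - u * card I > 0" using W'_nonneg by simp
      then have "subgaussian (perp U) (2 * sqrt (\<eta> * (W - u * card I)) + u * sqrt (card I))
          (\<lambda>v. \<Sum>r\<in>G - U. c r * e r v)"
        unfolding decomp using \<eta> u_pos cI by (intro subgaussian_add IH sub2) auto
      from subgaussian_mono[OF this, of "2 * sqrt (\<eta> * W)"]
      show ?thesis using key u_pos \<eta> W'_nonneg by (simp add: W_def)
    qed
  qed
qed

end

section \<open>Quantitative continuity and Chang's theorem\<close>

context F2_pairing
begin

text \<open>\<open>perp U\<close> is chosen with \<open>U\<close> maximising the Fourier mass of \<open>f\<close> on \<open>U\<close> minus \<open>\<eta> log |U|\<close>;
  maximality is exactly the capacity condition.\<close>

lemma quantitative_continuity:
  assumes H: "sub H" and \<eta>: "\<eta> > 0" and M: "M > 0" "anorm f \<le> M"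
  obtains V where "sub V" "V \<subseteq> H" "real (card H) \<le> card V * 2 powr (M / \<eta>)"
    "\<forall>x\<in>G. real (card {v\<in>V. \<bar>f (x + v) - avg V f x\<bar> > 1/4})
        \<le> 2 * exp (- 1 / (256 * \<eta> * M)) * card V"
proof -
  define \<Phi> where "\<Phi> U = (\<Sum>r\<in>U. \<bar>hat f r\<bar>) - \<eta> * log 2 (card U)" for U
  define \<U> where "\<U> = {U. sub U \<and> perp H \<subseteq> U}"
  have "\<U> \<subseteq> Pow G" using subD(1) by (auto simp: \<U>_def)
  then have fin\<U>: "finite \<U>" using finG finite_subset by blast
  have ne\<U>: "\<U> \<noteq> {}" using sub_perp by (auto simp: \<U>_def)
  have "Max (\<Phi> ` \<U>) \<in> \<Phi> ` \<U>"
    by (rule Max_in) (use fin\<U> ne\<U> in auto)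
  then obtain U where U': "U \<in> \<U>" "\<Phi> U = Max (\<Phi> ` \<U>)" by auto
  have U: "U \<in> \<U>" "\<And>U'. U' \<in> \<U> \<Longrightarrow> \<Phi> U' \<le> \<Phi> U"
    unfolding U'(2) by (rule U') (simp add: fin\<U>)
  have subU: "sub U" and HU: "perp H \<subseteq> U" using U(1) by (auto simp: \<U>_def)
  define V where "V = perp U"
  have subV: "sub V" unfolding V_def by (rule sub_perp)
  have perpV: "perp V = U" unfolding V_def by (rule perp_perp[OF subU])
  have VH: "V \<subseteq> H" using perp_mono[OF HU] perp_perp[OF H] by (simp add: V_def)
  have cU: "real (card U) > 0" using sub_card_pos[OF subU] by simp
  have mass_le: "(\<Sum>r\<in>A. \<bar>hat f r\<bar>) \<le> M" if "A \<subseteq> G" for A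
    using sum_mono2[OF finG that, of "\<lambda>r. \<bar>hat f r\<bar>"] M(2) by (simp add: anorm_def)
  have cap: "(\<Sum>r\<in>L - U. \<bar>hat f r\<bar>) \<le> \<eta> * log 2 (card L / card U)" if L: "sub L" "U \<subseteq> L" for L
  proof -
    have "\<Phi> L \<le> \<Phi> U" using U(2) L HU by (auto simp: \<U>_def)
    moreover have "(\<Sum>r\<in>L. \<bar>hat f r\<bar>) = (\<Sum>r\<in>L - U. \<bar>hat f r\<bar>) + (\<Sum>r\<in>U. \<bar>hat f r\<bar>)"
      by (rule sum.subset_diff) (use L sub_finite in auto)
    moreover have "\<eta> * log 2 (card L / card U) = \<eta> * log 2 (card L) - \<eta> * log 2 (card U)"
      using cU sub_card_pos[OF L(1)] by (simp add: log_divide right_diff_distrib)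
    ultimately show ?thesis unfolding \<Phi>_def by linarith
  qed
  \<comment> \<open>\<open>perp H\<close> competes in the maximisation, so the penalty allows
    \<open>U\<close> at most \<open>M / \<eta>\<close> dimensions beyond it; annihilators turn this
    into the codimension of \<open>V\<close> in \<open>H\<close>.\<close>
  have size: "real (card H) \<le> card V * 2 powr (M / \<eta>)"
  proof -
    have c: "real (card (perp H)) > 0" using sub_card_pos[OF sub_perp] by simp
    have "\<Phi> (perp H) \<le> \<Phi> U" using U(2) sub_perp by (auto simp: \<U>_def)
    moreover have "(\<Sum>r\<in>perp H. \<bar>hat f r\<bar>) \<ge> 0" by (simp add: sum_nonneg)
    moreover have "(\<Sum>r\<in>U. \<bar>hat f r\<bar>) \<le> M" using mass_le subD(1)[OF subU] by blast
    ultimately have "\<eta> * (log 2 (card U) - log 2 (card (perp H))) \<le> M"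
      unfolding \<Phi>_def right_diff_distrib by linarith
    then have "log 2 (card U / card (perp H)) \<le> M / \<eta>"
      using \<eta> cU c by (simp add: field_simps log_divide)
    then have "card U / card (perp H) \<le> 2 powr (M / \<eta>)"
      using cU c by (simp add: log_le_iff)
    then have *: "real (card U) \<le> card (perp H) * 2 powr (M / \<eta>)"
      using c by (simp add: field_simps)
    have "real (card H) * card (perp H) = real (card V) * card U"
      using card_perp[OF H] card_perp[OF subV] perpV by (simp flip: of_nat_mult)
    also have "\<dots> \<le> card V * (card (perp H) * 2 powr (M / \<eta>))"
      by (rule mult_left_mono) (use * in auto)
    finally show ?thesis using c by simp
  qed
  have dev: "real (card {v\<in>V. \<bar>f (x + v) - avg V f x\<bar> > 1/4}) \<le> 2 * exp (- 1 / (256 * \<eta> * M)) * card V"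
    if x: "x \<in> G" for x
  proof -
    define c where "c r = hat f r * e r x" for r
    define W where "W = (\<Sum>r\<in>G - U. \<bar>c r\<bar>)"
    define g where "g v = (\<Sum>r\<in>G - U. c r * e r v)" for v
    have abs_c: "\<bar>c r\<bar> = \<bar>hat f r\<bar>" for r by (simp add: c_def abs_mult)
    have WM: "W \<le> M" unfolding W_def abs_c by (rule mass_le) auto
    have W0: "W \<ge> 0" by (simp add: W_def sum_nonneg)
    have sg: "subgaussian V (2 * sqrt (\<eta> * W)) g"
      unfolding V_def W_def g_def by (rule subgaussian_of_capacity[OF subU \<eta>]) (simp add: abs_c cap)
    have gv: "f (x + v) - avg V f x = g v" if v: "v \<in> V" for v
    proof -
      have "f (x + v) - avg V f x = f (x + v) - avg V f (x + v)"
        using avg_shift[OF subV v] by simp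
      also have "\<dots> = g v"
        using avg_fourier[OF subV addG[OF x subD(4)[OF subV v]]] by (simp add: perpV g_def c_def e_add mult_ac)
      finally show ?thesis .
    qed
    \<comment> \<open>This \<open>t\<close> minimises
      \<open>4 * t\<^sup>2 * \<eta> * M - t / 4\<close>, the exponent in the Chernoff bound; the
      minimum is \<open>- t / 8\<close>.\<close>
    define t where "t = 1 / (32 * \<eta> * M)"
    have t: "t > 0" using \<eta> M by (simp add: t_def)
    define B where "B = {v\<in>V. \<bar>g v\<bar> > 1/4}"
    have moment: "(\<Sum>v\<in>V. exp (s * g v)) \<le> card V * exp (4 * t\<^sup>2 * \<eta> * M)" if "s\<^sup>2 = t\<^sup>2" for s
    proof -
      have "(\<Sum>v\<in>V. exp (s * g v)) \<le> card V * exp (s\<^sup>2 * (2 * sqrt (\<eta> * W))\<^sup>2)"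
        using sg unfolding subgaussian_def by blast
      also have "s\<^sup>2 * (2 * sqrt (\<eta> * W))\<^sup>2 = 4 * t\<^sup>2 * \<eta> * W"
        using \<eta> W0 that by (simp add: power_mult_distrib)
      also have "card V * exp (4 * t\<^sup>2 * \<eta> * W) \<le> card V * exp (4 * t\<^sup>2 * \<eta> * M)"
        using \<eta> WM by (intro mult_left_mono) (auto intro!: mult_left_mono)
      finally show ?thesis .
    qed
    have "card B * exp (t * (1/4)) \<le> 2 * (card V * exp (4 * t\<^sup>2 * \<eta> * M))"
      unfolding B_def by (rule card_abs_gt_le[OF sub_finite[OF subV] less_imp_le[OF t] moment moment]) auto
    also have "4 * t\<^sup>2 * \<eta> * M = t / 8"
      using \<eta> M by (simp add: t_def power2_eq_square)
    finally have "card B * exp (t / 4) \<le> 2 * exp (t / 8) * card V" by (simp add: mult_ac)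
    then have "(card B * exp (t / 4)) * exp (- t / 4) \<le> (2 * exp (t / 8) * card V) * exp (- t / 4)"
      by (rule mult_right_mono) simp
    then have "card B \<le> 2 * (exp (t / 8) * exp (- t / 4)) * card V"
      by (simp add: mult_ac exp_minus)
    also have "exp (t / 8) * exp (- t / 4) = exp (- 1 / (256 * \<eta> * M))"
      by (simp add: exp_add[symmetric] t_def)
    finally have "card B \<le> 2 * exp (- 1 / (256 * \<eta> * M)) * card V" .
    moreover have "{v\<in>V. \<bar>f (x + v) - avg V f x\<bar> > 1/4} = B"
      using gv by (auto simp: B_def)
    ultimately show ?thesis by simp
  qed
  show thesis by (rule that[OF subV VH size]) (use dev in blast)
qed

text \<open>On \<open>T\<close> the signed sum over an independent set \<open>I\<close> of large
  frequencies has mean at least \<open>card I / 2\<close>, while on \<open>G\<close> it is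
  subgaussian with parameter \<open>sqrt (card I)\<close>. Jensen's inequality on \<open>T\<close>,
  compared with the moment on \<open>G\<close>, bounds \<open>card I\<close> by a multiple of
  \<open>ln (card G / card T)\<close>.\<close>

lemma chang:
  assumes T: "T \<subseteq> G" "T \<noteq> {}"
  obtains U where "sub U" "\<forall>r\<in>G. \<bar>\<Sum>v\<in>T. e r v\<bar> \<ge> card T / 2 \<longrightarrow> r \<in> U"
    "real (card U) \<le> (card G / card T) ^ 16"
proof -
  have finT: "finite T" using T(1) finG finite_subset by blast
  have cT: "real (card T) > 0" using finT T(2) by (simp add: card_gt_0_iff)
  define R where "R = {r \<in> G. \<bar>\<Sum>v\<in>T. e r v\<bar> \<ge> card T / 2}"
  have RG: "R \<subseteq> G" by (auto simp: R_def)
  obtain I where I: "I \<subseteq> R" "indep {0} I" "R \<subseteq> span {0} I"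
    using exists_maximal_indep[OF sub_0 RG] .
  have IG: "I \<subseteq> G" using I(1) RG by blast
  have finI: "finite I" using IG finG finite_subset by blast
  define s where "s r = (if (\<Sum>v\<in>T. e r v) \<ge> 0 then 1 else - 1 :: real)" for r
  define g where "g v = (\<Sum>r\<in>I. s r * e r v)" for v
  have p0: "perp {0} = G" by (auto simp: perp_def)
  have sg: "subgaussian G (sqrt (card I)) g"
    using subgaussian_indep[OF sub_0 IG I(2), of s] by (auto simp: p0 g_def[abs_def] s_def)
  have "card I * (card T / 2) = (\<Sum>r\<in>I. card T / 2)" by simp
  also have "\<dots> \<le> (\<Sum>r\<in>I. s r * (\<Sum>v\<in>T. e r v))"
    by (rule sum_mono) (use I(1) in \<open>auto simp: R_def s_def\<close>)
  also have "\<dots> = (\<Sum>v\<in>T. g v)"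
    unfolding g_def by (subst sum.swap) (simp add: sum_distrib_left)
  finally have mean: "card I / 2 \<le> (\<Sum>v\<in>T. g v) / card T" using cT by (simp add: field_simps)
  \<comment> \<open>The parameter \<open>1/4\<close> maximises \<open>t / 2 - t\<^sup>2\<close>; the
    maximum \<open>1/16\<close> is the source of the exponent 16.\<close>
  have "(\<Sum>v\<in>T. 1/4 * g v) / card T = 1/4 * ((\<Sum>v\<in>T. g v) / card T)"
    by (simp flip: sum_divide_distrib)
  then have "card I / 8 \<le> (\<Sum>v\<in>T. 1/4 * g v) / card T" using mean by linarith
  then have "card T * exp (card I / 8) \<le> card T * exp ((\<Sum>v\<in>T. 1/4 * g v) / card T)"
    by (intro mult_left_mono) auto
  also have "\<dots> \<le> (\<Sum>v\<in>T. exp (1/4 * g v))" by (rule exp_mean_le[OF finT T(2)])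
  also have "\<dots> \<le> (\<Sum>v\<in>G. exp (1/4 * g v))" by (rule sum_mono2) (use finG T(1) in auto)
  also have "\<dots> \<le> card G * exp ((1/4)\<^sup>2 * (sqrt (card I))\<^sup>2)"
    using sg unfolding subgaussian_def by blast
  also have "(1/4)\<^sup>2 * (sqrt (card I))\<^sup>2 = card I / 16" by (simp add: power2_eq_square)
  finally have "card T * exp (card I / 8) * exp (- (card I / 16)) \<le> card G * exp (card I / 16) * exp (- (card I / 16))"
    by (rule mult_right_mono) simp
  then have "card T * exp (card I / 16) \<le> card G"
    by (simp add: mult.assoc exp_add[symmetric])
  then have "exp (card I / 16) \<le> card G / card T" using cT by (simp add: field_simps)
  then have "exp (card I / 16) ^ 16 \<le> (card G / card T) ^ 16" by (intro power_mono) auto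
  also have "exp (card I / 16) ^ 16 = exp 1 ^ card I"
    by (simp add: exp_of_nat_mult[symmetric])
  finally have ex: "exp 1 ^ card I \<le> (card G / card T) ^ 16" .
  have "card (span {0} I) \<le> 2 ^ card I" using card_span[of "{0}" I] finI by simp
  then have "real (card (span {0} I)) \<le> real (2 ^ card I)" by (simp only: of_nat_le_iff)
  then have "real (card (span {0} I)) \<le> 2 ^ card I" by simp
  also have "\<dots> \<le> exp 1 ^ card I"
    by (rule power_mono) (use exp_ge_add_one_self[of 1] in auto)
  also note ex
  finally have "real (card (span {0} I)) \<le> (card G / card T) ^ 16" .
  with that[of "span {0} I"] sub_span[OF sub_0 IG] I(3) show thesis by (auto simp: R_def)
qed

end

section \<open>Sumsets and additive energy\<close>

definition sumset :: "'a::ab_group_add set \<Rightarrow> 'a set \<Rightarrow> 'a set" where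
  "sumset A B = (\<lambda>(a, b). a + b) ` (A \<times> B)"

primrec msum :: "nat \<Rightarrow> 'a::ab_group_add set \<Rightarrow> 'a set" where
  "msum 0 B = {0}"
| "msum (Suc m) B = sumset B (msum m B)"

lemma sumsetI: "a \<in> A \<Longrightarrow> b \<in> B \<Longrightarrow> a + b \<in> sumset A B"
  unfolding sumset_def by (rule image_eqI[of _ _ "(a, b)"]) auto

lemma sumsetE:
  assumes "x \<in> sumset A B" obtains a b where "a \<in> A" "b \<in> B" "x = a + b"
  using assms unfolding sumset_def by auto

lemma finite_sumset: "finite A \<Longrightarrow> finite B \<Longrightarrow> finite (sumset A B)"
  by (simp add: sumset_def)

lemma sumset_mono: "A \<subseteq> A' \<Longrightarrow> B \<subseteq> B' \<Longrightarrow> sumset A B \<subseteq> sumset A' B'"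
  unfolding sumset_def by (intro image_mono Sigma_mono) auto

lemma sumset_comm: "sumset A B = sumset B A"
proof -
  have "sumset A B \<subseteq> sumset B A" for A B :: "'a set"
    by (auto elim!: sumsetE) (metis add.commute sumsetI)
  then show ?thesis by blast
qed

lemma sumset_assoc: "sumset (sumset A B) C = sumset A (sumset B C)"
proof
  show "sumset (sumset A B) C \<subseteq> sumset A (sumset B C)"
  proof
    fix x assume "x \<in> sumset (sumset A B) C"
    then obtain y c where y: "y \<in> sumset A B" "c \<in> C" "x = y + c" by (rule sumsetE)
    from y(1) obtain a b where "a \<in> A" "b \<in> B" "y = a + b" by (rule sumsetE)
    then show "x \<in> sumset A (sumset B C)" using y sumsetI[of a A "b + c"] sumsetI[of b B c C]
      by (simp add: add.assoc)
  qed
  show "sumset A (sumset B C) \<subseteq> sumset (sumset A B) C"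
  proof
    fix x assume "x \<in> sumset A (sumset B C)"
    then obtain a y where y: "a \<in> A" "y \<in> sumset B C" "x = a + y" by (rule sumsetE)
    from y(2) obtain b c where "b \<in> B" "c \<in> C" "y = b + c" by (rule sumsetE)
    then show "x \<in> sumset (sumset A B) C" using y sumsetI[of "a + b" _ c C] sumsetI[of a A b B]
      by (simp add: add.assoc)
  qed
qed

lemma sumset_0 [simp]: "sumset {0} A = A" "sumset A {0} = A"
  by (auto simp: sumset_def image_iff)

lemma card_sumset_ge:
  assumes "finite A" "finite B" "A \<noteq> {}" shows "card B \<le> card (sumset A B)"
proof -
  obtain a where "a \<in> A" using assms(3) by blast
  have "card B = card ((+) a ` B)" by (simp add: card_image)
  also have "\<dots> \<le> card (sumset A B)"
    by (rule card_mono) (use assms \<open>a \<in> A\<close> finite_sumset in \<open>auto intro: sumsetI\<close>)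
  finally show ?thesis .
qed

lemma finite_msum: "finite B \<Longrightarrow> finite (msum m B)"
  by (induction m) (auto intro: finite_sumset)

lemma msum_1 [simp]: "msum (Suc 0) B = B" by simp

lemma msum_add: "sumset (msum m B) (msum k B) = msum (m + k) B"
  by (induction m) (auto simp: sumset_assoc)

text \<open>Petridis's lemma. A new element \<open>c\<close> of \<open>C\<close> adds to the triple
  sumset at most a translate of \<open>sumset X B - sumset Z B\<close>, where \<open>Z\<close>
  collects the points whose translates were already covered, and minimality of \<open>X\<close>
  bounds \<open>sumset Z B\<close> from below. The ratios are cross-multiplied, so \<open>Y\<close>
  may be empty.\<close>

lemma petridis:
  fixes X B C :: "'a::ab_group_add set"
  assumes fin: "finite X" "finite B" "finite C"
    and minimal: "\<And>Y. Y \<subseteq> X \<Longrightarrow> card (sumset X B) * card Y \<le> card (sumset Y B) * card X"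
  shows "card X * card (sumset (sumset C X) B) \<le> card (sumset X B) * card (sumset C X)"
  using fin(3)
proof (induction C rule: finite_induct)
  case empty
  then show ?case by (simp add: sumset_def)
next
  case (insert c C)
  define S where "S = sumset C X"
  define Z where "Z = {x \<in> X. \<forall>b\<in>B. c + x + b \<in> sumset S B}"
  \<comment> \<open>\<open>W\<close> measures how much of the translate of \<open>X\<close> was
    already in \<open>S\<close>; \<open>W \<subseteq> Z\<close> makes the saving in the triple
    sumset at least proportional to the saving in \<open>sumset C X\<close>.\<close>
  define W where "W = {x \<in> X. c + x \<in> S}"
  have finS: "finite S" unfolding S_def using fin insert by (intro finite_sumset)
  have "W \<subseteq> Z" by (auto simp: W_def Z_def intro: sumsetI)
  have ZX: "Z \<subseteq> X" by (auto simp: Z_def)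
  have new: "sumset (insert c C) X = S \<union> (+) c ` (X - W)"
  proof -
    have "sumset (insert c C) X = S \<union> (+) c ` X"
      unfolding S_def sumset_def by auto
    then show ?thesis by (auto simp: W_def)
  qed
  have card_new: "card (sumset (insert c C) X) = card S + (card X - card W)"
  proof -
    have "card (S \<union> (+) c ` (X - W)) = card S + card ((+) c ` (X - W))"
      by (rule card_Un_disjoint) (use finS fin in \<open>auto simp: W_def\<close>)
    also have "card ((+) c ` (X - W)) = card (X - W)" by (simp add: card_image)
    also have "\<dots> = card X - card W"
      by (rule card_Diff_subset) (use fin finite_subset in \<open>auto simp: W_def\<close>)
    finally show ?thesis using new by simp
  qed
  have ZB: "sumset Z B \<subseteq> sumset X B" by (rule sumset_mono) (use ZX in auto)
  have sub: "sumset (sumset (insert c C) X) B \<subseteq> sumset S B \<union> (+) c ` (sumset X B - sumset Z B)"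
  proof
    fix y assume "y \<in> sumset (sumset (insert c C) X) B"
    then obtain s b where y: "s \<in> sumset (insert c C) X" "b \<in> B" "y = s + b" by (rule sumsetE)
    show "y \<in> sumset S B \<union> (+) c ` (sumset X B - sumset Z B)"
    proof (cases "y \<in> sumset S B")
      case False
      then have "s \<notin> S" using y sumsetI[of s S b B] by auto
      then obtain x where x: "x \<in> X" "s = c + x" using y(1) new by auto
      have "x + b \<notin> sumset Z B"
      proof
        assume "x + b \<in> sumset Z B"
        then obtain z b' where z: "z \<in> Z" "b' \<in> B" "x + b = z + b'" by (rule sumsetE)
        then have "y = c + z + b'" using x y by (simp add: add.assoc)
        then show False using z False by (auto simp: Z_def)
      qed
      then have "x + b \<in> sumset X B - sumset Z B" using x y by (auto intro: sumsetI)
      then show ?thesis using x y by (auto simp: add.assoc)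
    qed auto
  qed
  have finXB: "finite (sumset X B)" "finite (sumset Z B)" "finite (sumset S B)"
    using fin finS ZX finite_subset by (auto intro!: finite_sumset)
  have "card (sumset (sumset (insert c C) X) B) \<le> card (sumset S B \<union> (+) c ` (sumset X B - sumset Z B))"
    by (rule card_mono[OF _ sub]) (use finXB in auto)
  also have "\<dots> \<le> card (sumset S B) + card ((+) c ` (sumset X B - sumset Z B))"
    by (rule card_Un_le)
  also have "card ((+) c ` (sumset X B - sumset Z B)) = card (sumset X B) - card (sumset Z B)"
    using card_Diff_subset[OF finXB(2) ZB] by (simp add: card_image)
  finally have "card X * card (sumset (sumset (insert c C) X) B)
      \<le> card X * (card (sumset S B) + (card (sumset X B) - card (sumset Z B)))"
    by (rule mult_left_mono) simp
  also have "\<dots> = card X * card (sumset S B) + (card X * card (sumset X B) - card X * card (sumset Z B))"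
    by (simp add: distrib_left diff_mult_distrib2)
  also have "\<dots> \<le> card (sumset X B) * card S + (card (sumset X B) * card X - card (sumset X B) * card W)"
  proof (intro add_mono)
    show "card X * card (sumset S B) \<le> card (sumset X B) * card S"
      using insert.IH by (simp add: S_def)
    have "card W \<le> card Z" by (rule card_mono) (use \<open>W \<subseteq> Z\<close> ZX fin finite_subset in auto)
    then have "card (sumset X B) * card W \<le> card (sumset X B) * card Z" by simp
    also have "\<dots> \<le> card (sumset Z B) * card X" by (rule minimal[OF ZX])
    finally show "card X * card (sumset X B) - card X * card (sumset Z B)
        \<le> card (sumset X B) * card X - card (sumset X B) * card W"
      by (simp add: mult.commute diff_le_mono2)
  qed
  also have "\<dots> = card (sumset X B) * card (sumset (insert c C) X)"
    unfolding card_new by (simp add: distrib_left diff_mult_distrib2)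
  finally show ?case .
qed

text \<open>Petridis's lemma for a nonempty \<open>X \<subseteq> B\<close> of least expansion ratio,
  with \<open>msum m B\<close> in the role of \<open>C\<close>, costs one factor \<open>K\<close>
  per further summand. Adding \<open>X\<close> does not shrink \<open>msum m B\<close>, and
  \<open>card X \<le> card B\<close>.\<close>

lemma plunnecke:
  fixes B :: "'a::ab_group_add set" and K :: real
  assumes fin: "finite B" and ne: "B \<noteq> {}" and K: "real (card (sumset B B)) \<le> K * card B"
  shows "real (card (msum m B)) \<le> K ^ m * card B"
proof -
  define ratio where "ratio X = real (card (sumset X B)) / card X" for X
  define \<X> where "\<X> = Pow B - {{}}"
  have fin\<X>: "finite \<X>" "\<X> \<noteq> {}" using fin ne by (auto simp: \<X>_def)
  have "Min (ratio ` \<X>) \<in> ratio ` \<X>"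
    by (rule Min_in) (use fin\<X> in auto)
  then obtain X where X: "X \<in> \<X>" "ratio X = Min (ratio ` \<X>)" by auto
  have X_min: "ratio X \<le> ratio Y" if "Y \<in> \<X>" for Y
    unfolding X(2) by (rule Min_le) (use that fin\<X> in auto)
  have XB: "X \<subseteq> B" "X \<noteq> {}" "finite X" using X(1) fin finite_subset by (auto simp: \<X>_def)
  have cX: "real (card X) > 0" using XB by (simp add: card_gt_0_iff)
  have cB: "real (card B) > 0" using fin ne by (simp add: card_gt_0_iff)
  have "ratio X \<le> ratio B" by (rule X_min) (use ne in \<open>auto simp: \<X>_def\<close>)
  also have "\<dots> \<le> K" using K cB by (simp add: ratio_def field_simps)
  finally have XK: "real (card (sumset X B)) \<le> K * card X"
    using cX by (simp add: ratio_def field_simps)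
  have minimal: "card (sumset X B) * card Y \<le> card (sumset Y B) * card X" if "Y \<subseteq> X" for Y
  proof (cases "Y = {}")
    case False
    then have "Y \<in> \<X>" "real (card Y) > 0"
      using that XB finite_subset by (auto simp: \<X>_def card_gt_0_iff)
    then have "real (card (sumset X B)) * card Y \<le> card (sumset Y B) * real (card X)"
      using X_min[of Y] cX by (simp add: ratio_def field_simps)
    then show ?thesis by (simp flip: of_nat_mult)
  qed simp
  have "0 \<le> K * card B" using K by (rule order.trans[rotated]) simp
  then have K0: "K \<ge> 0" using cB by (simp add: zero_le_mult_iff)
  have "real (card (sumset (msum m B) X)) \<le> K ^ m * card X"
  proof (induction m)
    case 0
    then show ?case by simp
  next
    case (Suc m)
    have eq: "sumset (msum (Suc m) B) X = sumset (sumset (msum m B) X) B"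
      using sumset_comm[of B "sumset (msum m B) X"] by (simp add: sumset_assoc)
    have "real (card X) * card (sumset (sumset (msum m B) X) B)
        \<le> real (card (sumset X B)) * card (sumset (msum m B) X)"
      using petridis[OF XB(3) fin finite_msum[OF fin] minimal, of m] by (simp flip: of_nat_mult)
    also have "\<dots> \<le> (K * card X) * (K ^ m * card X)"
      by (intro mult_mono XK Suc.IH) (use K0 in auto)
    finally have "real (card X) * card (sumset (msum (Suc m) B) X) \<le> real (card X) * (K ^ Suc m * card X)"
      unfolding eq by (simp add: mult_ac)
    then show ?case using cX by simp
  qed
  then have "real (card (sumset X (msum m B))) \<le> K ^ m * card X" by (subst sumset_comm)
  moreover have "card (msum m B) \<le> card (sumset X (msum m B))"
    by (rule card_sumset_ge) (use XB fin finite_msum in auto)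
  moreover have "K ^ m * card X \<le> K ^ m * card B"
    using K0 XB fin by (intro mult_left_mono) (auto intro: card_mono)
  ultimately show ?thesis by linarith
qed

section \<open>Additive energy and the Balog--Szemeredi--Gowers lemma\<close>

context F2_pairing
begin

text \<open>In exponent two this counts the ordered representations of \<open>d\<close> as a sum,
  equivalently as a difference, of two elements of \<open>A\<close>; the sum of its squares is the
  additive energy.\<close>

definition corr :: "'a set \<Rightarrow> 'a \<Rightarrow> nat" where
  "corr A d = card {a \<in> A. a + d \<in> A}"

lemma sum_corr:
  assumes "A \<subseteq> G" shows "(\<Sum>d\<in>G. corr A d) = card A ^ 2"
proof -
  have finA: "finite A" using assms finG finite_subset by blast
  have c: "corr A d = (\<Sum>a\<in>A. if a + d \<in> A then 1 else 0)" for d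
    using finA by (simp add: corr_def sum.If_cases Int_def)
  have "(\<Sum>d\<in>G. corr A d) = (\<Sum>a\<in>A. \<Sum>d\<in>G. if a + d \<in> A then 1 else 0)"
    unfolding c by (rule sum.swap)
  also have "\<dots> = (\<Sum>a\<in>A. \<Sum>d\<in>G. if d \<in> A then 1 else 0)"
    by (rule sum.cong[OF refl]) (use sum_shift'[OF sub_G, where h = "\<lambda>d. if d \<in> A then 1 else 0 :: nat"] assms in auto)
  also have "(\<Sum>d\<in>G. if d \<in> A then 1 else 0) = card A"
    using finG assms by (simp add: sum.If_cases Int_absorb1)
  finally show ?thesis by (simp add: power2_eq_square)
qed

text \<open>Dependent random choice with a shift \<open>x\<close>: by the energy \<open>S x\<close>
  is large on average, while a pair with unpopular sum lies in \<open>S x\<close> for few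
  \<open>x\<close>. Discarding from a good \<open>S x\<close> the points with many unpopular
  partners leaves \<open>B\<close>. Any two of its points share many \<open>t\<close>, each of which
  yields many representations of their sum by four elements of \<open>A\<close>, and there are only
  \<open>card A ^ 4\<close> quadruples.\<close>

lemma balog_szemeredi_gowers:
  fixes \<kappa> :: real
  assumes A: "A \<subseteq> G" "A \<noteq> {}" and \<kappa>: "\<kappa> > 0"
    and energy: "(\<Sum>d\<in>G. real (corr A d) ^ 2) \<ge> card A ^ 3 / \<kappa>"
  obtains B where "B \<subseteq> A" "real (card B) \<ge> card A / (8 * \<kappa>)"
    "real (card (sumset B B)) \<le> 16384 * \<kappa> ^ 4 * card B"
proof -
  have finA: "finite A" using A(1) finG finite_subset by blast
  define n where "n = real (card A)"
  have n: "n > 0" using finA A(2) by (simp add: n_def card_gt_0_iff)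
  define S where "S x = {a \<in> A. a + x \<in> A}" for x
  have cS: "card (S x) = corr A x" for x by (simp add: S_def corr_def)
  define pop where "pop d \<longleftrightarrow> real (corr A d) \<ge> n / (16 * \<kappa>)" for d
  define bad where "bad x = {(s, t) \<in> S x \<times> S x. \<not> pop (s + t)}" for x
  have finS: "finite (S x)" for x using finA by (simp add: S_def)
  have SA: "S x \<subseteq> A" for x by (auto simp: S_def)
  have finbad: "finite (bad x)" for x
    by (rule finite_subset[of _ "S x \<times> S x"]) (use finS in \<open>auto simp: bad_def\<close>)
  have sum_bad: "(\<Sum>x\<in>G. real (card (bad x))) \<le> n ^ 2 * (n / (16 * \<kappa>))"
  proof -
    define Q where "Q = {(s, t) \<in> A \<times> A. \<not> pop (s + t)}"
    have finQ: "finite Q" by (rule finite_subset[of _ "A \<times> A"]) (use finA in \<open>auto simp: Q_def\<close>)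
    have cQ: "real (card Q) \<le> n ^ 2"
    proof -
      have "card Q \<le> card (A \<times> A)" by (rule card_mono) (use finA in \<open>auto simp: Q_def\<close>)
      then have "real (card Q) \<le> real (card A * card A)" by (simp only: card_cartesian_product of_nat_le_iff)
      then show ?thesis by (simp add: n_def power2_eq_square)
    qed
    have b: "real (card (bad x)) = (\<Sum>q\<in>Q. if fst q + x \<in> A \<and> snd q + x \<in> A then 1 else 0)" for x
    proof -
      have "bad x = {q \<in> Q. fst q + x \<in> A \<and> snd q + x \<in> A}" by (auto simp: bad_def Q_def S_def)
      then show ?thesis using finQ by (simp add: sum.If_cases Int_def)
    qed
    have "(\<Sum>x\<in>G. real (card (bad x))) = (\<Sum>q\<in>Q. \<Sum>x\<in>G. if fst q + x \<in> A \<and> snd q + x \<in> A then 1 else 0)"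
      unfolding b by (rule sum.swap)
    also have "\<dots> \<le> (\<Sum>q\<in>Q. n / (16 * \<kappa>))"
    proof (rule sum_mono)
      fix q assume q: "q \<in> Q"
      then have qA: "fst q \<in> A" "snd q \<in> A" by (auto simp: Q_def)
      then have qG: "fst q \<in> G" using A by auto
      have "(\<Sum>x\<in>G. if fst q + x \<in> A \<and> snd q + x \<in> A then 1 else 0 :: real)
          = (\<Sum>x\<in>G. if fst q + (fst q + x) \<in> A \<and> snd q + (fst q + x) \<in> A then 1 else 0)"
        using sum_shift'[OF sub_G qG, symmetric] .
      also have "\<dots> = (\<Sum>x\<in>G. if x \<in> A \<and> x + (fst q + snd q) \<in> A then 1 else 0)"
        by (simp add: ac_simps)
      also have "\<dots> = real (card (G \<inter> {x \<in> A. x + (fst q + snd q) \<in> A}))"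
        using finG by (simp add: sum.If_cases Int_def)
      also have "G \<inter> {x \<in> A. x + (fst q + snd q) \<in> A} = {x \<in> A. x + (fst q + snd q) \<in> A}"
        using A by auto
      finally have "(\<Sum>x\<in>G. if fst q + x \<in> A \<and> snd q + x \<in> A then 1 else 0) = real (corr A (fst q + snd q))"
        by (simp add: corr_def)
      then show "(\<Sum>x\<in>G. if fst q + x \<in> A \<and> snd q + x \<in> A then 1 else 0) \<le> n / (16 * \<kappa>)"
        using q by (auto simp: Q_def pop_def)
    qed
    also have "\<dots> \<le> n ^ 2 * (n / (16 * \<kappa>))"
      using mult_right_mono[OF cQ, of "n / (16 * \<kappa>)"] n \<kappa> by simp
    finally show ?thesis .
  qed
  \<comment> \<open>The weights balance three sums over \<open>x\<close>: the energy is at least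
    \<open>n ^ 3 / \<kappa>\<close>, and the two subtracted terms take at most one half and one
    quarter of that.\<close>
  have "\<exists>x\<in>G. real (corr A x) ^ 2 - 8 * card (bad x) - n / (4 * \<kappa>) * corr A x > 0"
  proof (rule ccontr)
    assume "\<not> ?thesis"
    then have "(\<Sum>x\<in>G. real (corr A x) ^ 2 - 8 * card (bad x) - n / (4 * \<kappa>) * corr A x) \<le> 0"
      by (intro sum_nonpos) force
    then have "(\<Sum>x\<in>G. real (corr A x) ^ 2) \<le> 8 * (\<Sum>x\<in>G. real (card (bad x))) + n / (4 * \<kappa>) * (\<Sum>x\<in>G. real (corr A x))"
      by (simp add: sum_subtractf sum_distrib_left)
    also have "(\<Sum>x\<in>G. real (corr A x)) = n ^ 2"
      using sum_corr[OF A(1)] by (simp add: n_def flip: of_nat_sum)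
    also have "8 * (\<Sum>x\<in>G. real (card (bad x))) + n / (4 * \<kappa>) * n ^ 2 \<le> 8 * (n ^ 2 * (n / (16 * \<kappa>))) + n / (4 * \<kappa>) * n ^ 2"
      using sum_bad by linarith
    also have "\<dots> = 3/4 * (n ^ 3 / \<kappa>)" by (simp add: power2_eq_square power3_eq_cube)
    finally have "n ^ 3 / \<kappa> \<le> 3/4 * (n ^ 3 / \<kappa>)" using energy by (simp add: n_def)
    moreover have "n ^ 3 / \<kappa> > 0" using n \<kappa> by simp
    ultimately show False by linarith
  qed
  then obtain x where x: "x \<in> G" "real (corr A x) ^ 2 - 8 * card (bad x) - n / (4 * \<kappa>) * corr A x > 0" by blast
  define s where "s = real (card (S x))"
  have s0: "s \<ge> 0" by (simp add: s_def)
  have x': "s ^ 2 - 8 * card (bad x) - n / (4 * \<kappa>) * s > 0" using x(2) by (simp add: s_def cS)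
  have s_big: "s \<ge> n / (4 * \<kappa>)"
  proof (rule ccontr)
    assume "\<not> ?thesis"
    then have "s * s \<le> n / (4 * \<kappa>) * s" using s0 by (intro mult_right_mono) auto
    then show False using x' by (simp add: power2_eq_square)
  qed
  have s_pos: "s > 0" using s_big n \<kappa> by (meson divide_pos_pos less_le_trans mult_pos_pos zero_less_numeral)
  have bad_le: "real (card (bad x)) \<le> s ^ 2 / 8"
  proof -
    have "n / (4 * \<kappa>) * s \<ge> 0" using n \<kappa> s0 by simp
    then show ?thesis using x' by linarith
  qed
  define B where "B = {a \<in> S x. real (card {t \<in> S x. \<not> pop (a + t)}) \<le> s / 4}"
  have BS: "B \<subseteq> S x" by (auto simp: B_def)
  have finB: "finite B" using BS finS finite_subset by blast
  have cB: "real (card B) \<ge> s / 2"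
  proof -
    have "bad x = Sigma (S x) (\<lambda>a. {t \<in> S x. \<not> pop (a + t)})" by (auto simp: bad_def)
    then have bad_eq: "real (card (bad x)) = (\<Sum>a\<in>S x. real (card {t \<in> S x. \<not> pop (a + t)}))"
      using finS by simp
    have "real (card (S x - B)) * (s / 4) = (\<Sum>a\<in>S x - B. s / 4)" by simp
    also have "\<dots> \<le> (\<Sum>a\<in>S x - B. real (card {t \<in> S x. \<not> pop (a + t)}))"
      by (rule sum_mono) (auto simp: B_def)
    also have "\<dots> \<le> real (card (bad x))"
      unfolding bad_eq by (rule sum_mono2) (use finS in auto)
    also note bad_le
    finally have "real (card (S x - B)) * (s / 4) \<le> s ^ 2 / 8" .
    then have "real (card (S x - B)) \<le> s / 2"
      using s_pos by (simp add: power2_eq_square field_simps)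
    moreover have "real (card (S x - B)) = s - card B"
      using card_Diff_subset[OF finB BS] card_mono[OF finS BS] by (simp add: s_def of_nat_diff)
    ultimately show ?thesis by linarith
  qed
  define q where "q = n / (16 * \<kappa>)"
  have q0: "q > 0" using n \<kappa> by (simp add: q_def)
  define quads where "quads d = {w \<in> (A \<times> A) \<times> (A \<times> A). fst (fst w) + snd (fst w) + (fst (snd w) + snd (snd w)) = d}" for d
  have finquads: "finite (quads d)" for d
    by (rule finite_subset[of _ "(A \<times> A) \<times> (A \<times> A)"]) (use finA in \<open>auto simp: quads_def\<close>)
  have many: "real (card (quads d)) \<ge> s / 2 * q ^ 2" if d: "d \<in> sumset B B" for d
  proof -
    obtain a b where ab: "a \<in> B" "b \<in> B" "d = a + b" using d by (rule sumsetE)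
    define T where "T = {t \<in> S x. pop (a + t) \<and> pop (b + t)}"
    have finT: "finite T" using finS by (simp add: T_def)
    have cT: "real (card T) \<ge> s / 2"
    proof -
      have "S x \<subseteq> T \<union> {t \<in> S x. \<not> pop (a + t)} \<union> {t \<in> S x. \<not> pop (b + t)}" by (auto simp: T_def)
      then have "card (S x) \<le> card (T \<union> {t \<in> S x. \<not> pop (a + t)} \<union> {t \<in> S x. \<not> pop (b + t)})"
        by (rule card_mono[rotated]) (use finT finS in auto)
      also have "\<dots> \<le> card T + card {t \<in> S x. \<not> pop (a + t)} + card {t \<in> S x. \<not> pop (b + t)}"
        by (intro order.trans[OF card_Un_le] add_mono card_Un_le) auto
      finally have "s \<le> card T + real (card {t \<in> S x. \<not> pop (a + t)}) + real (card {t \<in> S x. \<not> pop (b + t)})"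
        unfolding s_def by linarith
      then show ?thesis using ab by (auto simp: B_def)
    qed
    \<comment> \<open>The sum is split as \<open>a + b = (a + t) + (b + t)\<close> with both parts
      popular. The resulting quadruple determines \<open>u\<close>, \<open>v\<close> and
      \<open>t\<close>, so nothing is counted twice.\<close>
    define D where "D = Sigma T (\<lambda>t. {u \<in> A. u + (a + t) \<in> A} \<times> {v \<in> A. v + (b + t) \<in> A})"
    define \<phi> where "\<phi> = (\<lambda>(t, u, v). ((u, u + (a + t)), (v, v + (b + t))))"
    have "inj_on \<phi> D" by (auto simp: inj_on_def \<phi>_def)
    have "\<phi> ` D \<subseteq> quads d"
    proof -
      have "u + (u + (a + t)) + (v + (v + (b + t))) = a + b" for u v t
      proof -
        have "u + (u + (a + t)) + (v + (v + (b + t))) = (a + t) + (b + t)" by simp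
        also have "\<dots> = a + (b + (t + t))" by (simp only: ac_simps)
        finally show ?thesis by simp
      qed
      then show ?thesis by (auto simp: \<phi>_def D_def quads_def ab(3))
    qed
    then have "card (\<phi> ` D) \<le> card (quads d)" by (rule card_mono[OF finquads])
    then have "card D \<le> card (quads d)" using card_image[OF \<open>inj_on \<phi> D\<close>] by simp
    moreover have "real (card D) = (\<Sum>t\<in>T. real (corr A (a + t)) * corr A (b + t))"
      unfolding D_def using finT finA by (simp add: corr_def card_cartesian_product)
    moreover have "(\<Sum>t\<in>T. real (corr A (a + t)) * corr A (b + t)) \<ge> (\<Sum>t\<in>T. q * q)"
      by (intro sum_mono mult_mono) (use q0 in \<open>auto simp: T_def pop_def q_def\<close>)
    moreover have "(\<Sum>t\<in>T. q * q) \<ge> s / 2 * q ^ 2"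
      using mult_right_mono[OF cT, of "q * q"] by (simp add: power2_eq_square)
    ultimately show ?thesis by linarith
  qed
  have "real (card (sumset B B)) * (s / 2 * q ^ 2) = (\<Sum>d\<in>sumset B B. s / 2 * q ^ 2)" by simp
  also have "\<dots> \<le> (\<Sum>d\<in>sumset B B. real (card (quads d)))" by (rule sum_mono) (rule many)
  also have "\<dots> = real (card (\<Union>d\<in>sumset B B. quads d))"
    by (subst card_UN_disjoint) (use finite_sumset finB finquads in \<open>auto simp: quads_def\<close>)
  also have "\<dots> \<le> real (card ((A \<times> A) \<times> (A \<times> A)))"
    unfolding of_nat_le_iff by (rule card_mono) (use finA in \<open>auto simp: quads_def\<close>)
  also have "\<dots> = n ^ 4" by (simp add: card_cartesian_product n_def power4_eq_xxxx)
  finally have 1: "real (card (sumset B B)) * (s / 2 * q ^ 2) \<le> n ^ 4" .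
  have "n \<le> 4 * \<kappa> * s" using s_big \<kappa> by (simp add: field_simps)
  also have "\<dots> \<le> 4 * \<kappa> * (2 * card B)" using cB \<kappa> by (intro mult_left_mono) auto
  finally have nB: "n \<le> 8 * \<kappa> * card B" by simp
  have "real (card (sumset B B)) * (n / (8 * \<kappa>) * (n / (16 * \<kappa>)) ^ 2)
      \<le> real (card (sumset B B)) * (s / 2 * q ^ 2)"
    unfolding q_def using s_big \<kappa> by (intro mult_left_mono mult_right_mono) auto
  also note 1
  also have "n ^ 4 \<le> n ^ 3 * (8 * \<kappa> * card B)"
    using mult_left_mono[OF nB, of "n ^ 3"] n by (simp add: eval_nat_numeral)
  also have "real (card (sumset B B)) * (n / (8 * \<kappa>) * (n / (16 * \<kappa>)) ^ 2) =
      n ^ 3 * (real (card (sumset B B)) / (2048 * \<kappa> ^ 3))"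
    by (simp add: power_divide power_mult_distrib eval_nat_numeral)
  finally have "real (card (sumset B B)) / (2048 * \<kappa> ^ 3) \<le> 8 * \<kappa> * card B"
    using n by (subst (asm) mult_le_cancel_left_pos) auto
  then have 2: "real (card (sumset B B)) \<le> 16384 * \<kappa> ^ 4 * card B"
    using \<kappa> by (simp add: field_simps eval_nat_numeral)
  have "real (card B) \<ge> card A / (8 * \<kappa>)"
    using nB \<kappa> by (simp add: n_def field_simps)
  with that[of B] 2 BS SA[of x] show thesis by blast
qed

text \<open>As \<open>f\<close> need not vanish off \<open>A\<close>, it is paired with the sign of
  \<open>z\<close> on \<open>A\<close>. One Cauchy--Schwarz with weight
  \<open>\<bar>hat f r\<bar>\<close> spends the bound \<open>M\<close>, a second one spends the L2
  hypothesis, and the remaining fourth moment of \<open>hat \<phi>\<close> is controlled by the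
  energy of \<open>A\<close>, because \<open>\<bar>\<phi>\<bar>\<close> is at most the indicator of
  \<open>A\<close>.\<close>

lemma energy_lower_bound:
  assumes M: "M \<ge> 1" "anorm f \<le> M"
    and z: "\<And>x. x \<in> G \<Longrightarrow> z x \<in> \<int>" and close: "\<And>x. x \<in> G \<Longrightarrow> \<bar>f x - z x\<bar> \<le> 1/8"
    and l2: "(\<Sum>x\<in>G. (f x)\<^sup>2) \<le> (\<Sum>x\<in>G. (z x)\<^sup>2)"
  defines "A \<equiv> {x \<in> G. z x \<noteq> 0}"
  shows "(\<Sum>d\<in>G. real (corr A d) ^ 2) \<ge> card A ^ 3 / (4 * M ^ 4)"
proof -
  define N where "N = real (card G)"
  have N: "N > 0" by (simp add: N_def)
  define n where "n = real (card A)"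
  have n0: "n \<ge> 0" by (simp add: n_def)
  have finA: "finite A" "A \<subseteq> G" using finG by (auto simp: A_def)
  define \<phi> where "\<phi> x = (if x \<in> A then sgn (z x) else 0)" for x
  have "n * (7/8) = (\<Sum>x\<in>A. 7/8)" by (simp add: n_def)
  also have "\<dots> \<le> (\<Sum>x\<in>A. f x * \<phi> x)"
  proof (rule sum_mono)
    fix x assume x: "x \<in> A"
    then have xG: "x \<in> G" "z x \<noteq> 0" by (auto simp: A_def)
    obtain k where k: "z x = of_int k" using z[OF xG(1)] by (auto elim: Ints_cases)
    then have "\<bar>z x\<bar> \<ge> 1" using xG(2) by simp
    then have "z x > 0 \<and> f x \<ge> 7/8 \<or> z x < 0 \<and> - f x \<ge> 7/8"
      using close[OF xG(1)] by linarith
    then show "7/8 \<le> f x * \<phi> x" using x by (auto simp: \<phi>_def)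
  qed
  also have "\<dots> = (\<Sum>x\<in>G. f x * \<phi> x)"
    by (rule sum.mono_neutral_left) (use finG finA in \<open>auto simp: \<phi>_def\<close>)
  also have "\<dots> = N * (\<Sum>r\<in>G. hat f r * hat \<phi> r)" using N by (simp add: parseval2 N_def)
  finally have h1: "7/8 * (n / N) \<le> (\<Sum>r\<in>G. hat f r * hat \<phi> r)" using N by (simp add: field_simps)
  have f2: "(\<Sum>r\<in>G. (hat f r)\<^sup>2) \<le> 2 * M\<^sup>2 * (n / N)"
  proof -
    have "(\<Sum>x\<in>G. (z x)\<^sup>2) = (\<Sum>x\<in>A. (z x)\<^sup>2)"
      by (rule sum.mono_neutral_right) (use finG in \<open>auto simp: A_def\<close>)
    also have "\<dots> \<le> (\<Sum>x\<in>A. 2 * M\<^sup>2)"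
    proof (rule sum_mono)
      fix x assume "x \<in> A"
      then have x: "x \<in> G" by (simp add: A_def)
      \<comment> \<open>As \<open>M \<ge> 1\<close>, the distance \<open>1/8\<close> is absorbed in
        \<open>9/8 * M\<close>, and \<open>(9/8)\<^sup>2 \<le> 2\<close>.\<close>
      have "\<bar>z x\<bar> \<le> 9/8 * M" using sup_le_anorm[OF x, of f] close[OF x] M by linarith
      then have "(z x)\<^sup>2 \<le> (9/8 * M)\<^sup>2" by (metis abs_ge_zero power2_abs power_mono)
      also have "\<dots> \<le> 2 * M\<^sup>2" by (simp add: power_mult_distrib power2_eq_square)
      finally show "(z x)\<^sup>2 \<le> 2 * M\<^sup>2" .
    qed
    also have "\<dots> = 2 * M\<^sup>2 * n" by (simp add: n_def)
    finally have "(\<Sum>x\<in>G. (f x)\<^sup>2) \<le> 2 * M\<^sup>2 * n" using l2 by linarith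
    then show ?thesis unfolding parseval N_def[symmetric] using N by (simp add: divide_right_mono)
  qed
  define X where "X = (\<Sum>r\<in>G. \<bar>hat f r\<bar> * (hat \<phi> r)\<^sup>2)"
  define Y where "Y = (\<Sum>r\<in>G. (hat \<phi> r) ^ 4)"
  have X0: "X \<ge> 0" by (simp add: X_def sum_nonneg)
  have Y0: "Y \<ge> 0" by (simp add: Y_def sum_nonneg)
  have h2: "(\<Sum>r\<in>G. hat f r * hat \<phi> r)\<^sup>2 \<le> M * X"
  proof -
    have "(\<Sum>r\<in>G. hat f r * hat \<phi> r)\<^sup>2 = (\<Sum>r\<in>G. sqrt \<bar>hat f r\<bar> * (sgn (hat f r) * sqrt \<bar>hat f r\<bar> * hat \<phi> r))\<^sup>2"
    proof (intro arg_cong[where f = "\<lambda>u. u\<^sup>2"] sum.cong refl)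
      fix r
      have "sqrt \<bar>hat f r\<bar> * (sgn (hat f r) * sqrt \<bar>hat f r\<bar> * hat \<phi> r) = (sgn (hat f r) * (sqrt \<bar>hat f r\<bar> * sqrt \<bar>hat f r\<bar>)) * hat \<phi> r"
        by (simp only: mult_ac)
      also have "\<dots> = hat f r * hat \<phi> r" by (simp add: sgn_mult_abs)
      finally show "hat f r * hat \<phi> r = sqrt \<bar>hat f r\<bar> * (sgn (hat f r) * sqrt \<bar>hat f r\<bar> * hat \<phi> r)" by (rule sym)
    qed
    also have "\<dots> \<le> (\<Sum>r\<in>G. (sqrt \<bar>hat f r\<bar>)\<^sup>2) * (\<Sum>r\<in>G. (sgn (hat f r) * sqrt \<bar>hat f r\<bar> * hat \<phi> r)\<^sup>2)"
      by (rule Cauchy_Schwarz_ineq_sum)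
    also have "(\<Sum>r\<in>G. (sqrt \<bar>hat f r\<bar>)\<^sup>2) = anorm f" by (simp add: anorm_def)
    also have "(\<Sum>r\<in>G. (sgn (hat f r) * sqrt \<bar>hat f r\<bar> * hat \<phi> r)\<^sup>2) = X"
      unfolding X_def by (rule sum.cong) (auto simp: power_mult_distrib sgn_if)
    also have "anorm f * X \<le> M * X" by (rule mult_right_mono[OF M(2) X0])
    finally show ?thesis .
  qed
  have h3: "X\<^sup>2 \<le> 2 * M\<^sup>2 * (n / N) * Y"
  proof -
    have "X\<^sup>2 \<le> (\<Sum>r\<in>G. \<bar>hat f r\<bar>\<^sup>2) * (\<Sum>r\<in>G. ((hat \<phi> r)\<^sup>2)\<^sup>2)"
      unfolding X_def by (rule Cauchy_Schwarz_ineq_sum)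
    also have "\<dots> = (\<Sum>r\<in>G. (hat f r)\<^sup>2) * Y" by (simp add: Y_def flip: power_mult)
    also have "\<dots> \<le> 2 * M\<^sup>2 * (n / N) * Y" by (rule mult_right_mono[OF f2 Y0])
    finally show ?thesis .
  qed
  have h4: "(7/8 * (n / N)) ^ 4 \<le> M\<^sup>2 * (2 * M\<^sup>2 * (n / N) * Y)"
  proof -
    have "(7/8 * (n / N)) ^ 4 = ((7/8 * (n / N))\<^sup>2)\<^sup>2" by (simp flip: power_mult)
    also have "\<dots> \<le> ((\<Sum>r\<in>G. hat f r * hat \<phi> r)\<^sup>2)\<^sup>2"
      using h1 n0 N by (intro power_mono) auto
    also have "\<dots> \<le> (M * X)\<^sup>2" by (rule power_mono[OF h2]) simp
    also have "\<dots> \<le> M\<^sup>2 * (2 * M\<^sup>2 * (n / N) * Y)"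
      unfolding power_mult_distrib by (rule mult_left_mono[OF h3]) simp
    finally show ?thesis .
  qed
  \<comment> \<open>The autocorrelation of \<open>\<phi>\<close>: its transform is a multiple of the
    square of \<open>hat \<phi>\<close>, so Parseval for \<open>\<psi>\<close> evaluates the fourth
    moment \<open>Y\<close>.\<close>
  define \<psi> where "\<psi> d = (\<Sum>x\<in>G. \<phi> x * \<phi> (x + d))" for d
  have hat\<psi>: "hat \<psi> r = N * (hat \<phi> r)\<^sup>2" if "r \<in> G" for r
  proof -
    have "(\<Sum>d\<in>G. \<psi> d * e r d) = (\<Sum>x\<in>G. \<Sum>d\<in>G. \<phi> x * \<phi> (x + d) * e r d)"
      unfolding \<psi>_def sum_distrib_right by (rule sum.swap)
    also have "\<dots> = (\<Sum>x\<in>G. \<phi> x * e r x * (\<Sum>d\<in>G. \<phi> (x + d) * e r (x + d)))"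
      unfolding sum_distrib_left by (intro sum.cong refl) (simp add: e_add mult_ac)
    also have "\<dots> = (\<Sum>x\<in>G. \<phi> x * e r x * (\<Sum>d\<in>G. \<phi> d * e r d))"
      by (intro sum.cong refl) (simp add: sum_shift'[OF sub_G, where h = "\<lambda>d. \<phi> d * e r d"])
    also have "\<dots> = (\<Sum>x\<in>G. \<phi> x * e r x) * (\<Sum>d\<in>G. \<phi> d * e r d)" by (simp add: sum_distrib_right)
    finally show ?thesis unfolding hat_def N_def using N by (simp add: N_def power2_eq_square)
  qed
  have "N\<^sup>2 * Y = (\<Sum>r\<in>G. (hat \<psi> r)\<^sup>2)"
    unfolding Y_def sum_distrib_left by (rule sum.cong) (auto simp: hat\<psi> power_mult_distrib simp flip: power_mult)
  also have "\<dots> = (\<Sum>d\<in>G. (\<psi> d)\<^sup>2) / N" by (simp add: parseval N_def)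
  also have "\<dots> \<le> (\<Sum>d\<in>G. real (corr A d) ^ 2) / N"
  proof (intro divide_right_mono sum_mono)
    fix d
    have "\<bar>\<psi> d\<bar> \<le> (\<Sum>x\<in>G. \<bar>\<phi> x * \<phi> (x + d)\<bar>)" unfolding \<psi>_def by (rule sum_abs)
    also have "\<dots> \<le> (\<Sum>x\<in>G. if x \<in> A \<and> x + d \<in> A then 1 else 0)"
      by (rule sum_mono) (auto simp: \<phi>_def sgn_if abs_mult)
    also have "\<dots> = real (card (G \<inter> {x \<in> A. x + d \<in> A}))" using finG by (simp add: sum.If_cases Int_def)
    also have "G \<inter> {x \<in> A. x + d \<in> A} = {x \<in> A. x + d \<in> A}" using finA by auto
    finally have "\<bar>\<psi> d\<bar> \<le> real (corr A d)" by (simp add: corr_def)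
    then show "(\<psi> d)\<^sup>2 \<le> real (corr A d) ^ 2" by (metis abs_ge_zero power2_abs power_mono)
  qed (use N in auto)
  finally have h5: "N ^ 3 * Y \<le> (\<Sum>d\<in>G. real (corr A d) ^ 2)"
    using N by (simp add: field_simps power2_eq_square power3_eq_cube)
  show ?thesis
  proof (cases "n = 0")
    case True
    then show ?thesis by (simp add: n_def sum_nonneg)
  next
    case False
    then have n: "n > 0" using n0 by simp
    have "N ^ 4 * (7/8 * (n / N)) ^ 4 \<le> N ^ 4 * (M\<^sup>2 * (2 * M\<^sup>2 * (n / N) * Y))"
      by (rule mult_left_mono[OF h4]) (use N in simp)
    also have "N ^ 4 * (7/8 * (n / N)) ^ 4 = 2401/4096 * n ^ 4"
      using N by (simp add: power_mult_distrib power_divide)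
    also have "N ^ 4 * (M\<^sup>2 * (2 * M\<^sup>2 * (n / N) * Y)) = 2 * M ^ 4 * n * (N ^ 3 * Y)"
      using N by (simp add: eval_nat_numeral)
    finally have "n * (2401/4096 * n ^ 3) \<le> n * (2 * M ^ 4 * (N ^ 3 * Y))"
      by (simp add: eval_nat_numeral mult_ac)
    then have "2401/4096 * n ^ 3 \<le> 2 * M ^ 4 * (N ^ 3 * Y)" using n by simp
    also have "\<dots> \<le> 2 * M ^ 4 * (\<Sum>d\<in>G. real (corr A d) ^ 2)"
      using h5 M by (intro mult_left_mono) auto
    finally have "2401/4096 * n ^ 3 \<le> 2 * (M ^ 4 * (\<Sum>d\<in>G. real (corr A d) ^ 2))" by simp
    moreover have "M ^ 4 * (\<Sum>d\<in>G. real (corr A d) ^ 2) \<ge> 0" by (simp add: sum_nonneg)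
    \<comment> \<open>\<open>(7/8) ^ 4 = 2401/4096\<close> exceeds \<open>1/2\<close>, so the factor
      2 from the L2 bound becomes at most 4.\<close>
    ultimately have "n ^ 3 \<le> 4 * M ^ 4 * (\<Sum>d\<in>G. real (corr A d) ^ 2)" by linarith
    then show ?thesis using M by (simp add: n_def field_simps)
  qed
qed

end

section \<open>Almost periods and dense subspaces\<close>

text \<open>A Hoeffding bound for \<open>k\<close> independent uniform samples from
  \<open>B\<close>: over the extensional functions as sample space, exponential moments factor into
  coordinates. The parameter \<open>d / 2\<close> minimises
  \<open>k * t\<^sup>2 - t * k * d\<close>.\<close>

lemma chernoff_tuples:
  fixes X :: "'b \<Rightarrow> real"
  assumes fin: "finite B" and X: "\<And>b. b \<in> B \<Longrightarrow> \<bar>X b\<bar> \<le> 1" "(\<Sum>b\<in>B. X b) = 0"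
    and d: "0 < d" "d \<le> 1"
  shows "real (card {a \<in> PiE {..<k} (\<lambda>_. B). \<bar>\<Sum>i<k. X (a i)\<bar> > k * d})
      \<le> 2 * exp (- (k * d\<^sup>2 / 4)) * card B ^ k"
proof -
  define P where "P = PiE {..<k} (\<lambda>_. B)"
  have finP: "finite P" unfolding P_def using fin by (intro finite_PiE) auto
  define g where "g a = (\<Sum>i<k. X (a i))" for a :: "nat \<Rightarrow> 'b"
  define t where "t = d / 2"
  have moment: "(\<Sum>a\<in>P. exp (s * g a)) \<le> card B ^ k * exp (k * t\<^sup>2)" if s: "\<bar>s\<bar> = t" for s
  proof -
    have s2: "s\<^sup>2 = t\<^sup>2" using s by (metis power2_abs)
    have s1: "\<bar>s\<bar> \<le> 1" using s d by (simp add: t_def)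
    have "(\<Sum>b\<in>B. exp (s * X b)) \<le> (\<Sum>b\<in>B. 1 + s * X b + t\<^sup>2)"
    proof (rule sum_mono)
      fix b assume b: "b \<in> B"
      have "\<bar>s * X b\<bar> \<le> 1 * 1" unfolding abs_mult by (rule mult_mono) (use s1 X(1)[OF b] in auto)
      then have "exp (s * X b) \<le> 1 + s * X b + (s * X b)\<^sup>2" by (intro exp_le_quadratic) simp
      moreover have "(s * X b)\<^sup>2 \<le> t\<^sup>2"
      proof -
        have "(X b)\<^sup>2 \<le> 1" using X(1)[OF b] by (simp add: abs_square_le_1)
        then show ?thesis unfolding power_mult_distrib s2 by (simp add: mult_left_le)
      qed
      ultimately show "exp (s * X b) \<le> 1 + s * X b + t\<^sup>2" by linarith
    qed
    also have "\<dots> = card B * (1 + t\<^sup>2)"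
      using X(2) by (simp add: sum.distrib sum_distrib_left[symmetric] distrib_left)
    also have "\<dots> \<le> card B * exp (t\<^sup>2)" by (intro mult_left_mono exp_ge_add_one_self) simp
    finally have 1: "(\<Sum>b\<in>B. exp (s * X b)) \<le> card B * exp (t\<^sup>2)" .
    have "(\<Sum>a\<in>P. exp (s * g a)) = (\<Sum>a\<in>P. \<Prod>i<k. exp (s * X (a i)))"
      by (simp add: g_def sum_distrib_left exp_sum)
    also have "\<dots> = (\<Prod>i<k. \<Sum>b\<in>B. exp (s * X b))"
      unfolding P_def by (rule prod_sum_PiE[symmetric]) (use fin in auto)
    also have "\<dots> \<le> (card B * exp (t\<^sup>2)) ^ k"
      using 1 by (simp add: power_mono sum_nonneg)
    finally show ?thesis by (simp add: power_mult_distrib exp_of_nat_mult)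
  qed
  define Q where "Q = {a \<in> P. \<bar>g a\<bar> > k * d}"
  have "card Q * exp (t * (k * d)) \<le> 2 * (card B ^ k * exp (k * t\<^sup>2))"
    unfolding Q_def by (rule card_abs_gt_le[OF finP _ moment moment]) (use d in \<open>auto simp: t_def\<close>)
  then have "card Q * exp (t * (k * d)) * exp (- (t * (k * d))) \<le> 2 * card B ^ k * exp (k * t\<^sup>2) * exp (- (t * (k * d)))"
    by (intro mult_right_mono) auto
  then have "card Q \<le> 2 * card B ^ k * (exp (k * t\<^sup>2) * exp (- (t * (k * d))))"
    by (simp add: mult.assoc exp_minus_inverse)
  also have "exp (k * t\<^sup>2) * exp (- (t * (k * d))) = exp (- (k * d\<^sup>2 / 4))"
    unfolding exp_add[symmetric] by (simp add: t_def power2_eq_square algebra_simps)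
  finally show ?thesis unfolding Q_def g_def P_def by (simp add: mult_ac)
qed

context F2_pairing
begin

text \<open>Convolution with the indicator of \<open>T\<close> twice, without normalisation: the
  Fourier multiplier is a square, and powers of \<open>card T\<close> appear explicitly in the
  estimates.\<close>

definition period_op :: "'a set \<Rightarrow> ('a \<Rightarrow> real) \<Rightarrow> 'a \<Rightarrow> real" where
  "period_op T g x = (\<Sum>t\<in>T. \<Sum>u\<in>T. g (x + (t + u)))"

lemma hat_period_op:
  assumes "T \<subseteq> G"
  shows "hat (period_op T g) r = (\<Sum>t\<in>T. e r t)\<^sup>2 * hat g r"
proof -
  have "hat (period_op T g) r = (\<Sum>t\<in>T. \<Sum>u\<in>T. hat (\<lambda>x. g (x + (t + u))) r)"
    unfolding hat_def period_op_def sum_divide_distrib sum_distrib_right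
    by (subst sum.swap, rule sum.cong[OF refl], subst sum.swap, rule refl)
  also have "\<dots> = (\<Sum>t\<in>T. \<Sum>u\<in>T. e r t * e r u * hat g r)"
  proof (intro sum.cong refl)
    fix t u assume "t \<in> T" "u \<in> T"
    then have "t + u \<in> G" using assms addG by blast
    then show "hat (\<lambda>x. g (x + (t + u))) r = e r t * e r u * hat g r"
      by (simp add: hat_shift_sum e_add)
  qed
  also have "\<dots> = (\<Sum>t\<in>T. e r t)\<^sup>2 * hat g r"
    unfolding power2_eq_square sum_product by (simp flip: sum_distrib_right)
  finally show ?thesis .
qed

lemma hat_period_op_pow:
  assumes "T \<subseteq> G"
  shows "hat ((period_op T ^^ l) g) r = (\<Sum>t\<in>T. e r t) ^ (2 * l) * hat g r"
  by (induction l) (auto simp: hat_period_op[OF assms] power_add power2_eq_square mult_ac)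

text \<open>The \<open>l\<close>-th power is a sum of \<open>card T ^ (2 * l)\<close> translates of
  \<open>g\<close>, each by an element of the \<open>l\<close>-fold sumset.\<close>

lemma period_op_pow_lower:
  assumes "finite T"
    and "\<And>s. s \<in> msum l (sumset T T) \<Longrightarrow> c \<le> (\<Sum>x\<in>B. g (x + s))"
  shows "(real (card T)) ^ (2 * l) * c \<le> (\<Sum>x\<in>B. (period_op T ^^ l) g x)"
  using assms(2)
proof (induction l arbitrary: g c)
  case 0
  then show ?case by simp
next
  case (Suc l)
  have "(real (card T)) ^ (2 * l) * ((real (card T))\<^sup>2 * c) \<le> (\<Sum>x\<in>B. (period_op T ^^ l) (period_op T g) x)"
  proof (rule Suc.IH)
    fix s assume s: "s \<in> msum l (sumset T T)"
    have "(real (card T))\<^sup>2 * c = (\<Sum>t\<in>T. \<Sum>u\<in>T. c)" by (simp add: power2_eq_square)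
    also have "\<dots> \<le> (\<Sum>t\<in>T. \<Sum>u\<in>T. \<Sum>x\<in>B. g (x + ((t + u) + s)))"
      by (intro sum_mono Suc.prems) (use s in \<open>auto intro!: sumsetI\<close>)
    also have "\<dots> = (\<Sum>t\<in>T. \<Sum>x\<in>B. \<Sum>u\<in>T. g (x + ((t + u) + s)))"
      by (rule sum.cong[OF refl], rule sum.swap)
    also have "\<dots> = (\<Sum>x\<in>B. \<Sum>t\<in>T. \<Sum>u\<in>T. g (x + ((t + u) + s)))" by (rule sum.swap)
    also have "\<dots> = (\<Sum>x\<in>B. period_op T g (x + s))"
      unfolding period_op_def by (intro sum.cong refl) (simp add: ac_simps)
    finally show "(real (card T))\<^sup>2 * c \<le> (\<Sum>x\<in>B. period_op T g (x + s))" .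
  qed
  then show ?case by (simp add: funpow_swap1 power2_eq_square mult_ac)
qed

lemma period_op_pow_nonzero:
  assumes "(period_op T ^^ l) g x \<noteq> 0"
  shows "\<exists>s\<in>msum (2 * l) T. g (x + s) \<noteq> 0"
  using assms
proof (induction l arbitrary: x)
  case 0
  then show ?case by simp
next
  case (Suc l)
  have "period_op T ((period_op T ^^ l) g) x \<noteq> 0" using Suc.prems by simp
  then have "(\<Sum>t\<in>T. \<Sum>u\<in>T. (period_op T ^^ l) g (x + (t + u))) \<noteq> 0"
    unfolding period_op_def[of T "(period_op T ^^ l) g"] .
  then obtain t where t: "t \<in> T" "(\<Sum>u\<in>T. (period_op T ^^ l) g (x + (t + u))) \<noteq> 0"
    by (rule sum.not_neutral_contains_not_neutral)
  obtain u where u: "u \<in> T" "(period_op T ^^ l) g (x + (t + u)) \<noteq> 0"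
    using t(2) by (rule sum.not_neutral_contains_not_neutral)
  obtain s where s: "s \<in> msum (2 * l) T" "g (x + (t + u) + s) \<noteq> 0" using Suc.IH[OF u(2)] by blast
  have "t + (u + s) \<in> msum (2 * Suc l) T" using t(1) u(1) s(1) by (auto intro!: sumsetI)
  moreover have "g (x + (t + (u + s))) \<noteq> 0" using s(2) by (simp add: add.assoc)
  ultimately show ?case by blast
qed

text \<open>Croot--Sisask sampling: two good tuples that are translates of the same tuple \<open>z\<close> differ by an
  almost period of \<open>h\<close>.\<close>

lemma croot_sisask:
  fixes K :: real and k l :: nat
  assumes B: "B \<subseteq> G" "B \<noteq> {}" and K: "K \<ge> 4" and l: "l \<ge> 1"
    and B2: "real (card (sumset B B)) \<le> K * card B"
    and B3: "real (card (msum 3 B)) \<le> K ^ 3 * card B"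
    and k: "real k \<ge> 256 * real l ^ 2 * ln (32 * l * K ^ 3)"
  defines "h \<equiv> \<lambda>x. real (card {b \<in> B. x + b \<in> sumset B B}) / card B"
  obtains T where "T \<subseteq> B" "T \<noteq> {}" "real (card B) \<le> 2 * K ^ k * card T"
    "\<forall>t\<in>T. \<forall>u\<in>T.
      real (card {x \<in> G. \<bar>h (x + (t + u)) - h x\<bar> > 1 / (4 * l)}) \<le> card B / (4 * l)"
proof -
  define D where "D = sumset B B"
  define \<Omega> where "\<Omega> = msum 3 B"
  define n where "n = real (card B)"
  \<comment> \<open>Two sampling errors of relative size \<open>d\<close> add up to the tolerance
    \<open>1 / (4 * l)\<close>.\<close>
  define d where "d = 1 / (8 * real l)"
  have finB: "finite B" using B(1) finG finite_subset by blast
  have n: "n > 0" using finB B(2) by (simp add: n_def card_gt_0_iff)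
  have finD: "finite D" "finite \<Omega>" using finB by (auto simp: D_def \<Omega>_def intro: finite_sumset finite_msum)
  have d: "0 < d" "d \<le> 1" using l by (auto simp: d_def)
  have hn: "h x = real (card {b \<in> B. x + b \<in> D}) / n" for x by (simp add: h_def D_def n_def)
  have h01: "0 \<le> h x" "h x \<le> 1" for x
    unfolding hn using n card_mono[OF finB, of "{b \<in> B. x + b \<in> D}"] by (auto simp: n_def)
  define P where "P = PiE {..<k} (\<lambda>_. B)"
  have finP: "finite P" unfolding P_def using finB by (intro finite_PiE) auto
  have cP: "real (card P) = n ^ k" by (simp add: P_def card_PiE n_def)
  define S where "S a x = real (card {i \<in> {..<k}. x + a i \<in> D})" for a x
  define bad where "bad a = {x \<in> G. \<bar>S a x - k * h x\<bar> > k * d}" for a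
  have finbad: "finite (bad a)" for a using finG by (simp add: bad_def)
  have S_sum: "S a x = (\<Sum>i<k. if x + a i \<in> D then 1 else 0)" for a x
    by (simp add: S_def sum.If_cases Int_def)
  have h_sum: "n * h x = (\<Sum>b\<in>B. if x + b \<in> D then 1 else 0)" for x
    using finB n by (simp add: hn sum.If_cases Int_def)
  have out: "x + b \<notin> D" if "x \<notin> \<Omega>" "b \<in> B" for x b
  proof
    assume "x + b \<in> D"
    then have "b + (x + b) \<in> sumset B D" using that(2) sumsetI by blast
    then have "x \<in> sumset B D" by (simp add: add.commute)
    then show False using that(1) by (simp add: \<Omega>_def D_def numeral_3_eq_3)
  qed
  \<comment> \<open>Off the threefold sumset both \<open>h\<close> and every sample vanish, so
    exceptional points are counted in a set of size at most \<open>K ^ 3 * n\<close> and not in all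
    of \<open>G\<close>.\<close>
  have bad\<Omega>: "bad a \<subseteq> \<Omega>" if "a \<in> P" for a
  proof
    fix x assume x: "x \<in> bad a"
    show "x \<in> \<Omega>"
    proof (rule ccontr)
      assume "x \<notin> \<Omega>"
      have "a i \<in> B" if "i < k" for i using \<open>a \<in> P\<close> that by (auto simp: P_def)
      then have "{i \<in> {..<k}. x + a i \<in> D} = {}" using out[OF \<open>x \<notin> \<Omega>\<close>] by auto
      moreover have "{b \<in> B. x + b \<in> D} = {}" using out[OF \<open>x \<notin> \<Omega>\<close>] by auto
      ultimately have "S a x = 0" "h x = 0" unfolding S_def hn by (simp_all only: card.empty)
      then show False using x d by (auto simp: bad_def mult_less_0_iff)
    qed
  qed
  define \<theta> where "\<theta> = 2 * exp (- (k * d\<^sup>2 / 4))"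
  \<comment> \<open>This is the reason for the size of \<open>k\<close>: the expected number of
    exceptional points becomes at most \<open>n / (16 * l)\<close>, half the threshold in
    \<open>L\<close>, so at least half of the tuples are good.\<close>
  have \<theta>: "\<theta> \<le> 1 / (16 * l * K ^ 3)"
  proof -
    have pos: "32 * l * K ^ 3 > 0" using l K by simp
    have "ln (32 * l * K ^ 3) \<le> k * d\<^sup>2 / 4"
      using k l by (simp add: d_def power_divide field_simps power2_eq_square)
    then have "exp (- (k * d\<^sup>2 / 4)) \<le> exp (- ln (32 * l * K ^ 3))" by simp
    also have "\<dots> = 1 / (32 * l * K ^ 3)" using pos by (simp add: exp_minus inverse_eq_divide)
    finally show ?thesis by (simp add: \<theta>_def)
  qed
  have tail: "real (card {a \<in> P. x \<in> bad a}) \<le> \<theta> * n ^ k" if "x \<in> G" for x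
  proof -
    define X where "X b = (if x + b \<in> D then 1 else 0) - h x" for b
    have X1: "\<bar>X b\<bar> \<le> 1" for b using h01[of x] by (auto simp: X_def)
    have X0: "(\<Sum>b\<in>B. X b) = 0" using h_sum[of x] by (simp add: X_def sum_subtractf n_def)
    have "(\<Sum>i<k. X (a i)) = S a x - k * h x" for a by (simp add: X_def sum_subtractf S_sum)
    then have "{a \<in> P. x \<in> bad a} = {a \<in> PiE {..<k} (\<lambda>_. B). \<bar>\<Sum>i<k. X (a i)\<bar> > k * d}"
      using that by (simp add: bad_def P_def)
    then show ?thesis using chernoff_tuples[OF finB X1 X0 d, of k] by (simp add: \<theta>_def n_def)
  qed
  have sum_bad: "(\<Sum>a\<in>P. real (card (bad a))) \<le> n ^ k * (n / (16 * l))"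
  proof -
    have "(\<Sum>a\<in>P. real (card (bad a))) = (\<Sum>a\<in>P. \<Sum>x\<in>G \<inter> \<Omega>. if x \<in> bad a then 1 else 0)"
    proof (rule sum.cong[OF refl])
      fix a assume "a \<in> P"
      then have "bad a = G \<inter> \<Omega> \<inter> bad a" using bad\<Omega> by (auto simp: bad_def)
      then show "real (card (bad a)) = (\<Sum>x\<in>G \<inter> \<Omega>. if x \<in> bad a then 1 else 0)"
        using finD by (simp add: sum.If_cases)
    qed
    also have "\<dots> = (\<Sum>x\<in>G \<inter> \<Omega>. \<Sum>a\<in>P. if x \<in> bad a then 1 else 0)" by (rule sum.swap)
    also have "\<dots> = (\<Sum>x\<in>G \<inter> \<Omega>. real (card {a \<in> P. x \<in> bad a}))"
      using finP by (simp add: sum.If_cases Int_def)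
    also have "\<dots> \<le> (\<Sum>x\<in>G \<inter> \<Omega>. \<theta> * n ^ k)" by (rule sum_mono) (use tail in auto)
    also have "\<dots> = card (G \<inter> \<Omega>) * (\<theta> * n ^ k)" by simp
    also have "\<dots> \<le> (K ^ 3 * n) * (1 / (16 * l * K ^ 3) * n ^ k)"
    proof (intro mult_mono \<theta>)
      have "card (G \<inter> \<Omega>) \<le> card \<Omega>" by (rule card_mono) (use finD in auto)
      then show "real (card (G \<inter> \<Omega>)) \<le> K ^ 3 * n" using B3 by (simp add: \<Omega>_def n_def)
    qed (use n K in \<open>auto simp: \<theta>_def\<close>)
    also have "\<dots> = n ^ k * (n / (16 * l))" using K l by (simp add: field_simps)
    finally show ?thesis .
  qed
  define L where "L = {a \<in> P. real (card (bad a)) \<le> n / (8 * l)}"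
  have finL: "finite L" using finP by (simp add: L_def)
  have cL: "real (card L) \<ge> n ^ k / 2"
  proof -
    have "real (card (P - L)) * (n / (8 * l)) = (\<Sum>a\<in>P - L. n / (8 * l))" by simp
    also have "\<dots> \<le> (\<Sum>a\<in>P - L. real (card (bad a)))" by (rule sum_mono) (auto simp: L_def)
    also have "\<dots> \<le> (\<Sum>a\<in>P. real (card (bad a)))" by (rule sum_mono2) (use finP in auto)
    also note sum_bad
    finally have "real (card (P - L)) * (n / (8 * l)) \<le> (n ^ k / 2) * (n / (8 * l))" by simp
    then have "real (card (P - L)) \<le> n ^ k / 2"
      by (rule mult_right_le_imp_le) (use n l in simp)
    moreover have "real (card (P - L)) = n ^ k - card L"
    proof -
      have "L \<subseteq> P" by (auto simp: L_def)
      then show ?thesis using card_Diff_subset[OF finL] card_mono[OF finP, of L] cP by (simp add: of_nat_diff)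
    qed
    ultimately show ?thesis by linarith
  qed
  define DK where "DK = PiE {..<k} (\<lambda>_. D)"
  have finDK: "finite DK" unfolding DK_def using finD by (intro finite_PiE) auto
  have cDK: "real (card DK) \<le> (K * n) ^ k"
  proof -
    have "real (card DK) = real (card D) ^ k" by (simp add: DK_def card_PiE)
    also have "\<dots> \<le> (K * n) ^ k" by (rule power_mono) (use B2 in \<open>auto simp: D_def n_def\<close>)
    finally show ?thesis .
  qed
  \<comment> \<open>\<open>restrict\<close> keeps translated tuples extensional, so that a second
    translation by \<open>t\<close> recovers the original tuple exactly.\<close>
  define tr where "tr z t = restrict (\<lambda>i. z i + t) {..<k}" for z :: "nat \<Rightarrow> 'a" and t
  define Tz where "Tz z = {t \<in> B. tr z t \<in> L}" for z
  have finTz: "finite (Tz z)" for z using finB by (simp add: Tz_def)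
  have tr_tr: "tr (tr a t) t = a" if "a \<in> P" for a t
  proof (rule ext)
    fix i
    show "tr (tr a t) t i = a i"
      using that by (auto simp: tr_def P_def PiE_def extensional_def add.assoc)
  qed
  \<comment> \<open>Pigeonhole: pairs of a good tuple and a shift from \<open>B\<close> inject into
    pairs of a translated tuple and a shift. Translated tuples have entries in
    \<open>sumset B B\<close>, so there are at most \<open>(K * n) ^ k\<close> of them.\<close>
  have "\<exists>z\<in>DK. real (card (Tz z)) \<ge> n / (2 * K ^ k)"
  proof (rule ccontr)
    assume neg: "\<not> ?thesis"
    define \<phi> where "\<phi> = (\<lambda>(a, t). (tr a t, t))"
    have inj: "inj_on \<phi> (L \<times> B)"
    proof (rule inj_on_inverseI)
      fix p assume "p \<in> L \<times> B"
      then show "(\<lambda>(z, t). (tr z t, t)) (\<phi> p) = p" using tr_tr by (auto simp: \<phi>_def L_def)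
    qed
    have "\<phi> ` (L \<times> B) \<subseteq> Sigma DK Tz"
    proof
      fix q assume "q \<in> \<phi> ` (L \<times> B)"
      then obtain a t where q: "a \<in> L" "t \<in> B" "q = (tr a t, t)" by (auto simp: \<phi>_def)
      then have aP: "a \<in> P" by (simp add: L_def)
      have "tr a t \<in> DK" using aP q(2) by (auto simp: tr_def DK_def D_def P_def intro!: sumsetI)
      moreover have "t \<in> Tz (tr a t)" using q tr_tr[OF aP] by (simp add: Tz_def)
      ultimately show "q \<in> Sigma DK Tz" using q by simp
    qed
    then have "card (\<phi> ` (L \<times> B)) \<le> card (Sigma DK Tz)"
      by (rule card_mono[rotated]) (use finDK finTz in auto)
    then have "real (card L * card B) \<le> real (\<Sum>z\<in>DK. card (Tz z))"
      unfolding of_nat_le_iff using card_image[OF inj] finDK finTz by (simp add: card_cartesian_product)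
    then have 1: "card L * n \<le> (\<Sum>z\<in>DK. real (card (Tz z)))" by (simp add: n_def)
    have LB: "n ^ k / 2 * n \<le> card L * n" using cL n by (intro mult_right_mono) auto
    have "DK \<noteq> {}"
    proof
      assume "DK = {}"
      then have "card L * n \<le> 0" using 1 by simp
      moreover have "n ^ k / 2 * n > 0" using n by simp
      ultimately show False using LB by linarith
    qed
    then have "(\<Sum>z\<in>DK. real (card (Tz z))) < (\<Sum>z\<in>DK. n / (2 * K ^ k))"
      using neg finDK by (intro sum_strict_mono) (auto simp: not_le)
    also have "\<dots> = card DK * (n / (2 * K ^ k))" by simp
    also have "\<dots> \<le> (K * n) ^ k * (n / (2 * K ^ k))"
      by (rule mult_right_mono[OF cDK]) (use n K in simp)
    also have "\<dots> = n ^ k / 2 * n" using K by (simp add: power_mult_distrib)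
    finally show False using 1 LB by linarith
  qed
  then obtain z where z: "z \<in> DK" "real (card (Tz z)) \<ge> n / (2 * K ^ k)" by blast
  have "real (card (Tz z)) > 0"
    by (rule less_le_trans[OF _ z(2)]) (use n K in simp)
  then have Tne: "Tz z \<noteq> {}" by auto
  have cT: "real (card B) \<le> 2 * K ^ k * card (Tz z)"
    using z(2) K by (simp add: field_simps n_def)
  have per: "real (card {x \<in> G. \<bar>h (x + (t + u)) - h x\<bar> > 1 / (4 * l)}) \<le> card B / (4 * l)"
    if t: "t \<in> Tz z" and u: "u \<in> Tz z" for t u
  proof -
    define w where "w = t + u"
    have tuG: "w \<in> G" using t u B(1) addG by (auto simp: Tz_def w_def)
    have k0: "real k > 0"
    proof -
      have "32 * real l * K ^ 3 > 1"
      proof -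
        have "32 * real l * K ^ 3 \<ge> 32 * 1 * 1" by (intro mult_mono one_le_power) (use l K in auto)
        then show ?thesis by simp
      qed
      then have "256 * real l ^ 2 * ln (32 * l * K ^ 3) > 0" using l by (intro mult_pos_pos) auto
      then show ?thesis using k by linarith
    qed
    have shift: "S (tr z u) (x + w) = S (tr z t) x" for x
    proof -
      have "x + w + (z i + u) = x + (z i + t)" for i
      proof -
        have "x + w + (z i + u) = x + (z i + t) + (u + u)" unfolding w_def by (simp only: ac_simps)
        then show ?thesis by simp
      qed
      then have "x + w + tr z u i = x + tr z t i" if "i < k" for i
        using that by (simp only: tr_def restrict_apply lessThan_iff if_True)
      then have "{i \<in> {..<k}. x + w + tr z u i \<in> D} = {i \<in> {..<k}. x + tr z t i \<in> D}"
        by (intro Collect_cong conj_cong refl) (simp only: lessThan_iff)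
      then show ?thesis by (simp only: S_def)
    qed
    have "{x \<in> G. \<bar>h (x + w) - h x\<bar> > 1 / (4 * l)} \<subseteq> bad (tr z t) \<union> (+) w ` bad (tr z u)"
    proof
      fix x assume x: "x \<in> {x \<in> G. \<bar>h (x + w) - h x\<bar> > 1 / (4 * l)}"
      then have xG: "x \<in> G" by simp
      show "x \<in> bad (tr z t) \<union> (+) w ` bad (tr z u)"
      proof (rule ccontr)
        assume nin: "\<not> ?thesis"
        then have 1: "\<bar>S (tr z t) x - k * h x\<bar> \<le> k * d" using xG by (auto simp: bad_def)
        have "x + w \<notin> bad (tr z u)"
        proof
          assume "x + w \<in> bad (tr z u)"
          then have "w + (x + w) \<in> (+) w ` bad (tr z u)" by blast
          then show False using nin by (simp add: add.commute)
        qed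
        then have 2: "\<bar>S (tr z t) x - k * h (x + w)\<bar> \<le> k * d"
          using addG[OF xG tuG] shift[of x] by (auto simp: bad_def)
        have "k * \<bar>h (x + w) - h x\<bar> = \<bar>k * h (x + w) - k * h x\<bar>"
          by (simp add: abs_mult flip: right_diff_distrib)
        also have "\<dots> \<le> k * (2 * d)" using 1 2 by linarith
        finally have "\<bar>h (x + w) - h x\<bar> \<le> 2 * d" using k0 by simp
        then show False using x by (simp add: d_def)
      qed
    qed
    then have "card {x \<in> G. \<bar>h (x + w) - h x\<bar> > 1 / (4 * l)} \<le> card (bad (tr z t) \<union> (+) w ` bad (tr z u))"
      by (rule card_mono[rotated]) (use finbad in auto)
    also have "\<dots> \<le> card (bad (tr z t)) + card ((+) w ` bad (tr z u))" by (rule card_Un_le)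
    also have "card ((+) w ` bad (tr z u)) = card (bad (tr z u))" by (simp add: card_image)
    finally have "real (card {x \<in> G. \<bar>h (x + w) - h x\<bar> > 1 / (4 * l)}) \<le> card (bad (tr z t)) + card (bad (tr z u))"
      by linarith
    also have "\<dots> \<le> n / (8 * l) + n / (8 * l)"
      using t u by (auto simp: Tz_def L_def intro!: add_mono)
    finally show ?thesis by (simp add: n_def w_def)
  qed
  show thesis by (rule that[of "Tz z"]) (use Tne cT per in \<open>auto simp: Tz_def\<close>)
qed

text \<open>The smoothed \<open>h\<close> is correlated with \<open>B\<close>. At 0 the correlation
  is large, because \<open>h\<close> is 1 on \<open>B\<close> and the smoothing uses almost periods.
  Frequencies outside Chang's subspace are damped by \<open>2 ^ (2 * l)\<close>, which beats their
  total mass, of relative size \<open>sqrt K\<close>. So the correlation stays positive on the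
  annihilator \<open>V\<close>, and positivity puts \<open>V\<close> into the iterated
  sumset.\<close>

lemma dense_bogolyubov_ruzsa:
  fixes K Q :: real and k l :: nat
  assumes B: "B \<subseteq> G" "B \<noteq> {}" and K: "K \<ge> 4" and l: "l \<ge> 1" "2 ^ l \<ge> K"
    and B2: "real (card (sumset B B)) \<le> K * card B"
    and B3: "real (card (msum 3 B)) \<le> K ^ 3 * card B"
    and dense: "real (card G) \<le> Q * card B"
    and k: "real k \<ge> 256 * real l ^ 2 * ln (32 * l * K ^ 3)"
  obtains V where "sub V" "V \<subseteq> msum (2 * l + 4) B" "real (card G) \<le> (2 * K ^ k * Q) ^ 16 * card V"
proof -
  define D where "D = sumset B B"
  define n where "n = real (card B)"
  define N where "N = real (card G)"
  have N: "N > 0" by (simp add: N_def)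
  define h where "h x = real (card {b \<in> B. x + b \<in> D}) / n" for x
  have finB: "finite B" using B(1) finG finite_subset by blast
  have n: "n > 0" using finB B(2) by (simp add: n_def card_gt_0_iff)
  have h01: "0 \<le> h x" "h x \<le> 1" for x
    unfolding h_def using n card_mono[OF finB, of "{b \<in> B. x + b \<in> D}"] by (auto simp: n_def)
  have hB: "h x = 1" if "x \<in> B" for x
  proof -
    have "{b \<in> B. x + b \<in> D} = B" using that by (auto simp: D_def intro: sumsetI)
    then show ?thesis using n by (simp add: h_def n_def)
  qed
  have h_eq: "h = (\<lambda>x. real (card {b \<in> B. x + b \<in> sumset B B}) / card B)"
    by (rule ext) (simp add: h_def D_def n_def)
  obtain T where T: "T \<subseteq> B" "T \<noteq> {}" "real (card B) \<le> 2 * K ^ k * card T"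
    "\<forall>t\<in>T. \<forall>u\<in>T.
      real (card {x \<in> G. \<bar>h (x + (t + u)) - h x\<bar> > 1 / (4 * l)}) \<le> card B / (4 * l)"
    unfolding h_eq using croot_sisask[OF B K l(1) B2 B3 k] .
  have TG: "T \<subseteq> G" using T(1) B(1) by blast
  have finT: "finite T" using T(1) finB finite_subset by blast
  define \<tau> where "\<tau> = real (card T)"
  have \<tau>: "\<tau> > 0" using finT T(2) by (simp add: \<tau>_def card_gt_0_iff)
  have per: "real (card {x \<in> G. \<bar>h (x + s) - h x\<bar> > j / (4 * l)}) \<le> j * n / (4 * l)"
    if "s \<in> msum j (sumset T T)" for j s
    using that
  proof (induction j arbitrary: s)
    case 0
    then show ?case by simp
  next
    case (Suc j)
    obtain w s' where w: "w \<in> sumset T T" "s' \<in> msum j (sumset T T)" "s = w + s'"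
      using Suc.prems by (auto elim: sumsetE)
    obtain t u where tu: "t \<in> T" "u \<in> T" "w = t + u" using w(1) by (rule sumsetE)
    have wG: "w \<in> G" using tu TG addG by blast
    define E1 where "E1 = {x \<in> G. \<bar>h (x + w) - h x\<bar> > 1 / (4 * l)}"
    define E2 where "E2 = {x \<in> G. \<bar>h (x + s') - h x\<bar> > j / (4 * l)}"
    have fin: "finite E1" "finite E2" using finG by (auto simp: E1_def E2_def)
    have "{x \<in> G. \<bar>h (x + s) - h x\<bar> > Suc j / (4 * l)} \<subseteq> E1 \<union> (+) w ` E2"
    proof
      fix x assume x: "x \<in> {x \<in> G. \<bar>h (x + s) - h x\<bar> > Suc j / (4 * l)}"
      show "x \<in> E1 \<union> (+) w ` E2"
      proof (cases "x \<in> E1")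
        case False
        then have 1: "\<bar>h (x + w) - h x\<bar> \<le> 1 / (4 * l)" using x by (simp add: E1_def)
        have "\<bar>h (x + s) - h x\<bar> > j / (4 * l) + 1 / (4 * l)" using x by (simp add: add_divide_distrib add.commute)
        then have "\<bar>h ((x + w) + s') - h (x + w)\<bar> > j / (4 * l)" using 1 w(3) by (simp add: add.assoc)
        then have "x + w \<in> E2" using x addG wG by (simp add: E2_def)
        then have "w + (x + w) \<in> (+) w ` E2" by blast
        then show ?thesis by (simp add: add.commute)
      qed simp
    qed
    then have "card {x \<in> G. \<bar>h (x + s) - h x\<bar> > Suc j / (4 * l)} \<le> card (E1 \<union> (+) w ` E2)"
      by (rule card_mono[rotated]) (use fin in auto)
    also have "\<dots> \<le> card E1 + card ((+) w ` E2)" by (rule card_Un_le)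
    also have "card ((+) w ` E2) = card E2" by (simp add: card_image)
    finally have "real (card {x \<in> G. \<bar>h (x + s) - h x\<bar> > Suc j / (4 * l)}) \<le> real (card E1) + card E2" by linarith
    also have "real (card E1) \<le> n / (4 * l)" using T(4)[rule_format, OF tu(1,2)] by (simp add: E1_def tu(3) n_def)
    also have "real (card E2) \<le> j * n / (4 * l)" using Suc.IH[OF w(2)] by (simp add: E2_def)
    also have "n / (4 * l) + j * n / (4 * l) = Suc j * n / (4 * l)" by (simp add: add_divide_distrib distrib_right)
    finally show ?case by simp
  qed
  define F where "F v = (\<Sum>x\<in>B. (period_op T ^^ l) h (x + v))" for v
  have F0: "\<tau> ^ (2 * l) * (n / 2) \<le> F 0"
    unfolding F_def \<tau>_def add_0_right
  proof (rule period_op_pow_lower[OF finT])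
    fix s assume s: "s \<in> msum l (sumset T T)"
    \<comment> \<open>After \<open>l\<close> almost periods the error is at most \<open>1/4\<close>
      off a set of \<open>n / 4\<close> points; this leaves a sum of at least
      \<open>9/16 * n\<close>, more than half of \<open>n\<close>.\<close>
    define E where "E = {x \<in> G. \<bar>h (x + s) - h x\<bar> > 1/4}"
    have "real (card E) \<le> n / 4" using per[OF s] l by (simp add: E_def)
    moreover have "card (B \<inter> E) \<le> card E" by (rule card_mono) (use finG in \<open>auto simp: E_def\<close>)
    moreover have "real (card (B - E)) = n - card (B \<inter> E)"
      using card_Diff_subset_Int[of B E] finB card_mono[OF finB, of "B \<inter> E"] by (simp add: n_def of_nat_diff)
    ultimately have "real (card (B - E)) \<ge> 3/4 * n" by linarith
    then have "n / 2 \<le> 3/4 * real (card (B - E))" using n by simp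
    also have "\<dots> = (\<Sum>x\<in>B - E. 3/4)" by simp
    also have "\<dots> \<le> (\<Sum>x\<in>B - E. h (x + s))"
    proof (rule sum_mono)
      fix x assume "x \<in> B - E"
      then have "\<bar>h (x + s) - 1\<bar> \<le> 1/4" using B(1) hB by (auto simp: E_def)
      then show "3/4 \<le> h (x + s)" by linarith
    qed
    also have "\<dots> \<le> (\<Sum>x\<in>B. h (x + s))" by (rule sum_mono2) (use finB h01 in auto)
    finally show "n / 2 \<le> (\<Sum>x\<in>B. h (x + s))" .
  qed
  obtain U where U: "sub U" "\<forall>r\<in>G. \<bar>\<Sum>v\<in>T. e r v\<bar> \<ge> card T / 2 \<longrightarrow> r \<in> U"
    "real (card U) \<le> (card G / card T) ^ 16"
    using chang[OF TG T(2)] .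
  define V where "V = perp U"
  have subV: "sub V" unfolding V_def by (rule sub_perp)
  define \<beta> where "\<beta> r = (\<Sum>x\<in>B. e r x)" for r
  define p where "p r = (\<Sum>t\<in>T. e r t) ^ (2 * l)" for r
  have F_fourier: "F v = (\<Sum>r\<in>G. p r * hat h r * \<beta> r * e r v)" if "v \<in> G" for v
  proof -
    have "F v = (\<Sum>x\<in>B. \<Sum>r\<in>G. p r * hat h r * e r (x + v))"
      unfolding F_def p_def hat_period_op_pow[OF TG, symmetric]
      by (rule sum.cong[OF refl], rule fourier_inversion[symmetric]) (use that B(1) addG in auto)
    also have "\<dots> = (\<Sum>r\<in>G. \<Sum>x\<in>B. p r * hat h r * e r (x + v))" by (rule sum.swap)
    finally show ?thesis by (simp add: e_add \<beta>_def sum_distrib_left sum_distrib_right mult_ac)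
  qed
  have h_l2: "(\<Sum>x\<in>G. (h x)\<^sup>2) \<le> K * n"
  proof -
    have "(\<Sum>x\<in>G. (h x)\<^sup>2) \<le> (\<Sum>x\<in>G. h x)"
      by (rule sum_mono) (use h01 in \<open>auto simp: power2_eq_square mult_left_le\<close>)
    also have "\<dots> = (\<Sum>x\<in>G. \<Sum>b\<in>B. if x + b \<in> D then 1 else 0) / n"
      using finB by (simp add: h_def sum.If_cases Int_def sum_divide_distrib)
    also have "(\<Sum>x\<in>G. \<Sum>b\<in>B. if x + b \<in> D then 1 else 0 :: real) = (\<Sum>b\<in>B. \<Sum>x\<in>G. if x + b \<in> D then 1 else 0)"
      by (rule sum.swap)
    also have "\<dots> = (\<Sum>b\<in>B. \<Sum>x\<in>G. if x \<in> D then 1 else 0)"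
      by (rule sum.cong[OF refl]) (use sum_shift[OF sub_G, where h = "\<lambda>x. if x \<in> D then 1 else 0 :: real"] B(1) in auto)
    also have "\<dots> = n * card (G \<inter> D)" using finG by (simp add: sum.If_cases n_def)
    also have "\<dots> \<le> n * (K * n)"
    proof (rule mult_left_mono)
      have "card (G \<inter> D) \<le> card D" by (rule card_mono) (use finB in \<open>auto simp: D_def intro: finite_sumset\<close>)
      then show "real (card (G \<inter> D)) \<le> K * n" using B2 by (simp add: D_def n_def)
    qed (use n in simp)
    finally show ?thesis using n by (simp add: divide_right_mono)
  qed
  have \<beta>_l2: "(\<Sum>r\<in>G. (\<beta> r)\<^sup>2) = N * n"
  proof -
    define i where "i x = (if x \<in> B then 1 else 0 :: real)" for x
    have "hat i r = \<beta> r / N" for r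
      unfolding hat_def i_def \<beta>_def N_def using finG B(1)
      by (simp add: if_distrib[of "\<lambda>y. y * _"] sum.If_cases Int_absorb1 cong: if_cong)
    then have "(\<Sum>r\<in>G. (\<beta> r / N)\<^sup>2) = (\<Sum>x\<in>G. (i x)\<^sup>2) / N" using parseval[of i] by (simp add: N_def)
    also have "(\<Sum>x\<in>G. (i x)\<^sup>2) = n"
      using finG B(1) by (simp add: i_def if_distrib[of "\<lambda>y. y\<^sup>2"] sum.If_cases Int_absorb1 n_def cong: if_cong)
    finally show ?thesis using N by (simp add: power_divide sum_divide_distrib[symmetric] field_simps power2_eq_square)
  qed
  have mass: "(\<Sum>r\<in>G. \<bar>hat h r\<bar> * \<bar>\<beta> r\<bar>) \<le> sqrt K * n"
  proof -
    have "(\<Sum>r\<in>G. \<bar>hat h r\<bar> * \<bar>\<beta> r\<bar>)\<^sup>2 \<le> (\<Sum>r\<in>G. \<bar>hat h r\<bar>\<^sup>2) * (\<Sum>r\<in>G. \<bar>\<beta> r\<bar>\<^sup>2)"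
      by (rule Cauchy_Schwarz_ineq_sum)
    also have "\<dots> = (\<Sum>x\<in>G. (h x)\<^sup>2) * n" using N by (simp add: parseval \<beta>_l2 flip: N_def)
    also have "\<dots> \<le> (K * n) * n" by (rule mult_right_mono[OF h_l2]) (use n in simp)
    also have "\<dots> = (sqrt K * n)\<^sup>2" using K by (simp add: power_mult_distrib power2_eq_square)
    finally show ?thesis by (rule power2_le_imp_le) (use K n in simp)
  qed
  have small: "\<bar>p r\<bar> \<le> (\<tau> / 2) ^ (2 * l)" if "r \<in> G - U" for r
  proof -
    have "\<bar>\<Sum>t\<in>T. e r t\<bar> \<le> \<tau> / 2" using U(2)[rule_format, of r] that by (force simp: \<tau>_def)
    then show ?thesis unfolding p_def power_abs by (intro power_mono) auto
  qed
  have Fv: "F v > 0" if v: "v \<in> V" for v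
  proof -
    have vG: "v \<in> G" using subD(4)[OF subV v] .
    have ev: "e r v = 1" if "r \<in> U" for r
      using v that by (auto simp: V_def perp_def e_sym)
    have "F 0 - F v = (\<Sum>r\<in>G. p r * hat h r * \<beta> r * (1 - e r v))"
      using F_fourier[OF vG] F_fourier[OF zeroG] by (simp add: sum_subtractf right_diff_distrib)
    also have "\<dots> = (\<Sum>r\<in>G - U. p r * hat h r * \<beta> r * (1 - e r v))"
      by (rule sum.mono_neutral_right) (use finG ev in auto)
    also have "\<dots> \<le> (\<Sum>r\<in>G - U. (\<tau> / 2) ^ (2 * l) * (\<bar>hat h r\<bar> * \<bar>\<beta> r\<bar>) * 2)"
    proof (rule sum_mono)
      fix r assume r: "r \<in> G - U"
      have "p r * hat h r * \<beta> r * (1 - e r v) \<le> \<bar>p r\<bar> * (\<bar>hat h r\<bar> * \<bar>\<beta> r\<bar>) * \<bar>1 - e r v\<bar>"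
        using abs_ge_self[of "p r * hat h r * \<beta> r * (1 - e r v)"] by (simp add: abs_mult mult_ac)
      also have "\<dots> \<le> (\<tau> / 2) ^ (2 * l) * (\<bar>hat h r\<bar> * \<bar>\<beta> r\<bar>) * 2"
        using e_vals[of r v] \<tau> by (intro mult_mono small[OF r] order.refl) auto
      finally show "p r * hat h r * \<beta> r * (1 - e r v) \<le> (\<tau> / 2) ^ (2 * l) * (\<bar>hat h r\<bar> * \<bar>\<beta> r\<bar>) * 2" .
    qed
    also have "\<dots> = (\<tau> / 2) ^ (2 * l) * 2 * (\<Sum>r\<in>G - U. \<bar>hat h r\<bar> * \<bar>\<beta> r\<bar>)"
      by (simp add: sum_distrib_left mult_ac)
    also have "\<dots> \<le> (\<tau> / 2) ^ (2 * l) * 2 * (\<Sum>r\<in>G. \<bar>hat h r\<bar> * \<bar>\<beta> r\<bar>)"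
      using \<tau> by (intro mult_left_mono sum_mono2 finG) auto
    also have "\<dots> \<le> (\<tau> / 2) ^ (2 * l) * 2 * (sqrt K * n)"
      using \<tau> by (intro mult_left_mono mass) auto
    also have "\<dots> < \<tau> ^ (2 * l) * (n / 2)"
    proof -
      have sK: "sqrt K \<ge> 2" using K by (simp add: real_le_rsqrt)
      \<comment> \<open>The damping factor \<open>2 ^ (2 * l)\<close> is at least
        \<open>K * K\<close>, and this exceeds \<open>4 * sqrt K\<close> because
        \<open>sqrt K \<ge> 2\<close>.\<close>
      have "4 * sqrt K < K * K"
      proof -
        have "2 * sqrt K \<le> sqrt K * sqrt K" by (rule mult_right_mono[OF sK]) (use K in simp)
        then have "4 * sqrt K \<le> 2 * (sqrt K * sqrt K)" by linarith
        also have "\<dots> < K * K" using K by simp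
        finally show ?thesis .
      qed
      also have "\<dots> \<le> 2 ^ l * 2 ^ l" using l(2) K by (intro mult_mono) auto
      also have "\<dots> = 2 ^ (2 * l)" by (simp add: mult_2 power_add)
      finally have "4 * sqrt K / 2 ^ (2 * l) < 1" by simp
      then have "\<tau> ^ (2 * l) * (n / 2) * (4 * sqrt K / 2 ^ (2 * l)) < \<tau> ^ (2 * l) * (n / 2) * 1"
        using \<tau> n by (intro mult_strict_left_mono) auto
      then show ?thesis by (simp add: power_divide mult_ac)
    qed
    also note F0
    finally show ?thesis by simp
  qed
  have "V \<subseteq> msum (2 * l + 4) B"
  proof
    fix v assume "v \<in> V"
    then have "F v \<noteq> 0" using Fv[of v] by simp
    then obtain x where x: "x \<in> B" "(period_op T ^^ l) h (x + v) \<noteq> 0"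
      unfolding F_def by (rule sum.not_neutral_contains_not_neutral)
    obtain s where s: "s \<in> msum (2 * l) T" "h (x + v + s) \<noteq> 0" using period_op_pow_nonzero[OF x(2)] by blast
    have msum_mono: "msum m T \<subseteq> msum m B" for m
      by (induction m) (simp_all add: sumset_mono[OF T(1)])
    have "{b \<in> B. x + v + s + b \<in> D} \<noteq> {}"
    proof
      assume "{b \<in> B. x + v + s + b \<in> D} = {}"
      then show False using s(2) by (simp only: h_def) simp
    qed
    then obtain b where b: "b \<in> B" "x + v + s + b \<in> D" by blast
    \<comment> \<open>One summand for \<open>x\<close>, one for \<open>b\<close>,
      \<open>2 * l\<close> for \<open>s\<close> and two for the point of \<open>D\<close> make
      \<open>2 * l + 4\<close>.\<close>
    have eq: "x + (b + (s + (x + v + s + b))) = v"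
    proof -
      have "x + (b + (s + (x + v + s + b))) = v + (x + x) + (b + b) + (s + s)" by (simp only: ac_simps)
      then show ?thesis by simp
    qed
    have "s + (x + v + s + b) \<in> sumset (msum (2 * l) B) (msum 2 B)"
      by (rule sumsetI) (use s(1) b(2) msum_mono in \<open>auto simp: D_def numeral_2_eq_2\<close>)
    then have "s + (x + v + s + b) \<in> msum (2 * l + 2) B" by (simp only: msum_add)
    then have "x + (b + (s + (x + v + s + b))) \<in> sumset B (sumset B (msum (2 * l + 2) B))"
      by (intro sumsetI x(1) b(1))
    then have "v \<in> msum (Suc (Suc (2 * l + 2))) B" unfolding eq by simp
    moreover have "2 * l + 4 = Suc (Suc (2 * l + 2))" by simp
    ultimately show "v \<in> msum (2 * l + 4) B" by (simp only:)
  qed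
  moreover have "real (card G) \<le> (2 * K ^ k * Q) ^ 16 * card V"
  proof -
    have "N \<le> (2 * K ^ k * Q) * \<tau>"
    proof -
      have "0 < Q * n" using dense N unfolding N_def n_def by linarith
      then have "Q > 0" using n by (simp add: zero_less_mult_iff)
      then have "Q * n \<le> Q * (2 * K ^ k * \<tau>)" using T(3) by (intro mult_left_mono) (auto simp: n_def \<tau>_def)
      then show ?thesis using dense by (simp add: N_def n_def mult_ac)
    qed
    then have "card G / card T \<le> 2 * K ^ k * Q" using \<tau> by (simp add: N_def \<tau>_def field_simps)
    then have "(card G / card T) ^ 16 \<le> (2 * K ^ k * Q) ^ 16" by (intro power_mono) auto
    then have cU: "real (card U) \<le> (2 * K ^ k * Q) ^ 16" using U(3) by linarith
    have "real (card G) = real (card U) * card V" using card_perp[OF U(1)] by (simp add: V_def flip: of_nat_mult)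
    also have "\<dots> \<le> (2 * K ^ k * Q) ^ 16 * card V" by (rule mult_right_mono[OF cU]) simp
    finally show ?thesis .
  qed
  ultimately show thesis using that subV by blast
qed

end

section \<open>From dense sets to sets of small doubling, and on to the support of the
  function\<close>

context F2_pairing
begin

lemma zero_in_msum:
  fixes B :: "'a set"
  assumes "B \<noteq> {}" shows "0 \<in> msum (2 * j) B"
proof (induction j)
  case (Suc j)
  obtain b where b: "b \<in> B" using assms by blast
  have "b + (b + 0) \<in> sumset B (sumset B (msum (2 * j) B))" using b Suc by (intro sumsetI)
  then show ?case by simp
qed simp

lemma msum_2_subset:
  fixes B :: "'a set"
  assumes "B \<noteq> {}" shows "msum 2 B \<subseteq> msum (2 * j + 2) B"
proof
  fix x assume "x \<in> msum 2 B"
  then have "0 + x \<in> sumset (msum (2 * j) B) (msum 2 B)" using zero_in_msum[OF assms] by (intro sumsetI)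
  then show "x \<in> msum (2 * j + 2) B" by (simp only: msum_add add_0)
qed

lemma sumset_sub_self: assumes "sub W" shows "sumset W W = W"
proof
  show "sumset W W \<subseteq> W" using subD(3)[OF assms] by (auto elim!: sumsetE)
  show "W \<subseteq> sumset W W" using sumsetI[OF subD(2)[OF assms]] by fastforce
qed

lemma sub_sumset: assumes "sub V" "sub W" shows "sub (sumset V W)"
  unfolding sub_def
proof (intro conjI ballI subsetI)
  fix x assume "x \<in> sumset V W"
  then obtain a b where "a \<in> V" "b \<in> W" "x = a + b" by (rule sumsetE)
  then show "x \<in> G" using assms subD(4) addG by blast
next
  have "0 + 0 \<in> sumset V W" using assms subD(2) by (intro sumsetI)
  then show "0 \<in> sumset V W" by simp
next
  fix x y assume "x \<in> sumset V W" and y: "y \<in> sumset V W"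
  then obtain a b where ab: "a \<in> V" "b \<in> W" "x = a + b" by (elim sumsetE)
  obtain c d where cd: "c \<in> V" "d \<in> W" "y = c + d" using y by (rule sumsetE)
  have "(a + c) + (b + d) \<in> sumset V W" using ab cd assms subD(3) by (intro sumsetI) auto
  then show "x + y \<in> sumset V W" using ab cd by (simp only: ac_simps)
qed

text \<open>The copies of \<open>W\<close> collapse into one. The index starts at one, as the empty
  sum \<open>{0}\<close> is not saturated.\<close>

lemma msum_saturated:
  assumes "sub W" shows "msum (Suc m) (sumset B W) = sumset (msum (Suc m) B) W"
proof (induction m)
  case (Suc m)
  have "msum (Suc (Suc m)) (sumset B W) = sumset (sumset B W) (sumset (msum (Suc m) B) W)"
    using Suc by simp
  also have "\<dots> = sumset B (sumset (sumset W (msum (Suc m) B)) W)" by (simp only: sumset_assoc)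
  also have "sumset W (msum (Suc m) B) = sumset (msum (Suc m) B) W" by (rule sumset_comm)
  also have "sumset B (sumset (sumset (msum (Suc m) B) W) W) = sumset (sumset B (msum (Suc m) B)) W"
    by (simp only: sumset_assoc sumset_sub_self[OF assms])
  finally show ?case by simp
qed simp

lemma card_sumset_le:
  assumes "finite A" "finite B" shows "card (sumset A B) \<le> card A * card B"
  unfolding sumset_def using card_image_le[of "A \<times> B"] assms by (simp add: card_cartesian_product)

text \<open>The ambient group is replaced by its quotient by a maximal subspace \<open>W\<close> meeting a large iterated
  sumset trivially; instead of forming the quotient, sets are saturated by \<open>W\<close>.\<close>

lemma bogolyubov_ruzsa:
  fixes K :: real and k l :: nat
  assumes B: "B \<subseteq> G" "B \<noteq> {}" and K: "K \<ge> 4" and l: "l \<ge> 1" "2 ^ l \<ge> K"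
    and B2: "real (card (sumset B B)) \<le> K * card B"
    and k: "real k \<ge> 256 * real l ^ 2 * ln (32 * l * K ^ 3)"
  obtains V where "sub V" "V \<subseteq> msum (2 * l + 4) B"
    "real (card B) \<le> (2 * K ^ (k + 3 * (2 * l + 4))) ^ 16 * card V"
proof -
  define m where "m = 2 * l + 4"
  have finB: "finite B" using B(1) finG finite_subset by blast
  have m3: "3 * m = 2 * (3 * l + 5) + 2" "3 * m = 2 * (3 * l + 6)" "m = 2 * (l + 2)" by (auto simp: m_def)
  \<comment> \<open>The factor 3 comes from the end of the proof, where closure of \<open>V\<close>
    under addition involves a sum of three elements of \<open>msum m B\<close>.\<close>
  define good where "good W \<longleftrightarrow> sub W \<and> W \<inter> msum (3 * m) B \<subseteq> {0}" for W
  have good0: "good {0}" using sub_0 by (auto simp: good_def)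
  have "\<exists>W. good W \<and> (\<forall>W'. good W' \<longrightarrow> card W' \<le> card W)"
    by (rule ex_has_greatest_nat[where b = "Suc (card G)" and k = "{0}"])
      (use good0 in \<open>auto simp: good_def dest: subD(4) intro!: le_imp_less_Suc card_mono finG\<close>)
  then obtain W where W: "good W" "\<And>W'. good W' \<Longrightarrow> card W' \<le> card W" by blast
  have subW: "sub W" and W0: "\<And>y. y \<in> W \<Longrightarrow> y \<in> msum (3 * m) B \<Longrightarrow> y = 0" using W(1) by (auto simp: good_def)
  have finW: "finite W" using sub_finite[OF subW] .
  define \<omega> where "\<omega> = real (card W)"
  have \<omega>: "\<omega> > 0" using sub_card_pos[OF subW] by (simp add: \<omega>_def)
  \<comment> \<open>By maximality, adjoining \<open>x\<close> to \<open>W\<close> creates a nonzero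
    point of the iterated sumset, which expresses \<open>x\<close> modulo \<open>W\<close>. With
    Pluennecke's inequality this makes the saturation of \<open>B\<close> dense in
    \<open>G\<close>.\<close>
  have cover: "G \<subseteq> sumset (msum (3 * m) B) W"
  proof
    fix x assume x: "x \<in> G"
    show "x \<in> sumset (msum (3 * m) B) W"
    proof (cases "x \<in> W")
      case True
      then have "0 + x \<in> sumset (msum (3 * m) B) W"
        using zero_in_msum[OF B(2), of "3 * l + 6"] by (intro sumsetI) (simp_all only: m3(2))
      then show ?thesis by simp
    next
      case False
      have sp: "sub (span W {x})" by (rule sub_span[OF subW]) (use x in auto)
      have "x \<in> span W {x}" using spanI[OF subD(2)[OF subW], of "{x}" "{x}"] by simp
      then have "W \<subset> span W {x}" using span_superset[of W "{x}"] False by blast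
      then have "card W < card (span W {x})" by (rule psubset_card_mono[OF sub_finite[OF sp]])
      then have "\<not> good (span W {x})" using W(2) by (meson not_le)
      then obtain y where y: "y \<in> span W {x}" "y \<in> msum (3 * m) B" "y \<noteq> 0" using sp by (auto simp: good_def)
      obtain u J where uJ: "u \<in> W" "J \<subseteq> {x}" "y = u + \<Sum>J" using y(1) by (rule spanE)
      have "J \<noteq> {}" using W0[of y] y uJ by auto
      then have "J = {x}" using uJ(2) by blast
      then have "x = y + u" using uJ(3) by (simp add: add.commute)
      then show ?thesis using sumsetI[OF y(2) uJ(1)] by simp
    qed
  qed
  define B' where "B' = sumset B W"
  have B'G: "B' \<subseteq> G" using B(1) subD(4)[OF subW] addG by (auto simp: B'_def elim!: sumsetE)
  have B'ne: "B' \<noteq> {}" using B(2) subD(2)[OF subW] sumsetI by (force simp: B'_def)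
  \<comment> \<open>Two points of \<open>B\<close> congruent modulo \<open>W\<close> have their sum
    in \<open>W\<close> and in the iterated sumset, hence coincide; saturation multiplies the size
    by exactly \<open>\<omega>\<close>.\<close>
  have cB': "real (card B') = card B * \<omega>"
  proof -
    have "inj_on (\<lambda>(a, b). a + b) (B \<times> W)"
    proof (rule inj_onI)
      fix p q assume pq: "p \<in> B \<times> W" "q \<in> B \<times> W" "(\<lambda>(a, b). a + b) p = (\<lambda>(a, b). a + b) q"
      obtain b w where p: "p = (b, w)" "b \<in> B" "w \<in> W" using pq by auto
      obtain c v where q: "q = (c, v)" "c \<in> B" "v \<in> W" using pq by auto
      have eq: "b + w = c + v" using pq p q by simp
      have "b + (c + 0) \<in> msum 2 B" using p(2) q(2) by (auto simp: numeral_2_eq_2 intro!: sumsetI)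
      then have "b + c \<in> msum (3 * m) B" using msum_2_subset[OF B(2), of "3 * l + 5"] m3(1) by auto
      moreover have "b + c = w + v"
      proof -
        have "b + c = (b + w) + (w + c)" by (simp add: add.assoc)
        also have "\<dots> = (w + v) + (c + c)" unfolding eq by (simp only: ac_simps)
        finally show ?thesis by simp
      qed
      then have "b + c \<in> W" using subD(3)[OF subW] p q by simp
      ultimately have "b + c = 0" using W0 by blast
      then have "b = c" by (simp add: add_eq_0)
      then show "p = q" using eq p q by simp
    qed
    then have "card (sumset B W) = card B * card W"
      unfolding sumset_def using card_image by (metis card_cartesian_product)
    then show ?thesis by (simp add: B'_def \<omega>_def)
  qed
  have sat: "real (card (msum (Suc i) B')) \<le> K ^ Suc i * card B'" for i
  proof -
    have "real (card (msum (Suc i) B')) \<le> real (card (msum (Suc i) B)) * \<omega>"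
      unfolding B'_def msum_saturated[OF subW] \<omega>_def
      using card_sumset_le[OF finite_msum[OF finB] finW, of "Suc i"] by (simp flip: of_nat_mult)
    also have "\<dots> \<le> (K ^ Suc i * card B) * \<omega>"
      by (intro mult_right_mono plunnecke[OF finB B(2) B2]) (use \<omega> in simp)
    finally show ?thesis by (simp add: cB' mult_ac)
  qed
  have B'2: "real (card (sumset B' B')) \<le> K * card B'"
  proof -
    have "sumset B' B' = sumset (msum (Suc (Suc 0)) B) W"
      unfolding B'_def msum_saturated[OF subW, symmetric] by simp
    also have "real (card \<dots>) \<le> real (card (sumset B B)) * \<omega>"
      using card_sumset_le[of "sumset B B" W] finite_sumset[OF finB finB] finW
      by (simp add: \<omega>_def flip: of_nat_mult)
    also have "\<dots> \<le> K * card B * \<omega>" by (rule mult_right_mono[OF B2]) (use \<omega> in simp)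
    finally show ?thesis by (simp add: cB')
  qed
  have dense: "real (card G) \<le> K ^ (3 * m) * card B'"
  proof -
    have "card G \<le> card (sumset (msum (3 * m) B) W)"
      by (rule card_mono[OF _ cover]) (use finB finW in \<open>auto intro: finite_sumset finite_msum\<close>)
    also have "\<dots> \<le> card (msum (3 * m) B) * card W"
      by (rule card_sumset_le) (use finB finW in \<open>auto intro: finite_msum\<close>)
    finally have "real (card G) \<le> real (card (msum (3 * m) B)) * \<omega>" by (simp add: \<omega>_def flip: of_nat_mult)
    also have "\<dots> \<le> (K ^ (3 * m) * card B) * \<omega>"
      by (intro mult_right_mono plunnecke[OF finB B(2) B2]) (use \<omega> in simp)
    finally show ?thesis by (simp add: cB' mult_ac)
  qed
  have B'3: "real (card (msum 3 B')) \<le> K ^ 3 * card B'"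
    using sat[of 2] by (simp only: numeral_3_eq_3 numeral_2_eq_2)
  obtain V1 where V1: "sub V1" "V1 \<subseteq> msum (2 * l + 4) B'"
    "real (card G) \<le> (2 * K ^ k * K ^ (3 * m)) ^ 16 * card V1"
    using dense_bogolyubov_ruzsa[OF B'G B'ne K l B'2 B'3 dense k] .
  define V2 where "V2 = sumset V1 W"
  have subV2: "sub V2" unfolding V2_def by (rule sub_sumset[OF V1(1) subW])
  have V12: "V1 \<subseteq> V2"
  proof
    fix v assume "v \<in> V1"
    then have "v + 0 \<in> V2" unfolding V2_def by (intro sumsetI subD(2)[OF subW])
    then show "v \<in> V2" by simp
  qed
  have WV2: "W \<subseteq> V2"
  proof
    fix w assume "w \<in> W"
    then have "0 + w \<in> V2" unfolding V2_def by (intro sumsetI subD(2)[OF V1(1)])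
    then show "w \<in> V2" by simp
  qed
  have V2sub: "V2 \<subseteq> sumset (msum m B) W"
  proof -
    have "V1 \<subseteq> sumset (msum m B) W"
      using V1(2) msum_saturated[OF subW, of "2 * l + 3" B] by (simp add: m_def B'_def numeral_eq_Suc)
    then have "V2 \<subseteq> sumset (sumset (msum m B) W) W" unfolding V2_def by (rule sumset_mono) simp
    then show ?thesis by (simp only: sumset_assoc sumset_sub_self[OF subW])
  qed
  \<comment> \<open>Every class of \<open>V2\<close> modulo \<open>W\<close> has a representative in
    \<open>msum m B\<close>. Keeping these undoes the saturation, and they are closed under addition
    because \<open>W\<close> meets \<open>msum (3 * m) B\<close> trivially.\<close>
  define V where "V = V2 \<inter> msum m B"
  have decomp: "\<exists>v\<in>V. \<exists>w\<in>W. y = v + w" if y: "y \<in> V2" for y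
  proof -
    obtain b w where bw: "b \<in> msum m B" "w \<in> W" "y = b + w" using V2sub y by (blast elim: sumsetE)
    have "b = y + w" using bw(3) by (simp add: add.assoc)
    then have "b \<in> V2" using subD(3)[OF subV2 y] WV2 bw(2) by auto
    then show ?thesis using bw by (auto simp: V_def)
  qed
  have subV: "sub V"
    unfolding sub_def
  proof (intro conjI ballI)
    show "V \<subseteq> G" using subD(1)[OF subV2] by (auto simp: V_def)
    show "0 \<in> V" using subD(2)[OF subV2] zero_in_msum[OF B(2), of "l + 2"] m3(3) by (simp only: V_def IntI)
    fix u v assume u: "u \<in> V" and v: "v \<in> V"
    have "u + v \<in> V2" using u v subD(3)[OF subV2] by (auto simp: V_def)
    then obtain x w where x: "x \<in> V" "w \<in> W" "u + v = x + w" using decomp by blast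
    have "u + (v + x) \<in> sumset (msum m B) (sumset (msum m B) (msum m B))"
      using u v x by (intro sumsetI) (auto simp: V_def)
    then have "u + (v + x) \<in> msum (m + (m + m)) B" by (simp only: msum_add)
    moreover have "m + (m + m) = 3 * m" by simp
    moreover have "u + (v + x) = w"
    proof -
      have "u + (v + x) = (u + v) + x" by (simp only: add.assoc)
      also have "\<dots> = w + (x + x)" unfolding x(3) by (simp only: ac_simps)
      finally show ?thesis by simp
    qed
    ultimately have "w = 0" using W0 x(2) by metis
    then show "u + v \<in> V" using x by simp
  qed
  have "V2 \<subseteq> sumset V W" using decomp by (blast intro: sumsetI)
  then have "card V2 \<le> card (sumset V W)"
    by (rule card_mono[rotated]) (use sub_finite[OF subV] finW finite_sumset in auto)
  also have "\<dots> \<le> card V * card W" by (rule card_sumset_le) (use sub_finite[OF subV] finW in auto)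
  finally have cV2: "card V2 \<le> card V * card W" .
  have "card V1 \<le> card V2" by (rule card_mono[OF sub_finite[OF subV2] V12])
  with cV2 have cV1: "real (card V1) \<le> real (card V) * \<omega>" by (simp add: \<omega>_def flip: of_nat_mult)
  define R where "R = (2 * K ^ (k + 3 * m)) ^ 16"
  have "R \<ge> 0" using K by (simp add: R_def)
  have "card B * \<omega> \<le> card G" using card_mono[OF finG B'G] by (simp flip: cB')
  also have "real (card G) \<le> R * card V1" using V1(3) by (simp add: R_def power_add mult.assoc)
  also have "\<dots> \<le> R * (card V * \<omega>)" by (rule mult_left_mono[OF cV1 \<open>R \<ge> 0\<close>])
  finally have "real (card B) * \<omega> \<le> (R * card V) * \<omega>" by simp
  then have "real (card B) \<le> R * card V" using \<omega> by (rule mult_right_le_imp_le)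
  with that[of V] subV show thesis by (auto simp: V_def R_def m_def)
qed

text \<open>\<open>sumset B V\<close> lies in \<open>msum (Suc m) B\<close>, which is small by
  Pluennecke's inequality; distributing the pairs of \<open>B \<times> V\<close> over it gives a
  translate of \<open>V\<close> with a large part in \<open>B\<close>.\<close>

lemma dense_coset:
  fixes K :: real
  assumes B: "B \<subseteq> G" "B \<noteq> {}" and V: "sub V" "V \<subseteq> msum m B"
    and B2: "real (card (sumset B B)) \<le> K * card B"
  obtains x where "x \<in> G" "real (card V) \<le> K ^ Suc m * card {v \<in> V. x + v \<in> B}"
proof -
  have finB: "finite B" using B(1) finG finite_subset by blast
  have finV: "finite V" using sub_finite[OF V(1)] .
  have cB: "real (card B) > 0" using finB B(2) by (simp add: card_gt_0_iff)
  have cV: "real (card V) > 0" using sub_card_pos[OF V(1)] by simp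
  define S where "S = sumset B V"
  have finS: "finite S" unfolding S_def by (rule finite_sumset[OF finB finV])
  have SG: "S \<subseteq> G" using B(1) subD(4)[OF V(1)] addG by (auto simp: S_def elim!: sumsetE)
  have "card S \<le> card (msum (Suc m) B)"
    by (rule card_mono[OF finite_msum[OF finB]]) (simp add: S_def sumset_mono[OF order.refl V(2)])
  then have cS: "real (card S) \<le> K ^ Suc m * card B"
    using plunnecke[OF finB B(2) B2, of "Suc m"] by linarith
  have "\<exists>x\<in>S. real (card V) \<le> K ^ Suc m * card {v \<in> V. x + v \<in> B}"
  proof (rule ccontr)
    assume neg: "\<not> ?thesis"
    have S_ne: "S \<noteq> {}" using B(2) subD(2)[OF V(1)] sumsetI by (force simp: S_def)
    have "card B * card V = (\<Sum>v\<in>V. card B)" by simp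
    also have "\<dots> = (\<Sum>v\<in>V. card {y \<in> S. y + v \<in> B})"
    proof (rule sum.cong[OF refl])
      fix v assume v: "v \<in> V"
      have "{y \<in> S. y + v \<in> B} = (\<lambda>b. b + v) ` B"
      proof (intro equalityI subsetI)
        fix y assume "y \<in> {y \<in> S. y + v \<in> B}"
        then have "y = (y + v) + v" "y + v \<in> B" by (auto simp: add.assoc)
        then show "y \<in> (\<lambda>b. b + v) ` B" by (rule image_eqI)
      next
        fix y assume "y \<in> (\<lambda>b. b + v) ` B"
        then show "y \<in> {y \<in> S. y + v \<in> B}" using v by (auto simp: S_def add.assoc intro: sumsetI)
      qed
      then show "card B = card {y \<in> S. y + v \<in> B}" by (simp add: card_image)
    qed
    also have "\<dots> = (\<Sum>v\<in>V. \<Sum>y\<in>S. if y + v \<in> B then 1 else 0)"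
      using finS by (simp add: sum.If_cases Int_def)
    also have "\<dots> = (\<Sum>y\<in>S. \<Sum>v\<in>V. if y + v \<in> B then 1 else 0)" by (rule sum.swap)
    also have "\<dots> = (\<Sum>y\<in>S. card {v \<in> V. y + v \<in> B})"
      using finV by (simp add: sum.If_cases Int_def)
    finally have "real (card B * card V) = (\<Sum>y\<in>S. real (card {v \<in> V. y + v \<in> B}))" by simp
    then have "K ^ Suc m * (real (card B) * card V) = (\<Sum>y\<in>S. K ^ Suc m * card {v \<in> V. y + v \<in> B})"
      by (simp add: sum_distrib_left)
    also have "\<dots> < (\<Sum>y\<in>S. real (card V))"
      by (rule sum_strict_mono[OF finS S_ne]) (use neg in \<open>auto simp: not_le\<close>)
    also have "\<dots> = card S * real (card V)" by simp
    also have "\<dots> \<le> (K ^ Suc m * card B) * card V" by (rule mult_right_mono[OF cS]) simp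
    finally show False by (simp add: mult_ac)
  qed
  then show thesis using that SG by blast
qed

text \<open>The energy constant \<open>\<kappa> = 4 * M ^ 4\<close> fixes the others:
  \<open>K = 16384 * \<kappa> ^ 4\<close> is the doubling of the Balog--Szemeredi--Gowers set, and
  \<open>32 * M ^ 4 = 8 * \<kappa>\<close> its loss in size. Both conclusions are relative to
  \<open>H\<close> and the support, so the size of \<open>G\<close> does not enter.\<close>

lemma dense_subspace:
  fixes M K :: real and k l :: nat
  assumes M: "M \<ge> 1" "anorm f \<le> M"
    and z: "\<And>x. x \<in> G \<Longrightarrow> z x \<in> \<int>" and close: "\<And>x. x \<in> G \<Longrightarrow> \<bar>f x - z x\<bar> \<le> 1/8"
    and l2: "(\<Sum>x\<in>G. (f x)\<^sup>2) \<le> (\<Sum>x\<in>G. (z x)\<^sup>2)"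
    and nz: "{x \<in> G. z x \<noteq> 0} \<noteq> {}"
    and K: "K = 16384 * (4 * M ^ 4) ^ 4"
    and l: "2 ^ l \<ge> K" and k: "real k \<ge> 256 * real l ^ 2 * ln (32 * l * K ^ 3)"
  obtains H x where "sub H" "x \<in> G" "real (card H) \<le> K ^ (2 * l + 5) * card {v \<in> H. z (x + v) \<noteq> 0}"
    "real (card {x \<in> G. z x \<noteq> 0}) \<le> 32 * M ^ 4 * (2 * K ^ (k + 3 * (2 * l + 4))) ^ 16 * card H"
proof -
  define A where "A = {x \<in> G. z x \<noteq> 0}"
  have M4: "M ^ 4 \<ge> 1" using M(1) by simp
  have "(4 * M ^ 4) ^ 4 \<ge> 1" using M4 by (intro one_le_power) simp
  then have K4: "K \<ge> 4" unfolding K by simp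
  have l1: "l \<ge> 1" using l K4 by (cases l) auto
  obtain B where B: "B \<subseteq> A" "real (card B) \<ge> card A / (8 * (4 * M ^ 4))"
    "real (card (sumset B B)) \<le> 16384 * (4 * M ^ 4) ^ 4 * card B"
  proof (rule balog_szemeredi_gowers)
    show "A \<subseteq> G" "A \<noteq> {}" using nz by (auto simp: A_def)
    show "4 * M ^ 4 > 0" using M(1) by simp
    show "(\<Sum>d\<in>G. real (corr A d) ^ 2) \<ge> card A ^ 3 / (4 * M ^ 4)"
      unfolding A_def by (rule energy_lower_bound[OF M z close l2])
  qed
  have BG: "B \<subseteq> G" using B(1) by (auto simp: A_def)
  have finA: "finite A" using finG by (simp add: A_def)
  have "real (card A) > 0" using finA nz by (simp add: A_def card_gt_0_iff)
  then have "real (card B) > 0" using B(2) M4 by (smt (verit) divide_pos_pos)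
  then have Bne: "B \<noteq> {}" by auto
  have B2: "real (card (sumset B B)) \<le> K * card B" using B(3) K by simp
  obtain H where H: "sub H" "H \<subseteq> msum (2 * l + 4) B"
    "real (card B) \<le> (2 * K ^ (k + 3 * (2 * l + 4))) ^ 16 * card H"
    using bogolyubov_ruzsa[OF BG Bne K4 l1 l B2 k] .
  obtain x where x: "x \<in> G" "real (card H) \<le> K ^ Suc (2 * l + 4) * card {v \<in> H. x + v \<in> B}"
    using dense_coset[OF BG Bne H(1,2) B2] .
  have "card {v \<in> H. x + v \<in> B} \<le> card {v \<in> H. z (x + v) \<noteq> 0}"
    by (rule card_mono) (use sub_finite[OF H(1)] B(1) in \<open>auto simp: A_def\<close>)
  then have "K ^ Suc (2 * l + 4) * card {v \<in> H. x + v \<in> B} \<le> K ^ (2 * l + 5) * card {v \<in> H. z (x + v) \<noteq> 0}"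
    using K4 by (simp add: eval_nat_numeral mult_left_mono)
  then have 1: "real (card H) \<le> K ^ (2 * l + 5) * card {v \<in> H. z (x + v) \<noteq> 0}" using x(2) by linarith
  have "real (card A) \<le> 32 * M ^ 4 * card B" using B(2) M(1) by (simp add: field_simps)
  also have "\<dots> \<le> 32 * M ^ 4 * ((2 * K ^ (k + 3 * (2 * l + 4))) ^ 16 * card H)"
    by (rule mult_left_mono[OF H(3)]) (use M4 in simp)
  finally show thesis using that[OF H(1) x(1) 1] by (simp add: A_def mult.assoc)
qed

text \<open>The density of the support in \<open>x0 + H\<close> exceeds \<open>\<theta>\<close>, so
  the rounded average cannot vanish everywhere. The size of \<open>H\<close> relative to the support
  and the codimension of \<open>V\<close> in \<open>H\<close> multiply to \<open>C\<close>.\<close>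

lemma rounding_step:
  fixes M K \<theta> C :: real and k l :: nat
  assumes M: "M \<ge> 1" "anorm f \<le> M"
    and z: "\<And>x. x \<in> G \<Longrightarrow> z x \<in> \<int>" and close: "\<And>x. x \<in> G \<Longrightarrow> \<bar>f x - z x\<bar> \<le> 1/8"
    and l2: "(\<Sum>x\<in>G. (f x)\<^sup>2) \<le> (\<Sum>x\<in>G. (z x)\<^sup>2)"
    and nz: "{x \<in> G. z x \<noteq> 0} \<noteq> {}"
    and K: "K = 16384 * (4 * M ^ 4) ^ 4"
    and l: "2 ^ l \<ge> K" and k: "real k \<ge> 256 * real l ^ 2 * ln (32 * l * K ^ 3)"
    and \<theta>: "0 < \<theta>" "\<theta> \<le> 1/2" "\<theta> * K ^ (2 * l + 5) < 1"
    and C: "C = 32 * M ^ 4 * (2 * K ^ (k + 3 * (2 * l + 4))) ^ 16 * 2 powr (256 * M\<^sup>2 * ln (2 / \<theta>))"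
  obtains V g where "sub V" "\<forall>x\<in>G. g x \<in> \<int>" "\<forall>x\<in>G. \<forall>v\<in>V. g (x + v) = g x"
    "\<forall>x\<in>G. real (card {v \<in> V. z (x + v) \<noteq> g x}) \<le> \<theta> * card V" "\<exists>x\<in>G. g x \<noteq> (0::real)"
    "real (card {x \<in> G. z x \<noteq> 0}) \<le> C * card V"
proof -
  obtain H x0 where H: "sub H" and x0: "x0 \<in> G"
    and dense: "real (card H) \<le> K ^ (2 * l + 5) * card {v \<in> H. z (x0 + v) \<noteq> 0}"
    and big: "real (card {x \<in> G. z x \<noteq> 0}) \<le> 32 * M ^ 4 * (2 * K ^ (k + 3 * (2 * l + 4))) ^ 16 * card H"
    by (rule dense_subspace[OF M z close l2 nz K l k])
  have ln: "ln (2 / \<theta>) > 0" using \<theta> by (intro ln_gt_zero) (simp add: field_simps)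
  \<comment> \<open>Chosen so that the exceptional proportion
    \<open>2 * exp (- 1 / (256 * \<eta> * M))\<close> equals \<open>\<theta>\<close>; the
    codimension bound \<open>M / \<eta>\<close> is then
    \<open>256 * M\<^sup>2 * ln (2 / \<theta>)\<close>.\<close>
  define \<eta> where "\<eta> = 1 / (256 * M * ln (2 / \<theta>))"
  have \<eta>: "\<eta> > 0" using ln M by (simp add: \<eta>_def)
  have M0: "M > 0" using M by simp
  have Mln: "256 * M * ln (2 / \<theta>) > 0" using ln M0 by simp
  obtain V where V: "sub V" "V \<subseteq> H" "real (card H) \<le> card V * 2 powr (M / \<eta>)"
    "\<forall>x\<in>G. real (card {v\<in>V. \<bar>f (x + v) - avg V f x\<bar> > 1/4})
        \<le> 2 * exp (- 1 / (256 * \<eta> * M)) * card V"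
    by (rule quantitative_continuity[OF H \<eta> M0 M(2)])
  have "256 * \<eta> * M = 1 / ln (2 / \<theta>)" using M0 ln by (simp add: \<eta>_def)
  then have "2 * exp (- 1 / (256 * \<eta> * M)) = 2 * exp (- ln (2 / \<theta>))" by simp
  also have "\<dots> = \<theta>" using \<theta> by (simp add: exp_minus)
  finally have \<theta>_eq: "2 * exp (- 1 / (256 * \<eta> * M)) = \<theta>" .
  have M\<eta>: "M / \<eta> = 256 * M\<^sup>2 * ln (2 / \<theta>)" by (simp add: \<eta>_def power2_eq_square)
  have finV: "finite V" using sub_finite[OF V(1)] .
  have cV: "real (card V) > 0" using sub_card_pos[OF V(1)] by simp
  define g where "g x = real_of_int (round (avg V f x))" for x
  have g_dev: "real (card {v \<in> V. z (x + v) \<noteq> g x}) \<le> \<theta> * card V" if x: "x \<in> G" for x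
  proof -
    have "{v \<in> V. z (x + v) \<noteq> g x} \<subseteq> {v\<in>V. \<bar>f (x + v) - avg V f x\<bar> > 1/4}"
    proof
      fix v assume v: "v \<in> {v \<in> V. z (x + v) \<noteq> g x}"
      then have vG: "x + v \<in> G" using x addG subD(4)[OF V(1)] by blast
      obtain i where i: "z (x + v) = of_int i" using z[OF vG] by (auto elim: Ints_cases)
      show "v \<in> {v\<in>V. \<bar>f (x + v) - avg V f x\<bar> > 1/4}"
      proof (rule ccontr)
        assume "\<not> ?thesis"
        then have "\<bar>f (x + v) - avg V f x\<bar> \<le> 1/4" using v by auto
        \<comment> \<open>\<open>1/4 + 1/8 < 1/2\<close>, so the average rounds to the integer
          \<open>i\<close>.\<close>
        then have "\<bar>avg V f x - of_int i\<bar> < 1/2" using close[OF vG] i by linarith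
        then have "round (avg V f x) = i" by (rule round_unique')
        then show False using v i by (simp add: g_def)
      qed
    qed
    then have "card {v \<in> V. z (x + v) \<noteq> g x} \<le> card {v\<in>V. \<bar>f (x + v) - avg V f x\<bar> > 1/4}"
      by (rule card_mono[rotated]) (use finV in auto)
    then show ?thesis using V(4)[rule_format, OF x] unfolding \<theta>_eq by linarith
  qed
  have g_nz: "\<exists>x\<in>G. g x \<noteq> 0"
  proof (rule ccontr)
    assume neg: "\<not> ?thesis"
    \<comment> \<open>If \<open>g\<close> vanished, \<open>z\<close> would be nonzero on at most a
      proportion \<open>\<theta>\<close> of each coset of \<open>V\<close>; averaging over the
      cosets inside \<open>x0 + H\<close> contradicts the density there.\<close>
    have "real (card V) * card {w \<in> H. z (x0 + w) \<noteq> 0} = (\<Sum>v\<in>V. \<Sum>w\<in>H. if z (x0 + w) \<noteq> 0 then 1 else 0)"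
      using sub_finite[OF H] by (simp add: sum.If_cases Int_def)
    also have "\<dots> = (\<Sum>v\<in>V. \<Sum>w\<in>H. if z (x0 + (w + v)) \<noteq> 0 then 1 else 0)"
      by (rule sum.cong[OF refl], rule sum_shift[OF H, symmetric]) (use V(2) in auto)
    also have "\<dots> = (\<Sum>w\<in>H. \<Sum>v\<in>V. if z (x0 + (w + v)) \<noteq> 0 then 1 else 0)" by (rule sum.swap)
    also have "\<dots> = (\<Sum>w\<in>H. real (card {v \<in> V. z ((x0 + w) + v) \<noteq> 0}))"
      using finV by (simp add: sum.If_cases Int_def add.assoc)
    also have "\<dots> \<le> (\<Sum>w\<in>H. \<theta> * card V)"
    proof (rule sum_mono)
      fix w assume "w \<in> H"
      then have xw: "x0 + w \<in> G" using x0 addG subD(4)[OF H] by blast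
      then show "real (card {v \<in> V. z ((x0 + w) + v) \<noteq> 0}) \<le> \<theta> * card V" using g_dev[OF xw] neg by simp
    qed
    also have "\<dots> = card V * (\<theta> * card H)" by simp
    finally have "real (card {w \<in> H. z (x0 + w) \<noteq> 0}) \<le> \<theta> * card H" using cV by simp
    then have "K ^ (2 * l + 5) * card {w \<in> H. z (x0 + w) \<noteq> 0} \<le> K ^ (2 * l + 5) * (\<theta> * card H)"
      by (rule mult_left_mono) (use K in simp)
    then have "real (card H) \<le> (\<theta> * K ^ (2 * l + 5)) * card H" using dense by (simp add: mult_ac)
    moreover have "(\<theta> * K ^ (2 * l + 5)) * card H < 1 * real (card H)"
      using \<theta>(3) sub_card_pos[OF H] by (intro mult_strict_right_mono) auto
    ultimately show False by simp
  qed
  have size: "real (card {x \<in> G. z x \<noteq> 0}) \<le> C * card V"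
  proof -
    have "32 * M ^ 4 * (2 * K ^ (k + 3 * (2 * l + 4))) ^ 16 * card H
        \<le> 32 * M ^ 4 * (2 * K ^ (k + 3 * (2 * l + 4))) ^ 16 * (card V * 2 powr (M / \<eta>))"
      by (rule mult_left_mono[OF V(3)]) (use M K in simp)
    also have "\<dots> = C * card V" unfolding C M\<eta> by (simp add: mult_ac)
    finally show ?thesis using big by linarith
  qed
  show thesis
    by (rule that[of V g]) (use V(1) g_dev g_nz size avg_shift[OF V(1)] in \<open>auto simp: g_def\<close>)
qed

end

section \<open>Signed sums of subspaces\<close>

context F2_pairing
begin

text \<open>Lists allow repeated subspaces and make addition a concatenation; \<open>L\<close> is a
  real upper bound on the length, so that analytic estimates can be inserted directly.\<close>

definition signed_rep :: "real \<Rightarrow> ('a \<Rightarrow> real) \<Rightarrow> bool" where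
  "signed_rep L z \<longleftrightarrow> (\<exists>ws :: (real \<times> 'a set) list. real (length ws) \<le> L \<and>
     (\<forall>w\<in>set ws. fst w \<in> {-1, 1} \<and> sub (snd w)) \<and>
     (\<forall>x\<in>G. z x = (\<Sum>w\<leftarrow>ws. fst w * (if x \<in> snd w then 1 else 0))))"

lemma signed_rep_mono: "signed_rep L z \<Longrightarrow> L \<le> L' \<Longrightarrow> signed_rep L' z"
  unfolding signed_rep_def by force

lemma signed_rep_cong: "signed_rep L z \<Longrightarrow> (\<And>x. x \<in> G \<Longrightarrow> z' x = z x) \<Longrightarrow> signed_rep L z'"
  unfolding signed_rep_def by simp

lemma signed_rep_0: "0 \<le> L \<Longrightarrow> signed_rep L (\<lambda>_. 0)"
  unfolding signed_rep_def by (rule exI[of _ "[]"]) simp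

lemma signed_rep_add:
  assumes "signed_rep L z" "signed_rep L' z'" shows "signed_rep (L + L') (\<lambda>x. z x + z' x)"
proof -
  obtain ws ws' where
    "real (length ws) \<le> L" "\<forall>w\<in>set ws. fst w \<in> {-1, 1} \<and> sub (snd w)"
    "\<forall>x\<in>G. z x = (\<Sum>w\<leftarrow>ws. fst w * (if x \<in> snd w then 1 else 0))"
    "real (length ws') \<le> L'" "\<forall>w\<in>set ws'. fst w \<in> {-1, 1} \<and> sub (snd w)"
    "\<forall>x\<in>G. z' x = (\<Sum>w\<leftarrow>ws'. fst w * (if x \<in> snd w then 1 else 0))"
    using assms unfolding signed_rep_def by blast
  then show ?thesis unfolding signed_rep_def by (intro exI[of _ "ws @ ws'"]) auto
qed

lemma signed_rep_uminus:
  assumes "signed_rep L z" shows "signed_rep L (\<lambda>x. - z x)"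
proof -
  obtain ws where ws: "real (length ws) \<le> L" "\<forall>w\<in>set ws. fst w \<in> {-1, 1} \<and> sub (snd w)"
    "\<forall>x\<in>G. z x = (\<Sum>w\<leftarrow>ws. fst w * (if x \<in> snd w then 1 else 0))"
    using assms unfolding signed_rep_def by blast
  have "(\<Sum>w\<leftarrow>map (\<lambda>w. (- fst w, snd w)) ws. fst w * (if x \<in> snd w then 1 else 0))
      = - (\<Sum>w\<leftarrow>ws. fst w * (if x \<in> snd w then 1 else 0 :: real))" for x
    by (induction ws) auto
  then show ?thesis unfolding signed_rep_def using ws
    by (intro exI[of _ "map (\<lambda>w. (- fst w, snd w)) ws"]) auto
qed

lemma signed_rep_sub: "sub V \<Longrightarrow> signed_rep 1 (\<lambda>x. if x \<in> V then 1 else 0)"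
  unfolding signed_rep_def by (rule exI[of _ "[(1, V)]"]) simp

text \<open>In exponent two, \<open>V\<close> together with one of its cosets is again a subspace,
  so a coset other than \<open>V\<close> is the difference of two subspaces.\<close>

lemma signed_rep_coset:
  assumes V: "sub V" and x: "x \<in> G"
  shows "signed_rep 2 (\<lambda>y. if x + y \<in> V then 1 else 0)"
proof (cases "x \<in> V")
  case True
  have "x + y \<in> V \<longleftrightarrow> y \<in> V" for y
    using subD(3)[OF V True, of y] subD(3)[OF V True, of "x + y"] by auto
  then show ?thesis using signed_rep_mono[OF signed_rep_sub[OF V]] by simp
next
  case False
  define W where "W = V \<union> (+) x ` V"
  have W: "sub W"
    unfolding sub_def
  proof (intro conjI ballI)
    show "W \<subseteq> G" using subD(4)[OF V] addG x by (auto simp: W_def)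
    show "0 \<in> W" using subD(2)[OF V] by (simp add: W_def)
    fix a b assume a: "a \<in> W" and b: "b \<in> W"
    have in1: "x + c \<in> W" if "c \<in> V" for c using that by (simp add: W_def)
    have in2: "c \<in> W" if "c \<in> V" for c using that by (simp add: W_def)
    from a consider "a \<in> V" | u where "u \<in> V" "a = x + u" by (auto simp: W_def)
    then show "a + b \<in> W"
    proof cases
      case 1
      from b consider "b \<in> V" | v where "v \<in> V" "b = x + v" by (auto simp: W_def)
      then show ?thesis
      proof cases
        case 2
        have e: "a + b = x + (a + v)" using 2 by (simp only: ac_simps)
        show ?thesis unfolding e by (rule in1[OF subD(3)[OF V 1 2(1)]])
      qed (use in2 subD(3)[OF V 1] in auto)
    next
      case a: 2
      from b consider "b \<in> V" | v where "v \<in> V" "b = x + v" by (auto simp: W_def)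
      then show ?thesis
      proof cases
        case 1
        have e: "a + b = x + (u + b)" using a by (simp only: ac_simps)
        show ?thesis unfolding e by (rule in1[OF subD(3)[OF V a(1) 1]])
      next
        case 2
        have "a + b = u + v + (x + x)" using a 2 by (simp only: ac_simps)
        then have e: "a + b = u + v" by simp
        show ?thesis unfolding e by (rule in2[OF subD(3)[OF V a(1) 2(1)]])
      qed
    qed
  qed
  have mem: "x + y \<in> V \<longleftrightarrow> y \<in> (+) x ` V" for y
  proof
    assume "x + y \<in> V"
    then have "x + (x + y) \<in> (+) x ` V" by (rule imageI)
    then show "y \<in> (+) x ` V" by simp
  qed auto
  have disj: "y \<notin> V" if y: "y \<in> (+) x ` V" for y
  proof
    assume "y \<in> V"
    moreover obtain v where v: "v \<in> V" "y = x + v" using y by auto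
    ultimately have "y + v \<in> V" using subD(3)[OF V] by blast
    then show False using v False by (simp add: add.assoc)
  qed
  have "signed_rep (1 + 1) (\<lambda>y. (if y \<in> W then 1 else 0) + - (if y \<in> V then 1 else 0))"
    by (intro signed_rep_add signed_rep_uminus signed_rep_sub V W)
  then show ?thesis
    by (rule signed_rep_cong[OF signed_rep_mono]) (use mem disj in \<open>auto simp: W_def\<close>)
qed

lemma signed_rep_nat_mult:
  assumes "signed_rep L z" shows "signed_rep (real n * L) (\<lambda>x. real n * z x)"
proof (induction n)
  case 0
  then show ?case by (simp add: signed_rep_0)
next
  case (Suc n)
  show ?case
    using signed_rep_add[OF Suc assms] by (simp add: distrib_right add.commute)
qed

lemma signed_rep_int_mult:
  assumes "signed_rep L z" "c \<in> \<int>" "\<bar>c\<bar> \<le> m" "L \<ge> 0" shows "signed_rep (m * L) (\<lambda>x. c * z x)"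
proof -
  obtain i :: int where i: "c = of_int i" using assms(2) by (auto elim: Ints_cases)
  have n: "real (nat \<bar>i\<bar>) = \<bar>c\<bar>" using i by simp
  have 1: "signed_rep (m * L) (\<lambda>x. \<bar>c\<bar> * z x)"
    using signed_rep_mono[OF signed_rep_nat_mult[OF assms(1), of "nat \<bar>i\<bar>"], of "m * L"] assms(3,4)
    unfolding n by (simp add: mult_right_mono)
  show ?thesis
  proof (cases "c \<ge> 0")
    case True
    then show ?thesis using 1 by simp
  next
    case False
    then show ?thesis using signed_rep_uminus[OF 1] by simp
  qed
qed

text \<open>The induction removes one coset of \<open>V\<close> at a time. The quotient in the bound
  is the number of cosets in the support, and each costs at most two subspaces, repeated at most
  \<open>m\<close> times.\<close>

lemma signed_rep_invariant:
  assumes V: "sub V" and m: "m \<ge> 0"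
    and g: "\<forall>x\<in>G. g x \<in> \<int>" "\<forall>x\<in>G. \<forall>v\<in>V. g (x + v) = g x" "\<forall>x\<in>G. \<bar>g x\<bar> \<le> m"
  shows "signed_rep (2 * m * (card {x \<in> G. g x \<noteq> 0} / card V)) g"
  using g
proof (induction "card {x \<in> G. g x \<noteq> 0}" arbitrary: g rule: less_induct)
  case less
  define P where "P = {x \<in> G. g x \<noteq> 0}"
  have finP: "finite P" using finG by (simp add: P_def)
  have cV: "real (card V) > 0" using sub_card_pos[OF V] by simp
  show ?case
  proof (cases "P = {}")
    case True
    have "signed_rep (2 * m * (card P / card V)) g"
      by (rule signed_rep_cong[OF signed_rep_0]) (use True m in \<open>auto simp: P_def\<close>)
    then show ?thesis by (simp only: P_def)
  next
    case False
    then obtain x where x: "x \<in> G" "g x \<noteq> 0" by (auto simp: P_def)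
    define coset where "coset y \<longleftrightarrow> x + y \<in> V" for y
    have gc: "g y = g x" if "coset y" for y
    proof -
      have "g (x + (x + y)) = g x" using less.prems(2) x(1) that by (simp only: coset_def)
      then show ?thesis by simp
    qed
    define g' where "g' y = (if coset y then 0 else g y)" for y
    have sub': "{y \<in> G. g' y \<noteq> 0} = P - (+) x ` V"
    proof -
      have "coset y \<longleftrightarrow> y \<in> (+) x ` V" for y
        unfolding coset_def by (metis (no_types, lifting) add_self_left image_iff)
      then show ?thesis by (auto simp: g'_def P_def)
    qed
    have "(+) x ` V \<subseteq> P"
      using x less.prems(2) addG subD(4)[OF V] by (auto simp: P_def)
    then have card': "card {y \<in> G. g' y \<noteq> 0} = card P - card V" "card V \<le> card P"
      unfolding sub' using card_Diff_subset[of "(+) x ` V" P] sub_finite[OF V] card_mono[OF finP, of "(+) x ` V"]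
      by (auto simp: card_image)
    have "signed_rep (2 * m * (card {y \<in> G. g' y \<noteq> 0} / card V)) g'"
    proof (rule less.hyps)
      show "card {y \<in> G. g' y \<noteq> 0} < card {x \<in> G. g x \<noteq> 0}"
        using card' sub_card_pos[OF V] by (simp add: P_def)
      show "\<forall>y\<in>G. g' y \<in> \<int>" using less.prems(1) by (simp add: g'_def)
      show "\<forall>y\<in>G. \<bar>g' y\<bar> \<le> m" using less.prems(3) m by (simp add: g'_def)
      show "\<forall>y\<in>G. \<forall>v\<in>V. g' (y + v) = g' y"
      proof (intro ballI)
        fix y v assume y: "y \<in> G" and v: "v \<in> V"
        have "x + (y + v) \<in> V \<longleftrightarrow> x + y \<in> V"
          using subD(3)[OF V _ v, of "x + y"] subD(3)[OF V _ v, of "x + (y + v)"]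
          by (auto simp: add.assoc)
        then show "g' (y + v) = g' y" using less.prems(2) y v by (simp add: g'_def coset_def)
      qed
    qed
    moreover have "signed_rep (m * 2) (\<lambda>y. g x * (if x + y \<in> V then 1 else 0))"
      by (rule signed_rep_int_mult[OF signed_rep_coset[OF V x(1)]]) (use less.prems x in auto)
    ultimately have "signed_rep (2 * m * (card {y \<in> G. g' y \<noteq> 0} / card V) + m * 2)
        (\<lambda>y. g' y + g x * (if x + y \<in> V then 1 else 0))"
      by (rule signed_rep_add)
    moreover have "2 * m * (card {y \<in> G. g' y \<noteq> 0} / card V) + m * 2 = 2 * m * (card P / card V)"
      using card' cV by (simp add: of_nat_diff field_simps)
    ultimately have "signed_rep (2 * m * (card P / card V)) (\<lambda>y. g' y + g x * (if x + y \<in> V then 1 else 0))" by simp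
    then have "signed_rep (2 * m * (card P / card V)) g"
      by (rule signed_rep_cong) (use gc in \<open>auto simp: g'_def coset_def\<close>)
    then show ?thesis by (simp only: P_def)
  qed
qed

lemma anorm_zero: assumes "anorm f \<le> 0" "x \<in> G" shows "f x = 0"
  using sup_le_anorm[OF assms(2), of f] assms(1) by simp

text \<open>Every subtracted \<open>g\<close> is annihilated by the later projections, so the Fourier coefficients of the
  current \<open>f\<close> are \<open>0\<close> or those of the current \<open>z\<close>. This keeps \<open>\<parallel>f\<parallel>\<^sub>2 \<le> \<parallel>z\<parallel>\<^sub>2\<close>, although \<open>f\<close> is only close to
  \<open>z\<close> uniformly.\<close>

lemma iterate_decomposition:
  fixes M \<theta> C :: real and z :: "'a \<Rightarrow> real"
  assumes M: "M \<ge> 1" and \<theta>: "0 < \<theta>" "\<theta> \<le> 1/2" and C: "C \<ge> 0"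
    and step: "\<And>f z. anorm f \<le> M \<Longrightarrow> \<forall>x\<in>G. z x \<in> \<int> \<Longrightarrow> \<forall>x\<in>G. \<bar>f x - z x\<bar> \<le> 1/8 \<Longrightarrow>
      (\<Sum>x\<in>G. (f x)\<^sup>2) \<le> (\<Sum>x\<in>G. (z x)\<^sup>2) \<Longrightarrow> {x \<in> G. z x \<noteq> 0} \<noteq> {} \<Longrightarrow>
      \<exists>V g. sub V \<and> (\<forall>x\<in>G. g x \<in> \<int>) \<and> (\<forall>x\<in>G. \<forall>v\<in>V. g (x + v) = g x) \<and>
        (\<forall>x\<in>G. real (card {v \<in> V. z (x + v) \<noteq> g x}) \<le> \<theta> * card V) \<and> (\<exists>x\<in>G. g x \<noteq> (0::real)) \<and>
        real (card {x \<in> G. z x \<noteq> 0}) \<le> C * card V"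
    and f: "anorm f \<le> j / 2" "anorm f \<le> M"
    and z: "\<forall>x\<in>G. z x \<in> \<int>"
    and close: "\<forall>x\<in>G. \<bar>f x - z x\<bar> \<le> (1/2) ^ j / 8 - 4 * M * \<theta>"
    and coeffs: "\<forall>r\<in>G. hat f r = 0 \<or> hat f r = hat z r"
  shows "signed_rep (j * (8 * M * C)) z"
  using f z close coeffs
proof (induction j arbitrary: f z)
  case 0
  have "z x = 0" if x: "x \<in> G" for x
  proof -
    have "f x = 0" by (rule anorm_zero) (use 0 x in auto)
    moreover have "4 * M * \<theta> > 0" using M \<theta> by simp
    moreover have "\<bar>f x - z x\<bar> \<le> 1/8 - 4 * M * \<theta>" using 0 x by simp
    ultimately have small: "\<bar>z x\<bar> < 1" by linarith
    have "z x \<in> \<int>" using 0 x by blast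
    then obtain i where i: "z x = of_int i" by (rule Ints_cases)
    then show ?thesis using small by simp
  qed
  then show ?case by (intro signed_rep_cong[OF signed_rep_0]) auto
next
  case (Suc j)
  define \<tau> where "\<tau> = 4 * M * \<theta>"
  have \<tau>: "\<tau> > 0" using M \<theta> by (simp add: \<tau>_def)
  \<comment> \<open>The new error is at most \<open>\<epsilon> + (\<epsilon> + \<tau>)\<close>, so
    \<open>\<epsilon> + \<tau>\<close> at most doubles. This is why the error bound is a power of
    \<open>1/2\<close> minus the fixed loss \<open>\<tau>\<close>.\<close>
  define \<epsilon> where "\<epsilon> = (1/2) ^ Suc j / 8 - \<tau>"
  have p1: "(1/2::real) ^ Suc j \<le> 1" by (rule power_le_one) auto
  have \<epsilon>8: "\<epsilon> + \<tau> \<le> 1/8" using p1 by (simp add: \<epsilon>_def)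
  have cl: "\<bar>f x - z x\<bar> \<le> \<epsilon>" if "x \<in> G" for x using Suc.prems(4) that by (simp add: \<epsilon>_def \<tau>_def)
  show ?case
  proof (cases "{x \<in> G. z x \<noteq> 0} = {}")
    case True
    have "0 \<le> Suc j * (8 * M * C)" using M C by simp
    from signed_rep_0[OF this] show ?thesis by (rule signed_rep_cong) (use True in auto)
  next
    case False
    have l2: "(\<Sum>x\<in>G. (f x)\<^sup>2) \<le> (\<Sum>x\<in>G. (z x)\<^sup>2)"
    proof -
      have "(\<Sum>r\<in>G. (hat f r)\<^sup>2) \<le> (\<Sum>r\<in>G. (hat z r)\<^sup>2)"
        by (rule sum_mono) (use Suc.prems(5) in force)
      then show ?thesis by (simp add: parseval divide_le_cancel)
    qed
    have cl8: "\<forall>x\<in>G. \<bar>f x - z x\<bar> \<le> 1/8"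
    proof
      fix x assume "x \<in> G"
      then show "\<bar>f x - z x\<bar> \<le> 1/8" using cl[of x] \<epsilon>8 \<tau> by linarith
    qed
    obtain V g where V: "sub V" and g: "\<forall>x\<in>G. g x \<in> \<int>" "\<forall>x\<in>G. \<forall>v\<in>V. g (x + v) = g x"
      "\<forall>x\<in>G. real (card {v \<in> V. z (x + v) \<noteq> g x}) \<le> \<theta> * card V" "\<exists>x\<in>G. g x \<noteq> (0::real)"
      "real (card {x \<in> G. z x \<noteq> 0}) \<le> C * card V"
      using step[OF Suc.prems(2,3) cl8 l2 False] by blast
    have finV: "finite V" using sub_finite[OF V] .
    have cV: "real (card V) > 0" using sub_card_pos[OF V] by simp
    have z_le: "\<bar>z x\<bar> \<le> 2 * M" if x: "x \<in> G" for x
      using sup_le_anorm[OF x, of f] cl[OF x] \<epsilon>8 \<tau> Suc.prems(2) M by linarith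
    \<comment> \<open>As \<open>\<theta> < 1\<close>, the exceptional set is not all of
      \<open>V\<close>, so each value of \<open>g\<close> is a value of \<open>z\<close> and
      inherits its bound.\<close>
    have agree: "\<exists>v\<in>V. z (x + v) = g x" if x: "x \<in> G" for x
    proof (rule ccontr)
      assume "\<not> ?thesis"
      then have "{v \<in> V. z (x + v) \<noteq> g x} = V" by auto
      then have "real (card V) \<le> \<theta> * card V" using g(3) x by force
      then show False using cV \<theta>(2) by (simp add: mult_le_cancel_right1)
    qed
    have g_le: "\<bar>g x\<bar> \<le> 2 * M" if x: "x \<in> G" for x
    proof -
      obtain v where "v \<in> V" "z (x + v) = g x" using agree[OF x] by blast
      then show ?thesis using z_le[of "x + v"] addG[OF x] subD(4)[OF V] by auto
    qed
    \<comment> \<open>Off \<open>E\<close> the value of \<open>z\<close> is \<open>g x\<close> and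
      only \<open>\<epsilon>\<close> is lost; on \<open>E\<close>, a proportion at most
      \<open>\<theta>\<close> of \<open>V\<close>, the additional loss is at most
      \<open>4 * M\<close>, which contributes \<open>\<tau>\<close> on average.\<close>
    have avg_close: "\<bar>avg V f x - g x\<bar> \<le> \<epsilon> + \<tau>" if x: "x \<in> G" for x
    proof -
      define E where "E = {v \<in> V. z (x + v) \<noteq> g x}"
      have finE: "finite E" using finV by (simp add: E_def)
      have xv: "x + v \<in> G" if "v \<in> V" for v using addG x subD(4)[OF V] that by blast
      have "card V * (avg V f x - g x) = (\<Sum>v\<in>V. f (x + v) - g x)"
        using cV by (simp add: avg_def sum_subtractf right_diff_distrib)
      then have "card V * \<bar>avg V f x - g x\<bar> = \<bar>\<Sum>v\<in>V. f (x + v) - g x\<bar>"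
        by (metis abs_mult abs_of_nat)
      also have "\<dots> \<le> (\<Sum>v\<in>V. \<bar>f (x + v) - g x\<bar>)" by (rule sum_abs)
      also have "\<dots> \<le> (\<Sum>v\<in>V. \<epsilon> + (if v \<in> E then 4 * M else 0))"
      proof (rule sum_mono)
        fix v assume v: "v \<in> V"
        have "\<bar>f (x + v) - z (x + v)\<bar> \<le> \<epsilon>" by (rule cl[OF xv[OF v]])
        moreover have "\<bar>z (x + v) - g x\<bar> \<le> (if v \<in> E then 4 * M else 0)"
        proof (cases "v \<in> E")
          case True
          then show ?thesis using z_le[OF xv[OF v]] g_le[OF x] by simp
        next
          case False
          then show ?thesis using v by (simp add: E_def)
        qed
        ultimately show "\<bar>f (x + v) - g x\<bar> \<le> \<epsilon> + (if v \<in> E then 4 * M else 0)" by linarith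
      qed
      also have "\<dots> = card V * \<epsilon> + card (V \<inter> E) * (4 * M)"
        using finV by (simp add: sum.distrib sum.If_cases)
      also have "V \<inter> E = E" by (auto simp: E_def)
      also have "card E * (4 * M) \<le> (\<theta> * card V) * (4 * M)"
        by (rule mult_right_mono) (use g(3) x M in \<open>auto simp: E_def\<close>)
      finally have "card V * \<bar>avg V f x - g x\<bar> \<le> card V * (\<epsilon> + \<tau>)"
        by (simp add: \<tau>_def algebra_simps)
      then show ?thesis using cV by simp
    qed
    define f' where "f' x = f x - avg V f x" for x
    define z' where "z' x = z x - g x" for x
    have anorm_f': "anorm f' = anorm f - anorm (avg V f)"
      using anorm_split[OF V, of f] by (simp add: f'_def[abs_def])
    \<comment> \<open>At a point with \<open>g x \<noteq> 0\<close> the average is at least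
      \<open>7/8\<close> in absolute value, and the sup norm is at most the spectral norm.\<close>
    have avg_big: "anorm (avg V f) \<ge> 1/2"
    proof -
      obtain x where x: "x \<in> G" "g x \<noteq> 0" using g(4) by blast
      obtain i where i: "g x = of_int i" using g(1) x by (auto elim: Ints_cases)
      then have "\<bar>g x\<bar> \<ge> 1" using x by simp
      then show ?thesis using avg_close[OF x(1)] \<epsilon>8 sup_le_anorm[OF x(1), of "avg V f"] by linarith
    qed
    have IH: "signed_rep (j * (8 * M * C)) z'"
    proof (rule Suc.IH[of f' z'])
      show "anorm f' \<le> j / 2" using anorm_f' avg_big Suc.prems(1) by simp
      show "anorm f' \<le> M" using anorm_f' avg_big Suc.prems(2) by simp
      show "\<forall>x\<in>G. z' x \<in> \<int>" using g(1) Suc.prems(3) by (simp add: z'_def)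
      show "\<forall>x\<in>G. \<bar>f' x - z' x\<bar> \<le> (1/2) ^ j / 8 - 4 * M * \<theta>"
      proof
        fix x assume x: "x \<in> G"
        have "\<bar>f' x - z' x\<bar> \<le> \<epsilon> + (\<epsilon> + \<tau>)" using cl[OF x] avg_close[OF x] unfolding f'_def z'_def by linarith
        also have "\<dots> = (1/2) ^ j / 8 - 4 * M * \<theta>" by (simp add: \<epsilon>_def \<tau>_def)
        finally show "\<bar>f' x - z' x\<bar> \<le> (1/2) ^ j / 8 - 4 * M * \<theta>" .
      qed
      show "\<forall>r\<in>G. hat f' r = 0 \<or> hat f' r = hat z' r"
      proof
        fix r assume r: "r \<in> G"
        have "hat g r = hat (avg V g) r"
          by (rule fun_cong[OF hat_cong]) (use avg_invariant[OF V] g(2) in auto)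
        then have "hat g r = (if r \<in> perp V then hat g r else 0)" using hat_avg[OF V r] by simp
        then have "hat g r = 0" if "r \<notin> perp V" using that by simp
        then show "hat f' r = 0 \<or> hat f' r = hat z' r"
          using Suc.prems(5) r by (auto simp: f'_def[abs_def] z'_def[abs_def] hat_diff hat_avg[OF V])
      qed
    qed
    define P where "P = {x \<in> G. g x \<noteq> 0}"
    \<comment> \<open>Where \<open>g\<close> is nonzero, \<open>z\<close> is nonzero on at least
      half of the coset, so double counting bounds the support of \<open>g\<close> by twice that of
      \<open>z\<close>.\<close>
    have P_le: "real (card P) \<le> 2 * C * card V"
    proof -
      have "card P * (real (card V) / 2) = (\<Sum>x\<in>P. real (card V) / 2)" by simp
      also have "\<dots> \<le> (\<Sum>x\<in>P. real (card {v \<in> V. z (x + v) \<noteq> 0}))"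
      proof (rule sum_mono)
        fix x assume x: "x \<in> P"
        then have xG: "x \<in> G" by (simp add: P_def)
        have "V \<subseteq> {v \<in> V. z (x + v) \<noteq> g x} \<union> {v \<in> V. z (x + v) \<noteq> 0}" using x by (auto simp: P_def)
        then have "card V \<le> card ({v \<in> V. z (x + v) \<noteq> g x} \<union> {v \<in> V. z (x + v) \<noteq> 0})"
          by (rule card_mono[rotated]) (use finV in auto)
        also have "\<dots> \<le> card {v \<in> V. z (x + v) \<noteq> g x} + card {v \<in> V. z (x + v) \<noteq> 0}" by (rule card_Un_le)
        finally have "real (card V) \<le> \<theta> * card V + card {v \<in> V. z (x + v) \<noteq> 0}"
          using g(3)[rule_format, OF xG] by linarith
        moreover have "\<theta> * card V \<le> 1/2 * real (card V)" by (rule mult_right_mono[OF \<theta>(2)]) simp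
        ultimately show "real (card V) / 2 \<le> card {v \<in> V. z (x + v) \<noteq> 0}" by linarith
      qed
      also have "\<dots> \<le> (\<Sum>x\<in>G. real (card {v \<in> V. z (x + v) \<noteq> 0}))"
        by (rule sum_mono2) (use finG in \<open>auto simp: P_def\<close>)
      also have "\<dots> = (\<Sum>x\<in>G. \<Sum>v\<in>V. if z (x + v) \<noteq> 0 then 1 else 0)"
        using finV by (simp add: sum.If_cases Int_def)
      also have "\<dots> = (\<Sum>v\<in>V. \<Sum>x\<in>G. if z (x + v) \<noteq> 0 then 1 else 0)" by (rule sum.swap)
      also have "\<dots> = (\<Sum>v\<in>V. \<Sum>x\<in>G. if z x \<noteq> 0 then 1 else 0)"
        by (rule sum.cong[OF refl], rule sum_shift[OF sub_G, where h = "\<lambda>x. if z x \<noteq> 0 then 1 else 0"])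
          (use subD(4)[OF V] in auto)
      also have "\<dots> = card V * real (card {x \<in> G. z x \<noteq> 0})"
        using finG by (simp add: sum.If_cases Int_def)
      also have "\<dots> \<le> card V * (C * card V)" by (rule mult_left_mono[OF g(5)]) simp
      finally have "real (card V) * card P \<le> real (card V) * (2 * C * card V)" by (simp add: mult_ac)
      then show ?thesis using cV by simp
    qed
    have "signed_rep (2 * (2 * M) * (card P / card V)) g"
      unfolding P_def by (rule signed_rep_invariant[OF V]) (use M g g_le in auto)
    moreover have "2 * (2 * M) * (card P / card V) \<le> 8 * M * C"
    proof -
      have "card P / card V \<le> 2 * C" using P_le cV by (simp add: field_simps)
      then have "2 * (2 * M) * (card P / card V) \<le> 2 * (2 * M) * (2 * C)" by (rule mult_left_mono) (use M in simp)
      then show ?thesis by simp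
    qed
    ultimately have "signed_rep (8 * M * C) g" by (rule signed_rep_mono)
    from signed_rep_add[OF IH this] have "signed_rep (j * (8 * M * C) + 8 * M * C) z"
      by (rule signed_rep_cong) (simp add: z'_def)
    then show ?thesis by (simp add: distrib_right add.commute)
  qed
qed

text \<open>The iteration starts at \<open>z = f\<close> with no error, yet
  \<open>4 * M * \<theta>\<close> has to fit below \<open>(1/2) ^ j / 8\<close>, since the error may
  double in each of the \<open>j\<close> steps. The norm drops by \<open>1/2\<close> per step,
  whence \<open>j \<ge> 2 * M\<close>.\<close>

lemma signed_rep_of_integer_valued:
  fixes M K \<theta> C :: real and j k l :: nat
  assumes M: "M \<ge> 1" "anorm f \<le> M" and f: "\<forall>x\<in>G. f x \<in> \<int>"
    and K: "K = 16384 * (4 * M ^ 4) ^ 4"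
    and l: "2 ^ l \<ge> K" and k: "real k \<ge> 256 * real l ^ 2 * ln (32 * l * K ^ 3)"
    and \<theta>: "0 < \<theta>" "\<theta> \<le> 1/2" "\<theta> * K ^ (2 * l + 5) < 1"
    and j: "real j \<ge> 2 * M" "4 * M * \<theta> \<le> (1/2) ^ j / 8"
    and C: "C = 32 * M ^ 4 * (2 * K ^ (k + 3 * (2 * l + 4))) ^ 16 * 2 powr (256 * M\<^sup>2 * ln (2 / \<theta>))"
  shows "signed_rep (j * (8 * M * C)) f"
proof (rule iterate_decomposition[OF M(1) \<theta>(1,2), where f = f])
  show "C \<ge> 0" unfolding C using M(1) K by simp
  show "anorm f \<le> real j / 2" using M(2) j(1) by simp
  show "anorm f \<le> M" by fact
  show "\<forall>x\<in>G. f x \<in> \<int>" by fact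
  show "\<forall>x\<in>G. \<bar>f x - f x\<bar> \<le> (1/2) ^ j / 8 - 4 * M * \<theta>" using j(2) by simp
  show "\<forall>r\<in>G. hat f r = 0 \<or> hat f r = hat f r" by simp
next
  fix f z assume a: "anorm f \<le> M" "\<forall>x\<in>G. z x \<in> \<int>" "\<forall>x\<in>G. \<bar>f x - z x\<bar> \<le> 1/8"
    "(\<Sum>x\<in>G. (f x)\<^sup>2) \<le> (\<Sum>x\<in>G. (z x)\<^sup>2)" "{x \<in> G. z x \<noteq> 0} \<noteq> {}"
  have b: "\<And>x. x \<in> G \<Longrightarrow> z x \<in> \<int>" "\<And>x. x \<in> G \<Longrightarrow> \<bar>f x - z x\<bar> \<le> 1/8" using a(2,3) by blast+
  obtain V g where "sub V" "\<forall>x\<in>G. g x \<in> \<int>" "\<forall>x\<in>G. \<forall>v\<in>V. g (x + v) = g x"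
    "\<forall>x\<in>G. real (card {v \<in> V. z (x + v) \<noteq> g x}) \<le> \<theta> * card V" "\<exists>x\<in>G. g x \<noteq> (0::real)"
    "real (card {x \<in> G. z x \<noteq> 0}) \<le> C * card V"
    by (rule rounding_step[OF M(1) a(1) b a(4,5) K l k \<theta> C])
  then show "\<exists>V g. sub V \<and> (\<forall>x\<in>G. g x \<in> \<int>) \<and> (\<forall>x\<in>G. \<forall>v\<in>V. g (x + v) = g x) \<and>
        (\<forall>x\<in>G. real (card {v \<in> V. z (x + v) \<noteq> g x}) \<le> \<theta> * card V) \<and> (\<exists>x\<in>G. g x \<noteq> (0::real)) \<and>
        real (card {x \<in> G. z x \<noteq> 0}) \<le> C * card V" by blast
qed

end

section \<open>Choice of parameters\<close>

text \<open>\<open>l\<close> is of order \<open>ln M\<close> and \<open>k\<close> a power of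
  \<open>ln M\<close>, so every factor except the power of two in \<open>C\<close> is
  quasi-polynomial. With \<open>\<theta> = exp (- 4 * M)\<close> that power is at most the
  exponential of \<open>256 * M\<^sup>2 * (ln 2 + 4 * M)\<close>, about \<open>1024 * M ^ 3\<close>,
  and 2000 leaves room for the rest.\<close>

lemma parameters:
  "\<exists>M\<^sub>0 \<ge> 1. \<forall>M \<ge> M\<^sub>0. \<exists>(K::real) (l::nat) (k::nat) (j::nat) (\<theta>::real) (C::real).
    K = 16384 * (4 * M ^ 4) ^ 4 \<and> 2 ^ l \<ge> K \<and> real k \<ge> 256 * real l ^ 2 * ln (32 * l * K ^ 3) \<and>
    0 < \<theta> \<and> \<theta> \<le> 1/2 \<and> \<theta> * K ^ (2 * l + 5) < 1 \<and> real j \<ge> 2 * M \<and> 4 * M * \<theta> \<le> (1/2) ^ j / 8 \<and>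
    C = 32 * M ^ 4 * (2 * K ^ (k + 3 * (2 * l + 4))) ^ 16 * 2 powr (256 * M\<^sup>2 * ln (2 / \<theta>)) \<and>
    j * (8 * M * C) \<le> exp (2000 * M ^ 3)"
proof -
  define \<kappa> where "\<kappa> M = 16384 * (4 * M ^ 4) ^ 4" for M :: real
  \<comment> \<open>\<open>lr\<close> and \<open>kr\<close> are real majorants of \<open>l\<close>
    and \<open>k\<close> without ceilings, fit for asymptotic comparison; the added 1 pays for
    rounding up.\<close>
  define lr where "lr M = log 2 (\<kappa> M) + 1" for M
  define kr where "kr M = 256 * lr M ^ 2 * ln (32 * lr M * \<kappa> M ^ 3) + 1" for M
  have "\<forall>\<^sub>F M in at_top. (2 * lr M + 5) * ln (\<kappa> M) < 4 * M"
    unfolding lr_def \<kappa>_def by real_asymp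
  moreover have "\<forall>\<^sub>F M::real in at_top. 4 * M * exp (- 4 * M) \<le> exp (- ((2 * M + 1) * ln 2)) / 8"
    by real_asymp
  moreover have "\<forall>\<^sub>F M::real in at_top. (2 * M + 1) * (8 * M * (32 * M ^ 4)) \<le> exp M"
    by real_asymp
  moreover have "\<forall>\<^sub>F M in at_top. M + 16 * (ln 2 + (kr M + 6 * lr M + 12) * ln (\<kappa> M))
      + 256 * M\<^sup>2 * (ln 2 + 4 * M) \<le> 2000 * M ^ 3"
    unfolding kr_def lr_def \<kappa>_def by real_asymp
  moreover have "\<forall>\<^sub>F M::real in at_top. M \<ge> 1" by (rule eventually_ge_at_top)
  ultimately have "\<forall>\<^sub>F M in at_top. M \<ge> 1 \<and> (2 * lr M + 5) * ln (\<kappa> M) < 4 * M \<and>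
      4 * M * exp (- 4 * M) \<le> exp (- ((2 * M + 1) * ln 2)) / 8 \<and>
      (2 * M + 1) * (8 * M * (32 * M ^ 4)) \<le> exp M \<and>
      M + 16 * (ln 2 + (kr M + 6 * lr M + 12) * ln (\<kappa> M)) + 256 * M\<^sup>2 * (ln 2 + 4 * M) \<le> 2000 * M ^ 3"
    by eventually_elim auto
  then obtain M\<^sub>0 where M\<^sub>0: "\<And>M. M \<ge> M\<^sub>0 \<Longrightarrow> M \<ge> 1 \<and> (2 * lr M + 5) * ln (\<kappa> M) < 4 * M \<and>
      4 * M * exp (- 4 * M) \<le> exp (- ((2 * M + 1) * ln 2)) / 8 \<and>
      (2 * M + 1) * (8 * M * (32 * M ^ 4)) \<le> exp M \<and>
      M + 16 * (ln 2 + (kr M + 6 * lr M + 12) * ln (\<kappa> M)) + 256 * M\<^sup>2 * (ln 2 + 4 * M) \<le> 2000 * M ^ 3"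
    unfolding eventually_at_top_linorder by blast
  show ?thesis
  proof (rule exI[of _ "max M\<^sub>0 1"], intro conjI allI impI)
    fix M assume "max M\<^sub>0 1 \<le> M"
    then have M: "M \<ge> 1" and a1: "(2 * lr M + 5) * ln (\<kappa> M) < 4 * M"
      and a2: "4 * M * exp (- 4 * M) \<le> exp (- ((2 * M + 1) * ln 2)) / 8"
      and a3: "(2 * M + 1) * (8 * M * (32 * M ^ 4)) \<le> exp M"
      and a4: "M + 16 * (ln 2 + (kr M + 6 * lr M + 12) * ln (\<kappa> M)) + 256 * M\<^sup>2 * (ln 2 + 4 * M) \<le> 2000 * M ^ 3"
      using M\<^sub>0[of M] by auto
    define K where "K = \<kappa> M"
    have M4: "M ^ 4 \<ge> 1" using M by simp
    have "(4 * M ^ 4) ^ 4 \<ge> 1" using M4 by (intro one_le_power) simp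
    then have K: "K \<ge> 4" by (simp add: K_def \<kappa>_def)
    define l where "l = nat \<lceil>log 2 K\<rceil>"
    have lK: "log 2 K \<ge> 0" using K by simp
    have l_ge: "real l \<ge> log 2 K" and l_le: "real l \<le> lr M"
      using lK ceiling_correct[of "log 2 K"] by (auto simp: l_def lr_def K_def)
    have "K = 2 powr (log 2 K)" using K by simp
    also have "\<dots> \<le> 2 powr l" using l_ge by simp
    finally have l2: "2 ^ l \<ge> K" by (simp add: powr_realpow)
    have l1: "real l \<ge> 1" using l2 K by (cases l) auto
    have lnK: "ln K > 0" using K by simp
    define y where "y = 256 * real l ^ 2 * ln (32 * l * K ^ 3)"
    have K3: "K ^ 3 \<ge> 1" using K by (intro one_le_power) simp
    have "32 * real l * K ^ 3 \<ge> 32 * 1 * 1" using l1 K3 by (intro mult_mono) auto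
    then have lK3: "32 * real l * K ^ 3 > 1" by simp
    then have y0: "y \<ge> 0" by (simp add: y_def)
    define k where "k = nat \<lceil>y\<rceil>"
    have k_ge: "real k \<ge> y" and "real k \<le> y + 1"
      using y0 ceiling_correct[of y] by (auto simp: k_def)
    moreover have "y \<le> 256 * lr M ^ 2 * ln (32 * lr M * K ^ 3)"
    proof -
      have "ln (32 * l * K ^ 3) \<le> ln (32 * lr M * K ^ 3)"
        using l_le K lK3 by (intro ln_mono mult_right_mono) auto
      moreover have "real l ^ 2 \<le> lr M ^ 2" using l_le by (intro power_mono) auto
      moreover have "ln (32 * l * K ^ 3) \<ge> 0" using lK3 by simp
      ultimately show ?thesis unfolding y_def by (intro mult_mono) auto
    qed
    ultimately have k_le: "real k \<le> kr M" by (simp add: kr_def K_def)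
    \<comment> \<open>The rate 4 exceeds the \<open>2 * ln 2\<close> lost to doubling over about
      \<open>2 * M\<close> steps, and any exponential rate beats the quasi-polynomial
      \<open>K ^ (2 * l + 5)\<close>.\<close>
    define \<theta> where "\<theta> = exp (- 4 * M)"
    define j where "j = nat \<lceil>2 * M\<rceil>"
    have j_ge: "real j \<ge> 2 * M" and j_le: "real j \<le> 2 * M + 1"
      using M ceiling_correct[of "2 * M"] by (auto simp: j_def)
    have \<theta>1: "\<theta> \<le> 1/2"
    proof -
      have "2 \<le> exp (4 * M)" using exp_ge_add_one_self[of "4 * M"] M by linarith
      then have "2 * \<theta> \<le> exp (4 * M) * \<theta>" by (intro mult_right_mono) (auto simp: \<theta>_def)
      also have "\<dots> = 1" by (simp add: \<theta>_def exp_minus)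
      finally show ?thesis by simp
    qed
    have \<theta>2: "\<theta> * K ^ (2 * l + 5) < 1"
    proof -
      have "K ^ (2 * l + 5) = exp (ln K) ^ (2 * l + 5)" using K by simp
      also have "\<dots> = exp ((2 * real l + 5) * ln K)" unfolding exp_of_nat_mult[symmetric] by simp
      finally have "\<theta> * K ^ (2 * l + 5) = exp (- 4 * M + (2 * real l + 5) * ln K)"
        by (simp only: \<theta>_def exp_add)
      also have "\<dots> < 1"
      proof -
        have "(2 * real l + 5) * ln K \<le> (2 * lr M + 5) * ln K"
          using l_le lnK by (intro mult_right_mono) auto
        then show ?thesis using a1 by (simp add: K_def)
      qed
      finally show ?thesis .
    qed
    have \<theta>3: "4 * M * \<theta> \<le> (1/2) ^ j / 8"
    proof -
      have "exp (- ((2 * M + 1) * ln 2)) \<le> exp (- (real j * ln 2))" using j_le by simp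
      also have "\<dots> = exp (real j * ln (1/2))" by (simp add: ln_div)
      also have "\<dots> = (1/2) ^ j" unfolding exp_of_nat_mult by simp
      finally show ?thesis using a2 by (simp add: \<theta>_def)
    qed
    define p where "p = k + 3 * (2 * l + 4)"
    define C where "C = 32 * M ^ 4 * (2 * K ^ p) ^ 16 * 2 powr (256 * M\<^sup>2 * ln (2 / \<theta>))"
    have bound: "j * (8 * M * C) \<le> exp (2000 * M ^ 3)"
    proof -
      have "K ^ p = exp (ln K) ^ p" using K by simp
      also have "\<dots> = exp (real p * ln K)" unfolding exp_of_nat_mult ..
      finally have "2 * K ^ p = exp (ln 2 + real p * ln K)" by (simp add: exp_add)
      then have 1: "(2 * K ^ p) ^ 16 = exp (16 * (ln 2 + real p * ln K))"
        using exp_of_nat_mult[of 16 "ln 2 + real p * ln K"] by simp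
      have "real p \<le> kr M + 6 * lr M + 12" using k_le l_le by (simp add: p_def)
      then have "real p * ln K \<le> (kr M + 6 * lr M + 12) * ln K" using lnK by (intro mult_right_mono) auto
      then have 2: "(2 * K ^ p) ^ 16 \<le> exp (16 * (ln 2 + (kr M + 6 * lr M + 12) * ln K))"
        unfolding 1 by simp
      have "ln (2 / \<theta>) = ln 2 + 4 * M" by (simp add: \<theta>_def ln_div)
      then have "2 powr (256 * M\<^sup>2 * ln (2 / \<theta>)) = exp (256 * M\<^sup>2 * (ln 2 + 4 * M) * ln 2)"
        by (simp add: powr_def)
      also have "\<dots> \<le> exp (256 * M\<^sup>2 * (ln 2 + 4 * M))"
      proof -
        have "256 * M\<^sup>2 * (ln 2 + 4 * M) * ln 2 \<le> 256 * M\<^sup>2 * (ln 2 + 4 * M) * 1"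
          using M ln_2_less_1 by (intro mult_left_mono mult_nonneg_nonneg) auto
        then show ?thesis by simp
      qed
      finally have 3: "2 powr (256 * M\<^sup>2 * ln (2 / \<theta>)) \<le> exp (256 * M\<^sup>2 * (ln 2 + 4 * M))" .
      have "j * (8 * M * C) = (real j * (8 * M * (32 * M ^ 4))) * (2 * K ^ p) ^ 16 * 2 powr (256 * M\<^sup>2 * ln (2 / \<theta>))"
        by (simp add: C_def)
      also have "\<dots> \<le> exp M * exp (16 * (ln 2 + (kr M + 6 * lr M + 12) * ln K)) * exp (256 * M\<^sup>2 * (ln 2 + 4 * M))"
      proof (intro mult_mono 2 3)
        have "real j * (8 * M * (32 * M ^ 4)) \<le> (2 * M + 1) * (8 * M * (32 * M ^ 4))"
          using j_le M by (intro mult_right_mono) auto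
        then show "real j * (8 * M * (32 * M ^ 4)) \<le> exp M" using a3 by linarith
      qed (use M K in auto)
      also have "\<dots> = exp (M + 16 * (ln 2 + (kr M + 6 * lr M + 12) * ln K) + 256 * M\<^sup>2 * (ln 2 + 4 * M))"
        by (simp only: exp_add)
      also have "\<dots> \<le> exp (2000 * M ^ 3)" using a4 by (simp only: exp_le_cancel_iff K_def)
      finally show ?thesis .
    qed
    show "\<exists>(K::real) (l::nat) (k::nat) (j::nat) (\<theta>::real) (C::real).
      K = 16384 * (4 * M ^ 4) ^ 4 \<and> 2 ^ l \<ge> K \<and> real k \<ge> 256 * real l ^ 2 * ln (32 * l * K ^ 3) \<and>
      0 < \<theta> \<and> \<theta> \<le> 1/2 \<and> \<theta> * K ^ (2 * l + 5) < 1 \<and> real j \<ge> 2 * M \<and> 4 * M * \<theta> \<le> (1/2) ^ j / 8 \<and>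
      C = 32 * M ^ 4 * (2 * K ^ (k + 3 * (2 * l + 4))) ^ 16 * 2 powr (256 * M\<^sup>2 * ln (2 / \<theta>)) \<and>
      j * (8 * M * C) \<le> exp (2000 * M ^ 3)"
      by (intro exI[of _ K] exI[of _ l] exI[of _ k] exI[of _ j] exI[of _ \<theta>] exI[of _ C] conjI
          l2 \<theta>1 \<theta>2 \<theta>3 j_ge bound)
        (use k_ge in \<open>simp_all add: K_def \<kappa>_def y_def \<theta>_def C_def p_def\<close>)
  qed simp
qed

section \<open>Transfer to bit vectors\<close>

text \<open>Vectors of all dimensions share one type, whereas the locale asks for a group structure
  on the whole type. Functions from naturals to bits have it pointwise; padding by zero embeds
  \<open>F2 n\<close> as \<open>F2_fun n\<close>.\<close>

definition vec_fun :: "bit vec \<Rightarrow> nat \<Rightarrow> bit" where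
  "vec_fun v = (\<lambda>i. if i < dim_vec v then v $ i else 0)"

definition F2_fun :: "nat \<Rightarrow> (nat \<Rightarrow> bit) set" where
  "F2_fun n = {x. \<forall>i\<ge>n. x i = 0}"

definition F2_char :: "nat \<Rightarrow> (nat \<Rightarrow> bit) \<Rightarrow> (nat \<Rightarrow> bit) \<Rightarrow> real" where
  "F2_char n r x = (if (\<Sum>i<n. r i * x i) = 0 then 1 else -1)"

lemma bit_add_self: "b + b = (0::bit)"
  by (cases b) auto

lemma F2_pairing_fun: "F2_pairing (F2_fun n) (F2_char n)"
proof
  show "x + x = 0" for x :: "nat \<Rightarrow> bit" by (rule ext) (simp add: bit_add_self)
  show "finite (F2_fun n)"
  proof (rule finite_subset)
    show "F2_fun n \<subseteq> (\<lambda>A i. if i \<in> A then 1 else 0) ` Pow {..<n}"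
    proof
      fix x assume x: "x \<in> F2_fun n"
      have "x = (\<lambda>i. if i \<in> {i. i < n \<and> x i = 1} then 1 else 0)"
      proof (rule ext)
        fix i show "x i = (if i \<in> {i. i < n \<and> x i = 1} then 1 else 0)"
          using x by (cases "x i"; cases "i < n") (auto simp: F2_fun_def)
      qed
      then show "x \<in> (\<lambda>A i. if i \<in> A then 1 else 0) ` Pow {..<n}" by (rule image_eqI) auto
    qed
  qed simp
  show "0 \<in> F2_fun n" by (simp add: F2_fun_def)
  show "x + y \<in> F2_fun n" if "x \<in> F2_fun n" "y \<in> F2_fun n" for x y
    using that by (simp add: F2_fun_def)
  show "F2_char n r x = F2_char n x r" for r x
  proof -
    have "(\<Sum>i<n. r i * x i) = (\<Sum>i<n. x i * r i)" by (rule sum.cong[OF refl], rule mult.commute)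
    then show ?thesis by (simp only: F2_char_def)
  qed
  show "F2_char n r (x + y) = F2_char n r x * F2_char n r y" for r x y
  proof -
    have "(\<Sum>i<n. r i * (x + y) i) = (\<Sum>i<n. r i * x i) + (\<Sum>i<n. r i * y i)"
      by (simp only: plus_fun_apply distrib_left sum.distrib)
    moreover have "(if a + b = 0 then 1 else - 1 :: real) = (if a = 0 then 1 else - 1) * (if b = 0 then 1 else - 1)"
      for a b :: bit by (cases a; cases b) auto
    ultimately show ?thesis by (simp only: F2_char_def)
  qed
  show "F2_char n r x = 1 \<or> F2_char n r x = - 1" for r x by (simp add: F2_char_def)
  show "\<exists>x\<in>F2_fun n. F2_char n r x = - 1" if "r \<in> F2_fun n" "r \<noteq> 0" for r
  proof -
    obtain i where i: "r i \<noteq> 0" using \<open>r \<noteq> 0\<close> by (auto simp: fun_eq_iff)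
    have "i < n" using i that(1) by (auto simp: F2_fun_def not_le[symmetric])
    define x :: "nat \<Rightarrow> bit" where "x j = (if j = i then 1 else 0)" for j
    have "(\<Sum>j<n. r j * x j) = r i" using \<open>i < n\<close> by (simp add: x_def if_distrib cong: if_cong)
    then have "F2_char n r x = - 1" using i by (simp add: F2_char_def)
    moreover have "x \<in> F2_fun n" using \<open>i < n\<close> by (simp add: F2_fun_def x_def)
    ultimately show ?thesis by blast
  qed
qed

lemma vec_fun_vec: "x \<in> F2_fun n \<Longrightarrow> vec_fun (vec n x) = x"
  by (rule ext) (auto simp: vec_fun_def F2_fun_def)

lemma vec_vec_fun: "v \<in> F2 n \<Longrightarrow> vec n (vec_fun v) = v"
  by (rule eq_vecI) (auto simp: vec_fun_def)

lemma vec_fun_in: "v \<in> F2 n \<Longrightarrow> vec_fun v \<in> F2_fun n"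
  by (auto simp: vec_fun_def F2_fun_def)

lemma bij_vec_fun: "bij_betw vec_fun (F2 n) (F2_fun n)"
  by (rule bij_betwI[where g = "vec n"]) (auto simp: vec_fun_vec vec_vec_fun vec_fun_in)

lemma vec_fun_add: "v \<in> F2 n \<Longrightarrow> w \<in> F2 n \<Longrightarrow> vec_fun (v + w) = vec_fun v + vec_fun w"
  by (rule ext) (auto simp: vec_fun_def)

lemma F2_char_vec_fun:
  assumes "r \<in> F2 n" "x \<in> F2 n"
  shows "(- 1) ^ (of_bit (r \<bullet> x) :: nat) = F2_char n (vec_fun r) (vec_fun x)"
proof -
  have "r \<bullet> x = (\<Sum>i<n. vec_fun r i * vec_fun x i)"
    unfolding scalar_prod_def using assms by (auto simp: vec_fun_def atLeast0LessThan intro!: sum.cong)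
  then show ?thesis by (cases "r \<bullet> x") (auto simp: F2_char_def)
qed

lemma spectral_norm_eq_anorm:
  "spectral_norm n f = F2_pairing.anorm (F2_fun n) (F2_char n) (\<lambda>x. f (vec n x))"
proof -
  interpret F2_pairing "F2_fun n" "F2_char n" by (rule F2_pairing_fun)
  have "fourier_transform n f r = hat (\<lambda>x. f (vec n x)) (vec_fun r)" if r: "r \<in> F2 n" for r
  proof -
    have "(\<Sum>x\<in>F2_fun n. f (vec n x) * F2_char n (vec_fun r) x)
        = (\<Sum>x\<in>F2 n. f (vec n (vec_fun x)) * F2_char n (vec_fun r) (vec_fun x))"
      by (rule sum.reindex_bij_betw[OF bij_vec_fun, symmetric])
    also have "\<dots> = (\<Sum>x\<in>F2 n. f x * (- 1) ^ (of_bit (r \<bullet> x) :: nat))"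
      by (rule sum.cong) (simp_all only: vec_vec_fun F2_char_vec_fun[OF r])
    finally show ?thesis
      unfolding fourier_transform_def hat_def by (simp add: bij_betw_same_card[OF bij_vec_fun])
  qed
  then have "spectral_norm n f = (\<Sum>r\<in>F2 n. \<bar>hat (\<lambda>x. f (vec n x)) (vec_fun r)\<bar>)"
    by (simp add: spectral_norm_def)
  also have "\<dots> = anorm (\<lambda>x. f (vec n x))"
    unfolding anorm_def by (rule sum.reindex_bij_betw[OF bij_vec_fun])
  finally show ?thesis .
qed

lemma subspace_F2_vimage:
  assumes "F2_pairing.sub (F2_fun n) V"
  shows "subspace_F2 n {v \<in> F2 n. vec_fun v \<in> V}"
proof -
  interpret F2_pairing "F2_fun n" "F2_char n" by (rule F2_pairing_fun)
  have zero: "vec_fun (0\<^sub>v n) = 0" by (rule ext) (simp add: vec_fun_def)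
  have vs: "vectorspace class_ring (module_vec TYPE(bit) n)" by (rule vec_vs)
  have "submodule class_ring {v \<in> F2 n. vec_fun v \<in> V} (module_vec TYPE(bit) n)"
  proof (rule submodule.intro)
    show "{v \<in> F2 n. vec_fun v \<in> V} \<subseteq> carrier (module_vec TYPE(bit) n)"
      by (auto simp: module_vec_def)
    show "v \<oplus>\<^bsub>module_vec TYPE(bit) n\<^esub> w \<in> {v \<in> F2 n. vec_fun v \<in> V}"
      if "v \<in> {v \<in> F2 n. vec_fun v \<in> V}" "w \<in> {v \<in> F2 n. vec_fun v \<in> V}" for v w
      using that subD(3)[OF assms] by (auto simp: module_vec_def vec_fun_add)
    show "\<zero>\<^bsub>module_vec TYPE(bit) n\<^esub> \<in> {v \<in> F2 n. vec_fun v \<in> V}"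
      using subD(2)[OF assms] by (simp add: module_vec_def zero)
    show "c \<odot>\<^bsub>module_vec TYPE(bit) n\<^esub> v \<in> {v \<in> F2 n. vec_fun v \<in> V}"
      if "v \<in> {v \<in> F2 n. vec_fun v \<in> V}" for c v
    \<comment> \<open>The only scalars are 0 and 1, so containing zero already gives closure under
      scaling.\<close>
    proof (cases c)
      case zero
      then have "c \<cdot>\<^sub>v v = 0\<^sub>v n" using that by auto
      then show ?thesis using subD(2)[OF assms] \<open>vec_fun (0\<^sub>v n) = 0\<close> by (simp add: module_vec_def)
    next
      case one
      then have "c \<cdot>\<^sub>v v = v" by auto
      then show ?thesis using that by (simp add: module_vec_def)
    qed
  qed (use vs in \<open>simp add: vectorspace_def\<close>)
  with vs show ?thesis by (simp add: VectorSpace.subspace_def)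
qed

theorem theorem1p1:
  fixes \<delta> :: real
  assumes "\<delta> > 0"
  shows "\<exists>M\<^sub>0 :: real. \<forall>M \<ge> M\<^sub>0. \<forall>n :: nat. \<forall>f :: bit vec \<Rightarrow> real.
    n > 0 \<longrightarrow> (\<forall>x \<in> F2 n. f x \<in> \<int>) \<longrightarrow> spectral_norm n f \<le> M \<longrightarrow>
    (\<exists>(L :: nat) (V :: nat \<Rightarrow> bit vec set) (\<epsilon> :: nat \<Rightarrow> real).
      (\<forall>i \<in> {1..L}. subspace_F2 n (V i)) \<and>
      (\<forall>i \<in> {1..L}. \<epsilon> i \<in> {- 1, 1}) \<and>
      (\<forall>x \<in> F2 n. f x = (\<Sum>i = 1..L. \<epsilon> i * indicator (V i) x)) \<and>
      real L \<le> exp (M powr (3 + \<delta>)))"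
proof -
  obtain M\<^sub>0 where M\<^sub>0: "M\<^sub>0 \<ge> 1" "\<forall>M \<ge> M\<^sub>0. \<exists>(K::real) (l::nat) (k::nat) (j::nat) (\<theta>::real) (C::real).
    K = 16384 * (4 * M ^ 4) ^ 4 \<and> 2 ^ l \<ge> K \<and> real k \<ge> 256 * real l ^ 2 * ln (32 * l * K ^ 3) \<and>
    0 < \<theta> \<and> \<theta> \<le> 1/2 \<and> \<theta> * K ^ (2 * l + 5) < 1 \<and> real j \<ge> 2 * M \<and> 4 * M * \<theta> \<le> (1/2) ^ j / 8 \<and>
    C = 32 * M ^ 4 * (2 * K ^ (k + 3 * (2 * l + 4))) ^ 16 * 2 powr (256 * M\<^sup>2 * ln (2 / \<theta>)) \<and>
    j * (8 * M * C) \<le> exp (2000 * M ^ 3)"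
    using parameters by (elim exE conjE) (rule that)
  \<comment> \<open>The second entry ensures \<open>2000 \<le> M powr \<delta>\<close>, which
    absorbs the constant of the cubic exponent.\<close>
  define M\<^sub>1 where "M\<^sub>1 = max M\<^sub>0 (2000 powr (1 / \<delta>))"
  show ?thesis
  proof (intro exI[of _ M\<^sub>1] allI impI)
    fix M :: real and n :: nat and f :: "bit vec \<Rightarrow> real"
    assume M1: "M\<^sub>1 \<le> M" and f: "\<forall>x \<in> F2 n. f x \<in> \<int>" and norm: "spectral_norm n f \<le> M"
    have "M\<^sub>0 \<le> M" and \<delta>: "2000 powr (1 / \<delta>) \<le> M" using M1 by (auto simp: M\<^sub>1_def)
    then have M: "M \<ge> 1" using M\<^sub>0(1) by simp
    obtain K l k j \<theta> C where par: "K = 16384 * (4 * M ^ 4) ^ 4" "2 ^ l \<ge> K"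
      "real k \<ge> 256 * real l ^ 2 * ln (real (32 * l) * K ^ 3)"
      "0 < \<theta>" "\<theta> \<le> 1/2" "\<theta> * K ^ (2 * l + 5) < 1" "real j \<ge> 2 * M" "4 * M * \<theta> \<le> (1/2) ^ j / 8"
      "C = 32 * M ^ 4 * (2 * K ^ (k + 3 * (2 * l + 4))) ^ 16 * 2 powr (256 * M\<^sup>2 * ln (2 / \<theta>))"
      and bound: "j * (8 * M * C) \<le> exp (2000 * M ^ 3)"
      using M\<^sub>0(2)[rule_format, OF \<open>M\<^sub>0 \<le> M\<close>] by (elim exE conjE) (rule that)
    interpret F2_pairing "F2_fun n" "F2_char n" by (rule F2_pairing_fun)
    have "signed_rep (j * (8 * M * C)) (\<lambda>x. f (vec n x))"
    proof (rule signed_rep_of_integer_valued[OF M _ _ par])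
      show "anorm (\<lambda>x. f (vec n x)) \<le> M" using norm by (simp add: spectral_norm_eq_anorm)
      show "\<forall>x\<in>F2_fun n. f (vec n x) \<in> \<int>" using f by simp
    qed
    then obtain ws :: "(real \<times> (nat \<Rightarrow> bit) set) list" where
      len: "real (length ws) \<le> j * (8 * M * C)" and
      ws: "\<forall>w\<in>set ws. fst w \<in> {-1, 1} \<and> sub (snd w)" and
      rep: "\<forall>x\<in>F2_fun n. f (vec n x) = (\<Sum>w\<leftarrow>ws. fst w * (if x \<in> snd w then 1 else 0))"
      unfolding signed_rep_def by blast
    \<comment> \<open>The list is indexed from 0, the required sum from 1.\<close>
    define V where "V i = {v \<in> F2 n. vec_fun v \<in> snd (ws ! (i - 1))}" for i
    define \<epsilon> where "\<epsilon> i = fst (ws ! (i - 1))" for i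
    have in_ws: "ws ! (i - 1) \<in> set ws" if "i \<in> {1..length ws}" for i using that by (intro nth_mem) auto
    show "\<exists>(L :: nat) (V :: nat \<Rightarrow> bit vec set) (\<epsilon> :: nat \<Rightarrow> real).
      (\<forall>i \<in> {1..L}. subspace_F2 n (V i)) \<and>
      (\<forall>i \<in> {1..L}. \<epsilon> i \<in> {- 1, 1}) \<and>
      (\<forall>x \<in> F2 n. f x = (\<Sum>i = 1..L. \<epsilon> i * indicator (V i) x)) \<and>
      real L \<le> exp (M powr (3 + \<delta>))"
    proof (intro exI[of _ "length ws"] exI[of _ V] exI[of _ \<epsilon>] conjI ballI)
      show "subspace_F2 n (V i)" if "i \<in> {1..length ws}" for i
        unfolding V_def by (rule subspace_F2_vimage) (use ws in_ws[OF that] in blast)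
      show "\<epsilon> i \<in> {- 1, 1}" if "i \<in> {1..length ws}" for i
        unfolding \<epsilon>_def using ws in_ws[OF that] by blast
      show "f x = (\<Sum>i = 1..length ws. \<epsilon> i * indicator (V i) x)" if x: "x \<in> F2 n" for x
      proof -
        have "f x = f (vec n (vec_fun x))" using x by (simp add: vec_vec_fun)
        also have "\<dots> = (\<Sum>w\<leftarrow>ws. fst w * (if vec_fun x \<in> snd w then 1 else 0))"
          using rep vec_fun_in[OF x] by blast
        also have "\<dots> = (\<Sum>i<length ws. fst (ws ! i) * (if vec_fun x \<in> snd (ws ! i) then 1 else 0))"
          by (simp add: sum_list_sum_nth atLeast0LessThan)
        also have "\<dots> = (\<Sum>i<length ws. \<epsilon> (Suc i) * indicator (V (Suc i)) x)"
          by (rule sum.cong) (use x in \<open>auto simp: \<epsilon>_def V_def\<close>)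
        also have "\<dots> = (\<Sum>i = 1..length ws. \<epsilon> i * indicator (V i) x)"
          by (simp add: sum.atLeast1_atMost_eq lessThan_Suc_atMost)
        finally show ?thesis .
      qed
      have "2000 = (2000 powr (1 / \<delta>)) powr \<delta>" using assms by (simp add: powr_powr)
      also have "\<dots> \<le> M powr \<delta>" using \<delta> assms by (intro powr_mono2) auto
      finally have "2000 * M ^ 3 \<le> M powr \<delta> * M ^ 3" using M by (intro mult_right_mono) auto
      also have "\<dots> = M powr (3 + \<delta>)" using M by (simp add: powr_add powr_numeral)
      finally have "exp (2000 * M ^ 3) \<le> exp (M powr (3 + \<delta>))" by simp
      then show "real (length ws) \<le> exp (M powr (3 + \<delta>))" using len bound by linarith
    qed
  qed
qed

end
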